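(* Let $\mathcal{A}$ be the universal rotation algebra, with unitary generators $U,V,Z$, and let $\mathcal{A}_0$ be the $*$-subalgebra generated by $U$, $V$ and $Z$. Fix $c_1,c_2\in\mathbb{C}$ and let $$\phi:\mathcal{A}_0\to\mathcal{A}_0\otimes\mathcal{B}(\mathbb{C}^2);\quad x\mapsto\begin{bmatrix}\tau(x)&\delta^\dagger(x)\\ \delta(x)&0\end{bmatrix},$$ where $\delta=c_1\delta_1+c_2\delta_2$, $\delta^\dagger(x):=\delta(x^* )^*$ and, by linear extension, for all $m,n,p\in\mathbb{Z}$, $$\delta_1(U^mV^nZ^p)=mU^mV^nZ^p,\qquad\delta_2(U^mV^nZ^p)=nU^mV^nZ^p,$$ $$\tau(U^mV^nZ^p)=-\bigl(\tfrac12|c_1|^2m^2+\tfrac12|c_2|^2n^2+\overline{c_1}c_2mn+(\overline{c_1}c_2-c_1\overline{c_2})p\bigr)U^mV^nZ^p.$$ There exists an adapted family $j=(j_t)_{t\ge0}$ of unital $*$-homomorphisms from $\mathcal{A}$ to $\mathcal{B}(\mathsf{h}\bar\otimes\mathcal{F})$ such that $$\langle u\varepsilon(f),j_t(x)v\varepsilon(g)\rangle=\langle u\varepsilon(f),(xv)\varepsilon(g)\rangle+\int_0^t\langle u\varepsilon(f),j_s\bigl(\phi^{\widehat{f}(s)}_{\widehat{g}(s)}(x)\bigr)v\varepsilon(g)\rangle\,ds$$ for all $u,v\in\mathsf{h}$, $f,g\in L^2(\mathbb{R}_+;\mathbb{C})$, $x\in\mathcal{A}_0$ and $t\ge0$.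
   Context: The universal rotation algebra is the universal $C^*$-algebra with unitary generators $U,V,Z$ satisfying $UV=ZVU$, $UZ=ZU$ and $VZ=ZV$ (the group $C^*$-algebra of the discrete Heisenberg group); $\{U^mV^nZ^p:m,n,p\in\mathbb{Z}\}$ is a basis of $\mathcal{A}_0$. It is identified with a $C^*$-subalgebra of $\mathcal{B}(\mathsf{h})$, $\mathsf{h}:=\ell^2(\mathbb{Z}^3)$, via $(Uu)_{m,n,p}=u_{m+1,n,p}$, $(Vu)_{m,n,p}=u_{m,n+1,m+p}$ and $(Zu)_{m,n,p}=u_{m,n,p+1}$. Inner products are linear in the second variable; $\otimes$ is the algebraic and $\bar\otimes$ the Hilbert-space tensor product; $|\xi\rangle:\lambda\mapsto\lambda\xi$, $\langle\xi|:\eta\mapsto\langle\xi,\eta\rangle$. The multiplicity space is $\mathsf{k}=\mathbb{C}$ and $\widehat{\mathsf{k}}=\mathbb{C}\oplus\mathsf{k}=\mathbb{C}^2$. For $\xi,\chi\in\widehat{\mathsf{k}}$, $\phi^\xi_\chi(x):=(1_{\mathsf{h}}\otimes\langle\xi|)\phi(x)(1_{\mathsf{h}}\otimes|\chi\rangle)$. $\mathcal{F}$ is Boson Fock space over $L^2(\mathbb{R}_+;\mathsf{k})$ with exponential vectors $\varepsilon(f)$, $\langle\varepsilon(f),\varepsilon(g)\rangle=e^{\langle f,g\rangle}$; $u\varepsilon(f):=u\otimes\varepsilon(f)$; $\widehat{f}(t):=(1,f(t))\in\widehat{\mathsf{k}}$; $f_{t)}:=1_{[0,t)}f$, $f_{[t}:=1_{[t,\infty)}f$.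 Adapted means $\langle u\varepsilon(f),j_t(a)v\varepsilon(g)\rangle=\langle u\varepsilon(f_{t)}),j_t(a)v\varepsilon(g_{t)})\rangle\langle\varepsilon(f_{[t}),\varepsilon(g_{[t})\rangle$ for all $u,v,f,g,t$ and $a\in\mathcal{A}$. *)

theory Defs
  imports "HOL-Analysis.Analysis"
begin

section \<open>Complex inner-product spaces\<close>

text \<open>The norm, and hence the topology and the operator norm, is that of the underlying real
  inner-product space.  Inner products are linear in the second variable.\<close>

class complex_inner = real_inner +
  fixes scaleC :: "complex \<Rightarrow> 'a \<Rightarrow> 'a"  (infixr \<open>*\<^sub>C\<close> 75)
    and cinner :: "'a \<Rightarrow> 'a \<Rightarrow> complex"
  assumes scaleC_add_right: "a *\<^sub>C (x + y) = a *\<^sub>C x + a *\<^sub>C y"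
    and scaleC_add_left: "(a + b) *\<^sub>C x = a *\<^sub>C x + b *\<^sub>C x"
    and scaleC_scaleC: "a *\<^sub>C b *\<^sub>C x = (a * b) *\<^sub>C x"
    and scaleR_scaleC: "scaleR r x = complex_of_real r *\<^sub>C x"
    and cinner_commute: "cinner x y = cnj (cinner y x)"
    and cinner_add_right: "cinner x (y + z) = cinner x y + cinner x z"
    and cinner_scaleC_right: "cinner x (a *\<^sub>C y) = a * cinner x y"
    and inner_cinner: "inner x y = Re (cinner x y)"

instantiation complex :: complex_inner
begin
definition "scaleC_complex (a::complex) (x::complex) = a * x"
definition "cinner_complex (x::complex) (y::complex) = cnj x * y"
instance
  by standard (auto simp: scaleC_complex_def cinner_complex_def algebra_simps inner_complex_def
      scaleR_conv_of_real)
end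

lemma cinner_add_left: "cinner (x + y) z = cinner x z + cinner y (z::'a::complex_inner)"
  by (metis cinner_add_right cinner_commute complex_cnj_add)

lemma cinner_scaleC_left: "cinner (a *\<^sub>C x) y = cnj a * cinner x (y::'a::complex_inner)"
  by (metis cinner_scaleC_right cinner_commute complex_cnj_mult)

lemma scaleC_one [simp]: "1 *\<^sub>C x = (x::'a::complex_inner)"
  using scaleR_scaleC[of 1 x] by simp

lemma scaleC_zero_left [simp]: "0 *\<^sub>C x = (0::'a::complex_inner)"
  using scaleR_scaleC[of 0 x] by simp

lemma cinner_self: "cinner x x = complex_of_real ((norm (x::'a::complex_inner))\<^sup>2)"
proof (rule complex_eqI)
  show "Re (cinner x x) = Re (complex_of_real ((norm x)\<^sup>2))"
    by (simp add: inner_cinner[symmetric] power2_norm_eq_inner)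
  have "cinner x x = cnj (cinner x x)" by (rule cinner_commute)
  then show "Im (cinner x x) = Im (complex_of_real ((norm x)\<^sup>2))"
    by (simp add: complex_eq_iff)
qed

lemma norm_scaleC: "norm (a *\<^sub>C (x::'a::complex_inner)) = cmod a * norm x"
proof -
  have "cinner (a *\<^sub>C x) (a *\<^sub>C x) = (a * cnj a) * cinner x x"
    by (simp add: cinner_scaleC_left cinner_scaleC_right)
  then have "complex_of_real ((norm (a *\<^sub>C x))\<^sup>2) = complex_of_real ((cmod a * norm x)\<^sup>2)"
    by (simp only: cinner_self complex_norm_square[symmetric] power_mult_distrib of_real_mult)
  then have "(norm (a *\<^sub>C x))\<^sup>2 = (cmod a * norm x)\<^sup>2"
    using of_real_eq_iff by blast
  then show ?thesis by (simp add: power2_eq_iff_nonneg)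
qed

lemma norm_cinner_le: "cmod (cinner x y) \<le> norm x * norm (y::'a::complex_inner)"
proof (cases "cinner x y = 0")
  case False
  define c where "c = cnj (sgn (cinner x y))"
  have c: "cmod c = 1" using False by (simp add: c_def norm_sgn)
  have "c * cinner x y = complex_of_real (cmod (cinner x y))"
    using False by (simp add: c_def sgn_div_norm scaleR_conv_of_real field_simps
        complex_norm_square[symmetric] power2_eq_square)
  then have "cmod (cinner x y) = inner x (c *\<^sub>C y)"
    by (simp add: inner_cinner cinner_scaleC_right)
  also have "\<dots> \<le> norm x * norm (c *\<^sub>C y)" by (rule norm_cauchy_schwarz)
  finally show ?thesis by (simp add: norm_scaleC c)
qed simp

lemma bounded_linear_scaleC: "bounded_linear ((*\<^sub>C) c :: 'a::complex_inner \<Rightarrow> 'a)"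
proof (rule bounded_linear_intro[where K = "cmod c"])
  show "c *\<^sub>C (r *\<^sub>R x) = r *\<^sub>R (c *\<^sub>C x)" for r and x :: 'a
    by (simp add: scaleR_scaleC scaleC_scaleC mult.commute)
qed (auto simp: scaleC_add_right norm_scaleC mult.commute)


section \<open>Operators\<close>

text \<open>Bounded operators are the complex-linear members of the library type of real-linear
  bounded operators.  The operator \<open>cscale c\<close> is multiplication by \<open>c\<close>, so that
  \<open>cscale c o\<^sub>L T\<close> is the scalar multiple \<open>c T\<close>.\<close>

definition clinear_op :: "('a::complex_inner \<Rightarrow>\<^sub>L 'b::complex_inner) \<Rightarrow> bool" where
  "clinear_op T \<longleftrightarrow> (\<forall>c x. T (c *\<^sub>C x) = c *\<^sub>C T x)"

lift_definition cscale :: "complex \<Rightarrow> 'a::complex_inner \<Rightarrow>\<^sub>L 'a" is "\<lambda>c x. c *\<^sub>C x"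
  by (rule bounded_linear_scaleC)

definition adj :: "('a::complex_inner \<Rightarrow>\<^sub>L 'b::complex_inner) \<Rightarrow> 'b \<Rightarrow>\<^sub>L 'a" where
  "adj T = (THE S :: 'b \<Rightarrow>\<^sub>L 'a. \<forall>x y. cinner (S x) y = cinner x (T y))"

lemma cinner_eqI:
  assumes "\<And>y. cinner x y = cinner x' (y::'a::complex_inner)" shows "x = x'"
proof -
  have "inner (x - x') (x - x') = 0"
    unfolding inner_diff_left unfolding inner_cinner assms by simp
  then show ?thesis by simp
qed

lemma adj_eqI:
  fixes T :: "'a::complex_inner \<Rightarrow>\<^sub>L 'b::complex_inner" and S :: "'b \<Rightarrow>\<^sub>L 'a"
  assumes "\<And>x y. cinner (S x) y = cinner x (T y)" shows "adj T = S"
  unfolding adj_def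
proof (rule the_equality)
  fix S' :: "'b \<Rightarrow>\<^sub>L 'a"
  assume "\<forall>x y. cinner (blinfun_apply S' x) y = cinner x (blinfun_apply T y)"
  then have "cinner (S' x) y = cinner (S x) y" for x y using assms by simp
  then show "S' = S" by (intro blinfun_eqI) (rule cinner_eqI)
qed (use assms in simp)

inductive_set star_algebra :: "('a::complex_inner \<Rightarrow>\<^sub>L 'a) set \<Rightarrow> ('a \<Rightarrow>\<^sub>L 'a) set"
  for G where
  gen: "a \<in> G \<Longrightarrow> a \<in> star_algebra G"
| add: "a \<in> star_algebra G \<Longrightarrow> b \<in> star_algebra G \<Longrightarrow> a + b \<in> star_algebra G"
| scale: "a \<in> star_algebra G \<Longrightarrow> cscale c o\<^sub>L a \<in> star_algebra G"
| mult: "a \<in> star_algebra G \<Longrightarrow> b \<in> star_algebra G \<Longrightarrow> a o\<^sub>L b \<in> star_algebra G"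
| star: "a \<in> star_algebra G \<Longrightarrow> adj a \<in> star_algebra G"

definition unital_star_hom ::
  "('a::complex_inner \<Rightarrow>\<^sub>L 'a) set \<Rightarrow> (('a \<Rightarrow>\<^sub>L 'a) \<Rightarrow> ('b::complex_inner \<Rightarrow>\<^sub>L 'b)) \<Rightarrow> bool" where
  "unital_star_hom A \<pi> \<longleftrightarrow>
     (\<forall>a\<in>A. clinear_op (\<pi> a)) \<and>
     (\<forall>a\<in>A. \<forall>b\<in>A. \<pi> (a + b) = \<pi> a + \<pi> b) \<and>
     (\<forall>c. \<forall>a\<in>A. \<pi> (cscale c o\<^sub>L a) = cscale c o\<^sub>L \<pi> a) \<and>
     (\<forall>a\<in>A. \<forall>b\<in>A. \<pi> (a o\<^sub>L b) = \<pi> a o\<^sub>L \<pi> b) \<and>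
     (\<forall>a\<in>A. \<pi> (adj a) = adj (\<pi> a)) \<and>
     \<pi> id_blinfun = id_blinfun"

text \<open>Negative powers of a unitary are powers of its adjoint.\<close>

definition unitary_power :: "('a::complex_inner \<Rightarrow>\<^sub>L 'a) \<Rightarrow> int \<Rightarrow> ('a \<Rightarrow>\<^sub>L 'a)" where
  "unitary_power T m = (if m \<ge> 0 then ((\<lambda>S. T o\<^sub>L S) ^^ nat m) id_blinfun
                        else ((\<lambda>S. adj T o\<^sub>L S) ^^ nat (- m)) id_blinfun)"


section \<open>Square-summable families\<close>

text \<open>\<open>('i, 'a) ell2\<close> is the Hilbert-space direct sum of copies of \<open>'a\<close> indexed by \<open>'i\<close>: it is
  \<open>\<ell>\<^sup>2('i)\<close> if \<open>'a\<close> is \<open>complex\<close>, and a realization of the Hilbert-space tensor product of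
  \<open>\<ell>\<^sup>2('i)\<close> with \<open>'a\<close> in general.\<close>

typedef (overloaded) ('i, 'a::complex_inner) ell2 =
  "{x :: 'i \<Rightarrow> 'a. (\<lambda>i. (norm (x i))\<^sup>2) summable_on UNIV}"
  morphisms ell2_nth Abs_ell2
  by (rule exI[of _ "\<lambda>_. 0"]) simp

setup_lifting type_definition_ell2

lemma square_summable_add:
  fixes x y :: "'i \<Rightarrow> 'a::real_normed_vector"
  assumes "(\<lambda>i. (norm (x i))\<^sup>2) summable_on UNIV" "(\<lambda>i. (norm (y i))\<^sup>2) summable_on UNIV"
  shows "(\<lambda>i. (norm (x i + y i))\<^sup>2) summable_on UNIV"
proof (rule summable_on_comparison_test)
  show "(\<lambda>i. 2 * ((norm (x i))\<^sup>2 + (norm (y i))\<^sup>2)) summable_on UNIV"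
    by (intro summable_on_cmult_right summable_on_add assms)
  show "(norm (x i + y i))\<^sup>2 \<le> 2 * ((norm (x i))\<^sup>2 + (norm (y i))\<^sup>2)" for i
  proof -
    have "(norm (x i + y i))\<^sup>2 \<le> (norm (x i) + norm (y i))\<^sup>2"
      by (intro power_mono norm_triangle_ineq) auto
    also have "\<dots> \<le> 2 * ((norm (x i))\<^sup>2 + (norm (y i))\<^sup>2)"
      using sum_squares_bound[of "norm (x i)" "norm (y i)"] by (simp add: power2_sum)
    finally show ?thesis .
  qed
qed simp

lemma summable_cinner:
  fixes x y :: "'i \<Rightarrow> 'a::complex_inner"
  assumes "(\<lambda>i. (norm (x i))\<^sup>2) summable_on UNIV" "(\<lambda>i. (norm (y i))\<^sup>2) summable_on UNIV"
  shows "(\<lambda>i. cinner (x i) (y i)) summable_on UNIV"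
proof (rule Infinite_Sum.abs_summable_summable, rule Infinite_Sum.abs_summable_on_comparison_test')
  show "(\<lambda>i. (norm (x i))\<^sup>2 + (norm (y i))\<^sup>2) summable_on UNIV"
    by (intro summable_on_add assms)
  show "cmod (cinner (x i) (y i)) \<le> (norm (x i))\<^sup>2 + (norm (y i))\<^sup>2" for i
    using norm_cinner_le[of "x i" "y i"] sum_squares_bound[of "norm (x i)" "norm (y i)"]
      mult_nonneg_nonneg[OF norm_ge_zero[of "x i"] norm_ge_zero[of "y i"]]
    by linarith
qed

instantiation ell2 :: (type, complex_inner) complex_inner
begin

lift_definition zero_ell2 :: "('a, 'b) ell2" is "\<lambda>_. 0" by simp
lift_definition plus_ell2 :: "('a, 'b) ell2 \<Rightarrow> ('a, 'b) ell2 \<Rightarrow> ('a, 'b) ell2"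
  is "\<lambda>x y i. x i + y i" by (rule square_summable_add)
lift_definition uminus_ell2 :: "('a, 'b) ell2 \<Rightarrow> ('a, 'b) ell2" is "\<lambda>x i. - x i" by simp
lift_definition minus_ell2 :: "('a, 'b) ell2 \<Rightarrow> ('a, 'b) ell2 \<Rightarrow> ('a, 'b) ell2"
  is "\<lambda>x y i. x i - y i"
  using square_summable_add[where y = "\<lambda>i. - y i" for y :: "'a \<Rightarrow> 'b"] by simp
lift_definition scaleC_ell2 :: "complex \<Rightarrow> ('a, 'b) ell2 \<Rightarrow> ('a, 'b) ell2"
  is "\<lambda>c x i. c *\<^sub>C x i"
  by (simp add: norm_scaleC power_mult_distrib summable_on_cmult_right)
lift_definition scaleR_ell2 :: "real \<Rightarrow> ('a, 'b) ell2 \<Rightarrow> ('a, 'b) ell2"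
  is "\<lambda>r x i. r *\<^sub>R x i"
  by (simp add: power_mult_distrib summable_on_cmult_right)

definition cinner_ell2 :: "('a, 'b) ell2 \<Rightarrow> ('a, 'b) ell2 \<Rightarrow> complex" where
  "cinner_ell2 x y = (\<Sum>\<^sub>\<infinity>i. cinner (ell2_nth x i) (ell2_nth y i))"
definition inner_ell2 :: "('a, 'b) ell2 \<Rightarrow> ('a, 'b) ell2 \<Rightarrow> real" where
  "inner_ell2 x y = Re (cinner x y)"
definition norm_ell2 :: "('a, 'b) ell2 \<Rightarrow> real" where
  "norm_ell2 x = sqrt (inner x x)"
definition sgn_ell2 :: "('a, 'b) ell2 \<Rightarrow> ('a, 'b) ell2" where
  "sgn_ell2 x = inverse (norm x) *\<^sub>R x"
definition dist_ell2 :: "('a, 'b) ell2 \<Rightarrow> ('a, 'b) ell2 \<Rightarrow> real" where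
  "dist_ell2 x y = norm (x - y)"
definition uniformity_ell2 :: "(('a, 'b) ell2 \<times> ('a, 'b) ell2) filter" where
  "uniformity_ell2 = (INF e\<in>{0<..}. principal {(x, y). dist x y < e})"
definition open_ell2 :: "('a, 'b) ell2 set \<Rightarrow> bool" where
  "open_ell2 S \<longleftrightarrow> (\<forall>x\<in>S. \<forall>\<^sub>F (x', y) in uniformity. x' = x \<longrightarrow> y \<in> S)"

instance
proof
  fix x y z :: "('a, 'b) ell2" and r s :: real and a b :: complex
  have sq: "(\<lambda>i. (norm (ell2_nth w i))\<^sup>2) summable_on UNIV" for w :: "('a, 'b) ell2"
    using ell2_nth[of w] by simp
  have sc: "(\<lambda>i. cinner (ell2_nth w i) (ell2_nth w' i)) summable_on UNIV"
    for w w' :: "('a, 'b) ell2"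
    by (intro summable_cinner sq)
  show "x + y + z = x + (y + z)" by transfer (simp add: add.assoc)
  show "x + y = y + x" by transfer (simp add: add.commute)
  show "0 + x = x" by transfer simp
  show "- x + x = 0" by transfer simp
  show "x - y = x + - y" by transfer simp
  show "r *\<^sub>R (x + y) = r *\<^sub>R x + r *\<^sub>R y" by transfer (simp add: scaleR_add_right)
  show "(r + s) *\<^sub>R x = r *\<^sub>R x + s *\<^sub>R x" by transfer (simp add: scaleR_add_left)
  show "r *\<^sub>R s *\<^sub>R x = (r * s) *\<^sub>R x" by transfer simp
  show "1 *\<^sub>R x = x" by transfer simp
  show "a *\<^sub>C (x + y) = a *\<^sub>C x + a *\<^sub>C y" by transfer (simp add: scaleC_add_right)
  show "(a + b) *\<^sub>C x = a *\<^sub>C x + b *\<^sub>C x" by transfer (simp add: scaleC_add_left)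
  show "a *\<^sub>C b *\<^sub>C x = (a * b) *\<^sub>C x" by transfer (simp add: scaleC_scaleC)
  show scR: "r *\<^sub>R x = complex_of_real r *\<^sub>C x" for r and x :: "('a, 'b) ell2"
    by transfer (simp add: scaleR_scaleC)
  show comm: "cinner x y = cnj (cinner y x)" for x y :: "('a, 'b) ell2"
    unfolding cinner_ell2_def infsum_cnj[symmetric] by (simp add: cinner_commute[symmetric])
  show add: "cinner x (y + z) = cinner x y + cinner x z" for x y z :: "('a, 'b) ell2"
    unfolding cinner_ell2_def plus_ell2.rep_eq cinner_add_right by (intro infsum_add sc)
  show scl: "cinner x (a *\<^sub>C y) = a * cinner x y" for a and x y :: "('a, 'b) ell2"
    unfolding cinner_ell2_def scaleC_ell2.rep_eq cinner_scaleC_right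
    by (rule infsum_cmult_right')
  show "inner x y = Re (cinner x y)" by (simp add: inner_ell2_def)
  show "inner x y = inner y x" unfolding inner_ell2_def using comm[of x y] by simp
  show "inner (x + y) z = inner x z + inner y z"
    unfolding inner_ell2_def comm[of _ z] by (simp add: add)
  show "inner (r *\<^sub>R x) y = r * inner x y"
    unfolding inner_ell2_def comm[of _ y] by (simp add: scR scl)
  have self: "inner x x = (\<Sum>\<^sub>\<infinity>i. (norm (ell2_nth x i))\<^sup>2)"
    unfolding inner_ell2_def cinner_ell2_def infsum_Re[OF sc, symmetric] by (simp add: cinner_self)
  show "0 \<le> inner x x" unfolding self by (intro infsum_nonneg) simp
  show "inner x x = 0 \<longleftrightarrow> x = 0"
  proof
    assume "inner x x = 0"
    then have "ell2_nth x i = 0" for i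
      using nonneg_infsum_le_0D[OF _ sq[of x], of i] unfolding self by simp
    then show "x = 0" by transfer auto
  next
    assume "x = 0"
    then show "inner x x = 0" unfolding self by (simp add: zero_ell2.rep_eq)
  qed
  show "norm x = sqrt (inner x x)" by (simp add: norm_ell2_def)
  show "sgn x = inverse (norm x) *\<^sub>R x" by (simp add: sgn_ell2_def)
  show "dist x y = norm (x - y)" by (simp add: dist_ell2_def)
  show "uniformity = (INF e\<in>{0<..}. principal {(x, y). dist (x::('a, 'b) ell2) y < e})"
    by (simp add: uniformity_ell2_def)
  show "open S = (\<forall>x\<in>S. \<forall>\<^sub>F (x', y) in uniformity. x' = x \<longrightarrow> y \<in> S)"
    for S :: "('a, 'b) ell2 set" by (simp add: open_ell2_def)
qed

end

lemma ell2_norm_square: "(norm x)\<^sup>2 = (\<Sum>\<^sub>\<infinity>i. (norm (ell2_nth x i))\<^sup>2)"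
proof -
  have "(\<lambda>i. cinner (ell2_nth x i) (ell2_nth x i)) summable_on UNIV"
    using ell2_nth[of x] by (intro summable_cinner) auto
  then have "Re (cinner x x) = (\<Sum>\<^sub>\<infinity>i. (norm (ell2_nth x i))\<^sup>2)"
    unfolding cinner_ell2_def by (simp add: infsum_Re[symmetric] cinner_self)
  then show ?thesis by (simp add: power2_norm_eq_inner inner_cinner)
qed

lift_definition tensor :: "('i, complex) ell2 \<Rightarrow> 'a::complex_inner \<Rightarrow> ('i, 'a) ell2"
    (infixr \<open>\<otimes>\<^sub>h\<close> 70)
  is "\<lambda>u \<xi> i. u i *\<^sub>C \<xi>"
  by (simp add: norm_scaleC power_mult_distrib summable_on_cmult_left)

lemma cinner_tensor: "cinner (u \<otimes>\<^sub>h \<xi>) (v \<otimes>\<^sub>h \<eta>) = cinner u v * cinner \<xi> \<eta>"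
proof -
  have "cinner (u \<otimes>\<^sub>h \<xi>) (v \<otimes>\<^sub>h \<eta>)
      = (\<Sum>\<^sub>\<infinity>i. cinner (ell2_nth u i) (ell2_nth v i) * cinner \<xi> \<eta>)"
    unfolding cinner_ell2_def tensor.rep_eq
    by (simp add: cinner_scaleC_left cinner_scaleC_right cinner_complex_def mult_ac)
  also have "\<dots> = cinner u v * cinner \<xi> \<eta>"
    unfolding cinner_ell2_def by (rule infsum_cmult_left')
  finally show ?thesis .
qed

text \<open>Index maps that are not permutations are sent to the zero operator.\<close>

lift_definition reindex :: "('i \<Rightarrow> 'i) \<Rightarrow> ('i, 'a::complex_inner) ell2 \<Rightarrow> ('i, 'a) ell2"
  is "\<lambda>\<sigma> x. if bij \<sigma> then (\<lambda>i. x (\<sigma> i)) else (\<lambda>_. 0)"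
  by (auto simp: summable_on_reindex_bij_betw[where f = "\<lambda>i. (norm (f i))\<^sup>2" for f])

lemma norm_reindex: "bij \<sigma> \<Longrightarrow> norm (reindex \<sigma> x) = norm x"
proof -
  assume "bij \<sigma>"
  then have "(norm (reindex \<sigma> x))\<^sup>2 = (norm x)\<^sup>2"
    unfolding ell2_norm_square
    by (simp add: reindex.rep_eq
        infsum_reindex_bij_betw[where f = "\<lambda>i. (norm (ell2_nth x i))\<^sup>2"])
  then show ?thesis by (simp add: power2_eq_iff_nonneg)
qed

lemma bounded_linear_reindex: "bounded_linear (reindex \<sigma>)"
proof (rule bounded_linear_intro[where K = 1])
  show "reindex \<sigma> (x + y) = reindex \<sigma> x + reindex \<sigma> y" for x y by transfer auto
  show "reindex \<sigma> (r *\<^sub>R x) = r *\<^sub>R reindex \<sigma> x" for r x by transfer auto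
  show "norm (reindex \<sigma> x) \<le> norm x * 1" for x
  proof (cases "bij \<sigma>")
    case False
    then have "reindex \<sigma> x = 0" by transfer simp
    then show ?thesis by simp
  qed (simp add: norm_reindex)
qed


lift_definition reindex_op :: "('i \<Rightarrow> 'i) \<Rightarrow> ('i, 'a::complex_inner) ell2 \<Rightarrow>\<^sub>L ('i, 'a) ell2"
  is reindex
  by (rule bounded_linear_reindex)

lemma reindex_op_nth: "bij \<sigma> \<Longrightarrow> ell2_nth (reindex_op \<sigma> x) i = ell2_nth x (\<sigma> i)"
  by (simp add: reindex_op.rep_eq reindex.rep_eq)


section \<open>Boson Fock space over \<open>L\<^sup>2(\<real>\<^sub>+; \<complex>)\<close>\<close>

text \<open>Elements of \<open>L\<^sup>2\<close> are given by representatives.\<close>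

definition L2 :: "'a measure \<Rightarrow> ('a \<Rightarrow> complex) set" where
  "L2 M = {f \<in> borel_measurable M. integrable M (\<lambda>x. (cmod (f x))\<^sup>2)}"

definition l2_inner :: "'a measure \<Rightarrow> ('a \<Rightarrow> complex) \<Rightarrow> ('a \<Rightarrow> complex) \<Rightarrow> complex" where
  "l2_inner M f g = (\<integral>x. cnj (f x) * g x \<partial>M)"

lemma cmod_mult_le: "cmod (a * b) \<le> (cmod a)\<^sup>2 + (cmod b)\<^sup>2"
  using sum_squares_bound[of "cmod a" "cmod b"] norm_ge_zero[of "a * b"]
  unfolding norm_mult by linarith

lemma borel_measurable_cnj [measurable]: "cnj \<in> borel_measurable borel"
  by (intro borel_measurable_continuous_onI continuous_intros)

lemma L2_integrable_mult:
  assumes "f \<in> L2 M" "g \<in> L2 M"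
  shows "integrable M (\<lambda>x. cnj (f x) * g x)"
proof (rule Bochner_Integration.integrable_bound)
  show "integrable M (\<lambda>x. (cmod (f x))\<^sup>2 + (cmod (g x))\<^sup>2)" using assms by (simp add: L2_def)
  have [measurable]: "f \<in> borel_measurable M" "g \<in> borel_measurable M"
    using assms by (auto simp: L2_def)
  show "(\<lambda>x. cnj (f x) * g x) \<in> borel_measurable M" by measurable
  show "AE x in M. norm (cnj (f x) * g x) \<le> norm ((cmod (f x))\<^sup>2 + (cmod (g x))\<^sup>2)"
    using cmod_mult_le[of "cnj (f x)" "g x" for x] by simp
qed

lemma cmod_l2_inner_le:
  assumes "f \<in> L2 M" "g \<in> L2 M"
  shows "cmod (l2_inner M f g) \<le> (\<integral>x. (cmod (f x))\<^sup>2 \<partial>M) + (\<integral>x. (cmod (g x))\<^sup>2 \<partial>M)"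
proof -
  have i: "integrable M (\<lambda>x. (cmod (f x))\<^sup>2)" "integrable M (\<lambda>x. (cmod (g x))\<^sup>2)"
    using assms by (auto simp: L2_def)
  have "cmod (l2_inner M f g) \<le> (\<integral>x. cmod (cnj (f x) * g x) \<partial>M)"
    unfolding l2_inner_def by (rule integral_norm_bound)
  also have "\<dots> \<le> (\<integral>x. (cmod (f x))\<^sup>2 + (cmod (g x))\<^sup>2 \<partial>M)"
    using L2_integrable_mult[OF assms] i cmod_mult_le[of "cnj (f x)" "g x" for x]
    by (intro integral_mono integrable_norm Bochner_Integration.integrable_add) auto
  finally show ?thesis using i by simp
qed

lemma cmod_add_square_le: "(cmod (a + b))\<^sup>2 \<le> 2 * (cmod a)\<^sup>2 + 2 * (cmod b)\<^sup>2"
proof -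
  have "(cmod (a + b))\<^sup>2 \<le> (cmod a + cmod b)\<^sup>2" by (intro power_mono norm_triangle_ineq) auto
  then show ?thesis using sum_squares_bound[of "cmod a" "cmod b"] by (simp add: power2_sum)
qed

lemma L2_add:
  assumes "f \<in> L2 M" "g \<in> L2 M" shows "(\<lambda>x. f x + g x) \<in> L2 M"
proof -
  have [measurable]: "f \<in> borel_measurable M" "g \<in> borel_measurable M"
    using assms by (auto simp: L2_def)
  have "integrable M (\<lambda>x. (cmod (f x + g x))\<^sup>2)"
  proof (rule Bochner_Integration.integrable_bound)
    show "integrable M (\<lambda>x. 2 * (cmod (f x))\<^sup>2 + 2 * (cmod (g x))\<^sup>2)"
      using assms by (simp add: L2_def)
    show "(\<lambda>x. (cmod (f x + g x))\<^sup>2) \<in> borel_measurable M" by measurable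
    show "AE x in M. norm ((cmod (f x + g x))\<^sup>2) \<le> norm (2 * (cmod (f x))\<^sup>2 + 2 * (cmod (g x))\<^sup>2)"
      using cmod_add_square_le by simp
  qed
  then show ?thesis by (simp add: L2_def)
qed

lemma L2_scale: "f \<in> L2 M \<Longrightarrow> (\<lambda>x. c * f x) \<in> L2 M"
  by (auto simp: L2_def norm_mult power_mult_distrib)

definition half_line :: "real measure" where
  "half_line = restrict_space lborel {0..}"

definition particles :: "nat \<Rightarrow> (nat \<Rightarrow> real) measure" where
  "particles n = Pi\<^sub>M {..<n} (\<lambda>_. half_line)"

text \<open>The \<open>n\<close>-particle component of a Fock vector is a symmetric square-integrable function of \<open>n\<close>
  variables in the half line, and the Fock space is the Hilbert-space direct sum of these
  components.\<close>

definition fock_vectors :: "(nat \<Rightarrow> (nat \<Rightarrow> real) \<Rightarrow> complex) set" where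
  "fock_vectors = {\<psi>.
     (\<forall>n. \<psi> n \<in> L2 (particles n)) \<and>
     (\<forall>n \<sigma>. \<sigma> permutes {..<n} \<longrightarrow> (AE x in particles n. \<psi> n (x \<circ> \<sigma>) = \<psi> n x)) \<and>
     (\<lambda>n. \<integral>x. (cmod (\<psi> n x))\<^sup>2 \<partial>particles n) summable_on UNIV}"

definition fock_rel ::
  "(nat \<Rightarrow> (nat \<Rightarrow> real) \<Rightarrow> complex) \<Rightarrow> (nat \<Rightarrow> (nat \<Rightarrow> real) \<Rightarrow> complex) \<Rightarrow> bool" where
  "fock_rel \<psi> \<phi> \<longleftrightarrow> \<psi> \<in> fock_vectors \<and> \<phi> \<in> fock_vectors \<and>
     (\<forall>n. AE x in particles n. \<psi> n x = \<phi> n x)"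

lemma fock_vectors_zero: "(\<lambda>n x. 0) \<in> fock_vectors"
  by (simp add: fock_vectors_def L2_def)

lemma fock_vectors_add:
  assumes "\<psi> \<in> fock_vectors" "\<phi> \<in> fock_vectors"
  shows "(\<lambda>n x. \<psi> n x + \<phi> n x) \<in> fock_vectors"
proof -
  have L: "\<psi> n \<in> L2 (particles n)" "\<phi> n \<in> L2 (particles n)" for n
    using assms by (auto simp: fock_vectors_def)
  have "AE x in particles n. \<psi> n (x \<circ> \<sigma>) + \<phi> n (x \<circ> \<sigma>) = \<psi> n x + \<phi> n x"
    if "\<sigma> permutes {..<n}" for n \<sigma>
  proof -
    have "AE x in particles n. \<psi> n (x \<circ> \<sigma>) = \<psi> n x" "AE x in particles n. \<phi> n (x \<circ> \<sigma>) = \<phi> n x"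
      using assms that by (auto simp: fock_vectors_def)
    then show ?thesis by eventually_elim simp
  qed
  moreover have "(\<lambda>n. \<integral>x. (cmod (\<psi> n x + \<phi> n x))\<^sup>2 \<partial>particles n) summable_on UNIV"
  proof (rule summable_on_comparison_test)
    show "(\<lambda>n. 2 * (\<integral>x. (cmod (\<psi> n x))\<^sup>2 \<partial>particles n) + 2 * (\<integral>x. (cmod (\<phi> n x))\<^sup>2 \<partial>particles n))
        summable_on UNIV"
      using assms by (intro summable_on_add summable_on_cmult_right) (auto simp: fock_vectors_def)
    fix n
    have i: "integrable (particles n) (\<lambda>x. (cmod (\<psi> n x))\<^sup>2)"
      "integrable (particles n) (\<lambda>x. (cmod (\<phi> n x))\<^sup>2)"
      "integrable (particles n) (\<lambda>x. (cmod (\<psi> n x + \<phi> n x))\<^sup>2)"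
      using L L2_add[OF L] by (auto simp: L2_def)
    have "(\<integral>x. (cmod (\<psi> n x + \<phi> n x))\<^sup>2 \<partial>particles n)
        \<le> (\<integral>x. 2 * (cmod (\<psi> n x))\<^sup>2 + 2 * (cmod (\<phi> n x))\<^sup>2 \<partial>particles n)"
      using i by (intro integral_mono cmod_add_square_le) auto
    then show "(\<integral>x. (cmod (\<psi> n x + \<phi> n x))\<^sup>2 \<partial>particles n)
        \<le> 2 * (\<integral>x. (cmod (\<psi> n x))\<^sup>2 \<partial>particles n) + 2 * (\<integral>x. (cmod (\<phi> n x))\<^sup>2 \<partial>particles n)"
      using i by simp
  qed simp
  ultimately show ?thesis by (simp add: fock_vectors_def L2_add[OF L])
qed

lemma fock_vectors_scale:
  assumes "\<psi> \<in> fock_vectors" shows "(\<lambda>n x. c * \<psi> n x) \<in> fock_vectors"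
proof -
  have "AE x in particles n. c * \<psi> n (x \<circ> \<sigma>) = c * \<psi> n x" if "\<sigma> permutes {..<n}" for n \<sigma>
  proof -
    have "AE x in particles n. \<psi> n (x \<circ> \<sigma>) = \<psi> n x"
      using assms that by (auto simp: fock_vectors_def)
    then show ?thesis by eventually_elim simp
  qed
  then show ?thesis
    using assms
    by (simp add: fock_vectors_def L2_scale norm_mult power_mult_distrib summable_on_cmult_right)
qed

quotient_type fock = "nat \<Rightarrow> (nat \<Rightarrow> real) \<Rightarrow> complex" / partial: fock_rel
proof (rule part_equivpI)
  show "\<exists>\<psi>. fock_rel \<psi> \<psi>" using fock_vectors_zero by (auto simp: fock_rel_def)
  show "symp fock_rel" by (rule sympI) (force simp: fock_rel_def elim: eventually_mono)
  show "transp fock_rel"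
  proof (rule transpI)
    fix \<psi> \<phi> \<eta> assume "fock_rel \<psi> \<phi>" "fock_rel \<phi> \<eta>"
    then show "fock_rel \<psi> \<eta>" unfolding fock_rel_def by (force elim: eventually_elim2)
  qed
qed

definition fock_inner ::
  "(nat \<Rightarrow> (nat \<Rightarrow> real) \<Rightarrow> complex) \<Rightarrow> (nat \<Rightarrow> (nat \<Rightarrow> real) \<Rightarrow> complex) \<Rightarrow> complex" where
  "fock_inner \<psi> \<phi> = (\<Sum>\<^sub>\<infinity>n. l2_inner (particles n) (\<psi> n) (\<phi> n))"

lemma fock_inner_summable:
  assumes "\<psi> \<in> fock_vectors" "\<phi> \<in> fock_vectors"
  shows "(\<lambda>n. l2_inner (particles n) (\<psi> n) (\<phi> n)) summable_on UNIV"
proof (rule Infinite_Sum.abs_summable_summable, rule Infinite_Sum.abs_summable_on_comparison_test')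
  show "(\<lambda>n. (\<integral>x. (cmod (\<psi> n x))\<^sup>2 \<partial>particles n) + (\<integral>x. (cmod (\<phi> n x))\<^sup>2 \<partial>particles n))
      summable_on UNIV"
    using assms by (intro summable_on_add) (auto simp: fock_vectors_def)
  show "cmod (l2_inner (particles n) (\<psi> n) (\<phi> n))
      \<le> (\<integral>x. (cmod (\<psi> n x))\<^sup>2 \<partial>particles n) + (\<integral>x. (cmod (\<phi> n x))\<^sup>2 \<partial>particles n)" for n
    using assms by (intro cmod_l2_inner_le) (auto simp: fock_vectors_def)
qed

lemma fock_inner_cong:
  assumes "fock_rel \<psi> \<psi>'" "fock_rel \<phi> \<phi>'" shows "fock_inner \<psi> \<phi> = fock_inner \<psi>' \<phi>'"
  unfolding fock_inner_def l2_inner_def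
proof (intro infsum_cong integral_cong_AE)
  fix n
  have [measurable]: "\<psi> n \<in> borel_measurable (particles n)" "\<psi>' n \<in> borel_measurable (particles n)"
    "\<phi> n \<in> borel_measurable (particles n)" "\<phi>' n \<in> borel_measurable (particles n)"
    using assms by (auto simp: fock_rel_def fock_vectors_def L2_def)
  show "(\<lambda>x. cnj (\<psi> n x) * \<phi> n x) \<in> borel_measurable (particles n)"
    "(\<lambda>x. cnj (\<psi>' n x) * \<phi>' n x) \<in> borel_measurable (particles n)"
    by measurable
  have "AE x in particles n. \<psi> n x = \<psi>' n x" "AE x in particles n. \<phi> n x = \<phi>' n x"
    using assms by (auto simp: fock_rel_def)
  then show "AE x in particles n. cnj (\<psi> n x) * \<phi> n x = cnj (\<psi>' n x) * \<phi>' n x"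
    by eventually_elim simp
qed

instantiation fock :: complex_inner
begin

lift_definition zero_fock :: fock is "\<lambda>n x. 0"
  by (simp add: fock_rel_def fock_vectors_zero)
lift_definition plus_fock :: "fock \<Rightarrow> fock \<Rightarrow> fock" is "\<lambda>\<psi> \<phi> n x. \<psi> n x + \<phi> n x"
  unfolding fock_rel_def by (force intro: fock_vectors_add elim: eventually_elim2)
lift_definition scaleC_fock :: "complex \<Rightarrow> fock \<Rightarrow> fock" is "\<lambda>c \<psi> n x. c * \<psi> n x"
  unfolding fock_rel_def by (force intro: fock_vectors_scale elim: eventually_mono)
lift_definition cinner_fock :: "fock \<Rightarrow> fock \<Rightarrow> complex" is fock_inner
  by (rule fock_inner_cong)

definition uminus_fock :: "fock \<Rightarrow> fock" where "uminus_fock x = (-1) *\<^sub>C x"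
definition minus_fock :: "fock \<Rightarrow> fock \<Rightarrow> fock" where "minus_fock x y = x + (-1) *\<^sub>C y"
definition scaleR_fock :: "real \<Rightarrow> fock \<Rightarrow> fock" where
  "scaleR_fock r x = complex_of_real r *\<^sub>C x"
definition inner_fock :: "fock \<Rightarrow> fock \<Rightarrow> real" where
  "inner_fock x y = Re (cinner x y)"
definition norm_fock :: "fock \<Rightarrow> real" where
  "norm_fock x = sqrt (inner x x)"
definition sgn_fock :: "fock \<Rightarrow> fock" where
  "sgn_fock x = inverse (norm x) *\<^sub>R x"
definition dist_fock :: "fock \<Rightarrow> fock \<Rightarrow> real" where
  "dist_fock x y = norm (x - y)"
definition uniformity_fock :: "(fock \<times> fock) filter" where
  "uniformity_fock = (INF e\<in>{0<..}. principal {(x, y). dist x y < e})"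
definition open_fock :: "fock set \<Rightarrow> bool" where
  "open_fock S \<longleftrightarrow> (\<forall>x\<in>S. \<forall>\<^sub>F (x', y) in uniformity. x' = x \<longrightarrow> y \<in> S)"

instance
proof
  fix x y z :: fock and r s :: real and a b :: complex
  have refl: "fock_rel \<psi> \<psi> \<longleftrightarrow> \<psi> \<in> fock_vectors" for \<psi> by (simp add: fock_rel_def)
  have relI: "fock_rel \<psi> \<phi>" if "\<psi> \<in> fock_vectors" "\<psi> = \<phi>" for \<psi> \<phi>
    using that by (simp add: fock_rel_def)
  show assoc: "x + y + z = x + (y + z)" for x y z :: fock
    by transfer (intro relI fock_vectors_add ext, auto simp: refl add.assoc)
  show "x + y = y + x"
    by transfer (intro relI fock_vectors_add ext, auto simp: refl add.commute)
  show "0 + x = x"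
    by transfer (intro relI fock_vectors_add fock_vectors_zero ext, auto simp: refl)
  show "- x + x = 0" unfolding uminus_fock_def
    by transfer (intro relI fock_vectors_add fock_vectors_scale ext, auto simp: refl)
  show "x - y = x + - y" by (simp add: minus_fock_def uminus_fock_def)
  show addr: "a *\<^sub>C (x + y) = a *\<^sub>C x + a *\<^sub>C y" for a and x y :: fock
    by transfer (intro relI fock_vectors_add fock_vectors_scale ext, auto simp: refl algebra_simps)
  show addl: "(a + b) *\<^sub>C x = a *\<^sub>C x + b *\<^sub>C x" for a b and x :: fock
    by transfer (intro relI fock_vectors_add fock_vectors_scale ext, auto simp: refl algebra_simps)
  show assc: "a *\<^sub>C b *\<^sub>C x = (a * b) *\<^sub>C x" for a b and x :: fock
    by transfer (intro relI fock_vectors_add fock_vectors_scale ext, auto simp: refl)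
  have one: "1 *\<^sub>C x = x" for x :: fock
    by transfer (intro relI fock_vectors_add fock_vectors_scale ext, auto simp: refl)
  show scR: "r *\<^sub>R x = complex_of_real r *\<^sub>C x" for r and x :: fock
    by (simp add: scaleR_fock_def)
  show "r *\<^sub>R (x + y) = r *\<^sub>R x + r *\<^sub>R y" by (simp add: scR addr)
  show "(r + s) *\<^sub>R x = r *\<^sub>R x + s *\<^sub>R x" by (simp add: scR addl)
  show "r *\<^sub>R s *\<^sub>R x = (r * s) *\<^sub>R x" by (simp add: scR assc)
  show "1 *\<^sub>R x = x" by (simp add: scR one)
  show comm: "cinner x y = cnj (cinner y x)" for x y :: fock
    by transfer (simp add: fock_inner_def l2_inner_def infsum_cnj[symmetric] mult.commute
        del: infsum_cnj Bochner_Integration.integral_cnj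
        flip: Bochner_Integration.integral_cnj)
  show add: "cinner x (y + z) = cinner x y + cinner x z" for x y z :: fock
  proof transfer
    fix \<psi> \<phi> \<eta> assume "fock_rel \<psi> \<psi>" "fock_rel \<phi> \<phi>" "fock_rel \<eta> \<eta>"
    then have f: "\<psi> \<in> fock_vectors" "\<phi> \<in> fock_vectors" "\<eta> \<in> fock_vectors" by (auto simp: refl)
    then have "l2_inner (particles n) (\<psi> n) (\<lambda>x. \<phi> n x + \<eta> n x)
        = l2_inner (particles n) (\<psi> n) (\<phi> n) + l2_inner (particles n) (\<psi> n) (\<eta> n)" for n
      unfolding l2_inner_def distrib_left
      by (intro Bochner_Integration.integral_add L2_integrable_mult) (auto simp: fock_vectors_def)
    then show "fock_inner \<psi> (\<lambda>n x. \<phi> n x + \<eta> n x) = fock_inner \<psi> \<phi> + fock_inner \<psi> \<eta>"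
      unfolding fock_inner_def by (simp add: infsum_add fock_inner_summable f)
  qed
  show scl: "cinner x (a *\<^sub>C y) = a * cinner x y" for a and x y :: fock
  proof transfer
    fix a \<psi> \<phi>
    have "l2_inner (particles n) (\<psi> n) (\<lambda>x. a * \<phi> n x) = a * l2_inner (particles n) (\<psi> n) (\<phi> n)" for n
      unfolding l2_inner_def mult.left_commute[of _ a] by simp
    then show "fock_inner \<psi> (\<lambda>n x. a * \<phi> n x) = a * fock_inner \<psi> \<phi>"
      unfolding fock_inner_def by (simp add: infsum_cmult_right')
  qed
  show "inner x y = Re (cinner x y)" by (simp add: inner_fock_def)
  show "inner x y = inner y x" unfolding inner_fock_def using comm[of x y] by simp
  show "inner (x + y) z = inner x z + inner y z"
    unfolding inner_fock_def comm[of _ z] by (simp add: add)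
  show "inner (r *\<^sub>R x) y = r * inner x y"
    unfolding inner_fock_def comm[of _ y] by (simp add: scR scl)
  show "0 \<le> inner x x" unfolding inner_fock_def
  proof transfer
    fix \<psi> assume "fock_rel \<psi> \<psi>"
    then have f: "\<psi> \<in> fock_vectors" by (simp add: refl)
    show "0 \<le> Re (fock_inner \<psi> \<psi>)"
      unfolding fock_inner_def infsum_Re[OF fock_inner_summable[OF f f], symmetric]
      by (intro infsum_nonneg)
        (simp add: l2_inner_def complex_norm_square[symmetric] mult.commute[of "cnj _"]
          del: of_real_power)
  qed
  show "inner x x = 0 \<longleftrightarrow> x = 0"
  proof
    assume "inner x x = 0"
    then show "x = 0" unfolding inner_fock_def
    proof transfer
      fix \<psi> assume "fock_rel \<psi> \<psi>" and 0: "Re (fock_inner \<psi> \<psi>) = 0"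
      then have f: "\<psi> \<in> fock_vectors" by (simp add: refl)
      have sq: "Re (l2_inner (particles n) (\<psi> n) (\<psi> n)) = (\<integral>x. (cmod (\<psi> n x))\<^sup>2 \<partial>particles n)" for n
        by (simp add: l2_inner_def complex_norm_square[symmetric] mult.commute[of "cnj _"]
            del: of_real_power)
      have "(\<Sum>\<^sub>\<infinity>n. \<integral>x. (cmod (\<psi> n x))\<^sup>2 \<partial>particles n) = 0"
        using 0 unfolding fock_inner_def infsum_Re[OF fock_inner_summable[OF f f], symmetric] sq .
      then have "(\<integral>x. (cmod (\<psi> n x))\<^sup>2 \<partial>particles n) = 0" for n
        using nonneg_infsum_le_0D[of "\<lambda>n. \<integral>x. (cmod (\<psi> n x))\<^sup>2 \<partial>particles n" UNIV n] f
        by (simp add: fock_vectors_def)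
      then have "AE x in particles n. \<psi> n x = 0" for n
        using integral_nonneg_eq_0_iff_AE[of "particles n" "\<lambda>x. (cmod (\<psi> n x))\<^sup>2"] f
        by (simp add: fock_vectors_def L2_def)
      then show "fock_rel \<psi> (\<lambda>n x. 0)" using f by (simp add: fock_rel_def fock_vectors_zero)
    qed
  next
    have "cinner (0::fock) 0 = 0" by transfer (simp add: fock_inner_def l2_inner_def)
    moreover assume "x = 0"
    ultimately show "inner x x = 0" by (simp add: inner_fock_def)
  qed
  show "norm x = sqrt (inner x x)" by (simp add: norm_fock_def)
  show "sgn x = inverse (norm x) *\<^sub>R x" by (simp add: sgn_fock_def)
  show "dist x y = norm (x - y)" by (simp add: dist_fock_def)
  show "uniformity = (INF e\<in>{0<..}. principal {(x, y). dist (x::fock) y < e})"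
    by (simp add: uniformity_fock_def)
  show "open S = (\<forall>x\<in>S. \<forall>\<^sub>F (x', y) in uniformity. x' = x \<longrightarrow> y \<in> S)"
    for S :: "fock set" by (simp add: open_fock_def)
qed

end

text \<open>The \<open>n\<close>-particle component of \<open>\<epsilon>(f)\<close> is the \<open>n\<close>-fold tensor power of \<open>f\<close>, divided by the
  square root of \<open>n!\<close>.\<close>

definition expv_fun :: "(real \<Rightarrow> complex) \<Rightarrow> nat \<Rightarrow> (nat \<Rightarrow> real) \<Rightarrow> complex" where
  "expv_fun f n x = (\<Prod>i<n. f (x i)) / complex_of_real (sqrt (fact n))"

definition expv :: "(real \<Rightarrow> complex) \<Rightarrow> fock" where
  "expv f = abs_fock (expv_fun f)"

lemma expv_fun_L2_inner:
  assumes "f \<in> L2 half_line" "g \<in> L2 half_line"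
  shows "integrable (particles n) (\<lambda>x. cnj (expv_fun f n x) * expv_fun g n x)"
    and "l2_inner (particles n) (expv_fun f n) (expv_fun g n)
      = (l2_inner half_line f g) ^ n /\<^sub>R fact n"
proof -
  interpret sigma_finite_measure half_line
    unfolding half_line_def
    by (intro sigma_finite_measure_restrict_space sigma_finite_lborel) auto
  interpret product_sigma_finite "\<lambda>_::nat. half_line" by standard
  have eq: "cnj (expv_fun f n x) * expv_fun g n x
      = (\<Prod>i<n. cnj (f (x i)) * g (x i)) /\<^sub>R fact n" for x
  proof -
    have "complex_of_real (sqrt (fact n)) * complex_of_real (sqrt (fact n)) = fact n"
      by (simp flip: of_real_mult)
    then show ?thesis
      by (simp add: expv_fun_def prod.distrib scaleR_conv_of_real field_simps)
  qed
  show "integrable (particles n) (\<lambda>x. cnj (expv_fun f n x) * expv_fun g n x)"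
    unfolding eq particles_def
    using product_integrable_prod[where I = "{..<n}" and f = "\<lambda>_ x. cnj (f x) * g x"]
      L2_integrable_mult[OF assms] by (intro integrable_scaleR_right) simp
  show "l2_inner (particles n) (expv_fun f n) (expv_fun g n)
      = (l2_inner half_line f g) ^ n /\<^sub>R fact n"
    unfolding l2_inner_def eq particles_def
    using product_integral_prod[where I = "{..<n}" and f = "\<lambda>_ x. cnj (f x) * g x"]
      L2_integrable_mult[OF assms] by simp
qed

lemma expv_fun_fock_vectors:
  assumes f: "f \<in> L2 half_line" shows "expv_fun f \<in> fock_vectors"
proof -
  have [measurable]: "f \<in> borel_measurable half_line" using f by (simp add: L2_def)
  have "expv_fun f n \<in> borel_measurable (particles n)" for n
    unfolding expv_fun_def[abs_def] particles_def by measurable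
  moreover have cm: "cnj (expv_fun f n x) * expv_fun f n x = complex_of_real ((cmod (expv_fun f n x))\<^sup>2)" for n x
    unfolding complex_norm_square by (rule mult.commute)
  have int: "integrable (particles n) (\<lambda>x. (cmod (expv_fun f n x))\<^sup>2)" for n
    using expv_fun_L2_inner(1)[OF f f, of n] unfolding cm by (simp only: complex_of_real_integrable_eq)
  have norm: "complex_of_real (\<integral>x. (cmod (expv_fun f n x))\<^sup>2 \<partial>particles n)
      = complex_of_real ((Re (l2_inner half_line f f)) ^ n /\<^sub>R fact n)" for n
  proof -
    define r where "r = Re (l2_inner half_line f f)"
    have "l2_inner half_line f f = complex_of_real r"
      unfolding l2_inner_def r_def
      by (simp add: complex_norm_square[symmetric] mult.commute[of "cnj _"] del: of_real_power)
    then have "l2_inner (particles n) (expv_fun f n) (expv_fun f n)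
        = complex_of_real (r ^ n /\<^sub>R fact n)"
      unfolding expv_fun_L2_inner(2)[OF f f] by (simp add: scaleR_conv_of_real)
    then show ?thesis
      unfolding l2_inner_def[of "particles n"] cm r_def[symmetric] integral_complex_of_real .
  qed
  have "(\<lambda>n. \<integral>x. (cmod (expv_fun f n x))\<^sup>2 \<partial>particles n) summable_on UNIV"
  proof -
    have "(\<lambda>n. (Re (l2_inner half_line f f)) ^ n /\<^sub>R fact n) summable_on UNIV"
      using summable_norm_exp[of "Re (l2_inner half_line f f)"]
      by (intro norm_summable_imp_summable_on)
    then show ?thesis using norm by (simp only: of_real_eq_iff)
  qed
  moreover have "expv_fun f n (x \<circ> \<sigma>) = expv_fun f n x" if "\<sigma> permutes {..<n}" for n x \<sigma>
    using prod.permute[OF that, of "\<lambda>i. f (x i)"] by (simp add: expv_fun_def o_def)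
  ultimately show ?thesis using int by (simp add: fock_vectors_def L2_def)
qed

lemma cinner_expv:
  assumes "f \<in> L2 half_line" "g \<in> L2 half_line"
  shows "cinner (expv f) (expv g) = exp (l2_inner half_line f g)"
proof -
  have "cinner (expv f) (expv g) = fock_inner (expv_fun f) (expv_fun g)"
    unfolding expv_def
    by (rule cinner_fock.abs_eq) (simp_all add: fock_rel_def expv_fun_fock_vectors assms)
  also have "\<dots> = (\<Sum>\<^sub>\<infinity>n. (l2_inner half_line f g) ^ n /\<^sub>R fact n)"
    by (simp add: fock_inner_def expv_fun_L2_inner assms)
  also have "\<dots> = exp (l2_inner half_line f g)"
    by (intro infsumI norm_summable_imp_has_sum exp_converges summable_norm_exp)
  finally show ?thesis .
qed


section \<open>The universal rotation algebra\<close>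

type_synonym h_space = "(int \<times> int \<times> int, complex) ell2"
type_synonym h_fock = "(int \<times> int \<times> int, fock) ell2"

definition op_U :: "h_space \<Rightarrow>\<^sub>L h_space" where
  "op_U = reindex_op (\<lambda>(m, n, p). (m + 1, n, p))"
definition op_V :: "h_space \<Rightarrow>\<^sub>L h_space" where
  "op_V = reindex_op (\<lambda>(m, n, p). (m, n + 1, m + p))"
definition op_Z :: "h_space \<Rightarrow>\<^sub>L h_space" where
  "op_Z = reindex_op (\<lambda>(m, n, p). (m, n, p + 1))"

text \<open>The universal rotation algebra is identified with its image under the faithful representation
  on \<open>\<ell>\<^sup>2(\<int>\<^sup>3)\<close> that sends the generators to the operators above, that is, with the operator-norm
  closure of \<open>rot_alg0\<close>.\<close>

definition rot_alg0 :: "(h_space \<Rightarrow>\<^sub>L h_space) set" where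
  "rot_alg0 = star_algebra {op_U, op_V, op_Z}"

definition rot_alg :: "(h_space \<Rightarrow>\<^sub>L h_space) set" where
  "rot_alg = closure rot_alg0"

definition monomial :: "int \<Rightarrow> int \<Rightarrow> int \<Rightarrow> h_space \<Rightarrow>\<^sub>L h_space" where
  "monomial m n p = unitary_power op_U m o\<^sub>L unitary_power op_V n o\<^sub>L unitary_power op_Z p"

definition shift :: "int \<times> int \<times> int \<Rightarrow> int \<times> int \<times> int \<Rightarrow> int \<times> int \<times> int" where
  "shift = (\<lambda>(m, n, p) (a, b, c). (a + m, b + n, c + n * (a + m) + p))"

lemma shift_shift: "shift (m', n', p') (shift (m, n, p) i) = shift (m + m', n + n', p + p' - m' * n) i"
  by (cases i) (simp add: shift_def algebra_simps)

lemma shift_zero: "shift (0, 0, 0) = id"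
  by (auto simp: shift_def)

lemma bij_shift: "bij (shift k)"
proof (cases k)
  case (fields m n p)
  show ?thesis unfolding fields
    by (rule o_bij[where g = "shift (- m, - n, - p - m * n)"])
      (auto simp: fun_eq_iff shift_shift shift_zero)
qed

lemma reindex_op_shift:
  "reindex_op (shift (m, n, p)) o\<^sub>L reindex_op (shift (m', n', p'))
    = reindex_op (shift (m + m', n + n', p + p' - m' * n))"
  by (rule blinfun_eqI, rule ell2_nth_inject[THEN iffD1])
    (auto simp: fun_eq_iff reindex_op_nth bij_shift shift_shift)

lemma reindex_op_shift_zero: "reindex_op (shift (0, 0, 0)) = id_blinfun"
  by (rule blinfun_eqI, rule ell2_nth_inject[THEN iffD1])
    (auto simp: fun_eq_iff reindex_op_nth bij_shift shift_zero)

lemma cinner_reindex_op_shift: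
  fixes x y :: h_space
  shows "cinner (reindex_op (shift (- m, - n, - p - m * n)) x) y
      = cinner x (reindex_op (shift (m, n, p)) y)"
proof -
  have "(\<Sum>\<^sub>\<infinity>i. cinner (ell2_nth x (shift (- m, - n, - p - m * n) i)) (ell2_nth y i))
      = (\<Sum>\<^sub>\<infinity>i. cinner (ell2_nth x (shift (- m, - n, - p - m * n) (shift (m, n, p) i)))
          (ell2_nth y (shift (m, n, p) i)))"
    by (rule infsum_reindex_bij_betw[OF bij_shift, symmetric])
  then show ?thesis
    by (simp add: cinner_ell2_def reindex_op_nth bij_shift shift_shift shift_zero)
qed

lemma adj_reindex_op_shift:
  "adj (reindex_op (shift (m, n, p)) :: h_space \<Rightarrow>\<^sub>L h_space) = reindex_op (shift (- m, - n, - p - m * n))"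
  by (rule adj_eqI) (rule cinner_reindex_op_shift)

lemma unitary_power_reindex_op:
  fixes T :: "int \<Rightarrow> h_space \<Rightarrow>\<^sub>L h_space"
  assumes "T 0 = id_blinfun" "\<And>k l. T k o\<^sub>L T l = T (k + l)" "adj (T 1) = T (- 1)"
  shows "unitary_power (T 1) m = T m"
proof -
  have "((\<lambda>S. T e o\<^sub>L S) ^^ n) id_blinfun = T (int n * e)" for n e
    by (induction n) (simp_all add: assms algebra_simps)
  then show ?thesis by (simp add: unitary_power_def assms)
qed

lemma op_shift:
  "op_U = reindex_op (shift (1, 0, 0))"
  "op_V = reindex_op (shift (0, 1, 0))"
  "op_Z = reindex_op (shift (0, 0, 1))"
  by (auto simp: op_U_def op_V_def op_Z_def shift_def split_def algebra_simps)

lemma op_nth: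
  "ell2_nth (op_U u) (m, n, p) = ell2_nth u (m + 1, n, p)"
  "ell2_nth (op_V u) (m, n, p) = ell2_nth u (m, n + 1, m + p)"
  "ell2_nth (op_Z u) (m, n, p) = ell2_nth u (m, n, p + 1)"
  by (simp_all add: op_shift reindex_op_nth bij_shift) (simp_all add: shift_def add.commute)

lemma op_commutation:
  "op_U o\<^sub>L op_V = op_Z o\<^sub>L op_V o\<^sub>L op_U"
  "op_U o\<^sub>L op_Z = op_Z o\<^sub>L op_U" "op_V o\<^sub>L op_Z = op_Z o\<^sub>L op_V"
  by (simp_all add: op_shift reindex_op_shift)

lemma unitary_power_op:
  "unitary_power op_U m = reindex_op (shift (m, 0, 0))"
  "unitary_power op_V m = reindex_op (shift (0, m, 0))"
  "unitary_power op_Z m = reindex_op (shift (0, 0, m))"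
proof -
  show "unitary_power op_U m = reindex_op (shift (m, 0, 0))"
    unfolding op_shift
    by (rule unitary_power_reindex_op[where T = "\<lambda>m. reindex_op (shift (m, 0, 0))"])
      (simp_all only: reindex_op_shift_zero reindex_op_shift adj_reindex_op_shift, simp_all)
  show "unitary_power op_V m = reindex_op (shift (0, m, 0))"
    unfolding op_shift
    by (rule unitary_power_reindex_op[where T = "\<lambda>m. reindex_op (shift (0, m, 0))"])
      (simp_all only: reindex_op_shift_zero reindex_op_shift adj_reindex_op_shift, simp_all)
  show "unitary_power op_Z m = reindex_op (shift (0, 0, m))"
    unfolding op_shift
    by (rule unitary_power_reindex_op[where T = "\<lambda>m. reindex_op (shift (0, 0, m))"])
      (simp_all only: reindex_op_shift_zero reindex_op_shift adj_reindex_op_shift, simp_all)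
qed

lemma monomial_shift: "monomial m n p = reindex_op (shift (m, n, p))"
  by (simp add: monomial_def unitary_power_op reindex_op_shift)

lemma monomial_nth:
  "ell2_nth (monomial m n p u) (a, b, c) = ell2_nth u (a + m, b + n, c + n * (a + m) + p)"
  unfolding monomial_shift reindex_op_nth[OF bij_shift] by (simp add: shift_def)

lemma cscale_reindex_op: "reindex_op (shift k) o\<^sub>L cscale c = cscale c o\<^sub>L reindex_op (shift k)"
  by (rule blinfun_eqI, rule ell2_nth_inject[THEN iffD1])
    (auto simp: fun_eq_iff reindex_op_nth bij_shift cscale.rep_eq scaleC_ell2.rep_eq)

lemma cscale_cscale: "cscale c o\<^sub>L (cscale d o\<^sub>L T) = cscale (c * d) o\<^sub>L T"
  by (rule blinfun_eqI) (simp add: cscale.rep_eq scaleC_scaleC)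

lemma cscale_add: "cscale (c + d) o\<^sub>L T = (cscale c o\<^sub>L T) + (cscale d o\<^sub>L T)"
  by (rule blinfun_eqI) (simp add: cscale.rep_eq scaleC_add_left blinfun.add_left)

lemma cscale_scaleR: "cscale (complex_of_real r) o\<^sub>L T = r *\<^sub>R T"
  by (rule blinfun_eqI) (simp add: cscale.rep_eq scaleR_scaleC[symmetric] blinfun.scaleR_left)

lemma bounded_linear_compose:
  "bounded_linear (\<lambda>T. S o\<^sub>L T)" "bounded_linear (\<lambda>S. S o\<^sub>L T)"
  by (rule bounded_bilinear.bounded_linear_right[OF bounded_bilinear_blinfun_compose],
      rule bounded_bilinear.bounded_linear_left[OF bounded_bilinear_blinfun_compose])

lemma compose_assoc: "(R o\<^sub>L S) o\<^sub>L T = R o\<^sub>L (S o\<^sub>L T)"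
  by (rule blinfun_eqI) simp

definition scaled_monomials :: "(h_space \<Rightarrow>\<^sub>L h_space) set" where
  "scaled_monomials = {cscale c o\<^sub>L monomial m n p |c m n p. True}"

lemma scaled_monomialsI: "cscale c o\<^sub>L reindex_op (shift k) \<in> scaled_monomials"
  by (cases k) (auto simp: scaled_monomials_def monomial_shift)

lemma scaled_monomialsE:
  assumes "b \<in> scaled_monomials"
  obtains c m n p where "b = cscale c o\<^sub>L reindex_op (shift (m, n, p))"
  using assms unfolding scaled_monomials_def monomial_shift by blast

lemma span_linear_image:
  assumes "linear f" "\<And>b. b \<in> B \<Longrightarrow> f b \<in> span C" "x \<in> span B"
  shows "f x \<in> span C"
  using assms(3)
proof (induction rule: span_induct)
  case base
  show ?case
    using linear_subspace_vimage[OF assms(1), of "span C"]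
    by (simp add: vimage_def subspace_span)
qed (rule assms(2))

lemma span_scaled_monomials_compose:
  assumes "a \<in> span scaled_monomials" "b \<in> span scaled_monomials"
  shows "a o\<^sub>L b \<in> span scaled_monomials"
proof (rule span_linear_image[where f = "\<lambda>a. a o\<^sub>L b", OF _ _ assms(1)])
  show "linear (\<lambda>a. a o\<^sub>L b)" by (intro bounded_linear.linear bounded_linear_compose)
  fix a assume a: "a \<in> scaled_monomials"
  show "a o\<^sub>L b \<in> span scaled_monomials"
  proof (rule span_linear_image[where f = "\<lambda>b. a o\<^sub>L b", OF _ _ assms(2)])
    show "linear (\<lambda>b. a o\<^sub>L b)" by (intro bounded_linear.linear bounded_linear_compose)
    fix b assume b: "b \<in> scaled_monomials"
    obtain c m n p d m' n' p' where ab: "a = cscale c o\<^sub>L reindex_op (shift (m, n, p))"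
      "b = cscale d o\<^sub>L reindex_op (shift (m', n', p'))"
      using a b by (metis scaled_monomialsE)
    have "a o\<^sub>L b = cscale c o\<^sub>L ((reindex_op (shift (m, n, p)) o\<^sub>L cscale d)
        o\<^sub>L reindex_op (shift (m', n', p')))"
      by (simp add: ab compose_assoc)
    also have "\<dots> = cscale (c * d) o\<^sub>L reindex_op (shift (m + m', n + n', p + p' - m' * n))"
      unfolding cscale_reindex_op compose_assoc cscale_cscale reindex_op_shift ..
    finally show "a o\<^sub>L b \<in> span scaled_monomials"
      by (simp add: span_base scaled_monomialsI)
  qed
qed

lemma cscale_one: "cscale 1 o\<^sub>L T = T"
  by (rule blinfun_eqI) (simp add: cscale.rep_eq)

lemma reindex_op_span: "reindex_op (shift k) \<in> span scaled_monomials"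
  using scaled_monomialsI[of 1 k] by (simp add: cscale_one span_base)

lemma span_scaled_monomials_cscale:
  assumes "a \<in> span scaled_monomials" shows "cscale c o\<^sub>L a \<in> span scaled_monomials"
proof -
  have "(cscale c o\<^sub>L reindex_op (shift (0, 0, 0))) o\<^sub>L a \<in> span scaled_monomials"
    by (intro span_scaled_monomials_compose assms span_base scaled_monomialsI)
  moreover have "(cscale c o\<^sub>L reindex_op (shift (0, 0, 0))) o\<^sub>L a = cscale c o\<^sub>L a"
    by (rule blinfun_eqI) (simp add: reindex_op_shift_zero)
  ultimately show ?thesis by simp
qed

lemma span_scaled_monomials_adj:
  assumes "a \<in> span scaled_monomials"
  shows "adj a \<in> span scaled_monomials" "cinner (adj a x) y = cinner x (a y)"
proof -
  have "\<exists>b \<in> span scaled_monomials. \<forall>x y. cinner (b x) y = cinner x (a y)"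
    using assms
  proof (induction rule: span_induct_alt)
    case base
    have "cinner (blinfun_apply 0 x) y = cinner x (blinfun_apply 0 y)" for x y :: h_space
      using cinner_scaleC_left[of 0 x y] cinner_scaleC_right[of x 0 y] by simp
    then show ?case using span_zero by blast
  next
    case (step r s t)
    then obtain t' where t': "t' \<in> span scaled_monomials" "\<And>x y. cinner (t' x) y = cinner x (t y)"
      by blast
    obtain c m n p where s: "s = cscale c o\<^sub>L reindex_op (shift (m, n, p))"
      using step(1) by (rule scaled_monomialsE)
    define q where "q = (- m, - n, - p - m * n)"
    have "cinner (reindex_op (shift q) x) y = cinner x (reindex_op (shift (m, n, p)) y)" for x y :: h_space
      unfolding q_def by (rule cinner_reindex_op_shift)
    then have "cinner (((cscale (complex_of_real r * cnj c) o\<^sub>L reindex_op (shift q)) + t') x) y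
        = cinner x ((r *\<^sub>R s + t) y)" for x y
      by (simp add: s t' blinfun.add_left blinfun.scaleR_left cinner_add_left cinner_add_right
          cscale.rep_eq cinner_scaleC_left cinner_scaleC_right scaleR_scaleC mult_ac)
    moreover have "(cscale (complex_of_real r * cnj c) o\<^sub>L reindex_op (shift q)) + t' \<in> span scaled_monomials"
      by (intro span_add span_base scaled_monomialsI t')
    ultimately show ?case by blast
  qed
  then obtain b where b: "b \<in> span scaled_monomials" "\<And>x y. cinner (b x) y = cinner x (a y)"
    by blast
  then have "adj a = b" by (intro adj_eqI)
  then show "adj a \<in> span scaled_monomials" "cinner (adj a x) y = cinner x (a y)"
    using b by auto
qed

lemma monomial_in_rot_alg0: "monomial m n p \<in> rot_alg0"
proof -
  have id: "id_blinfun \<in> rot_alg0"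
  proof -
    have "adj op_U o\<^sub>L op_U \<in> rot_alg0"
      unfolding rot_alg0_def by (intro star_algebra.mult star_algebra.star star_algebra.gen) auto
    then show ?thesis
      unfolding op_shift adj_reindex_op_shift reindex_op_shift
      by (simp add: reindex_op_shift_zero)
  qed
  have "unitary_power T k \<in> rot_alg0" if "T \<in> {op_U, op_V, op_Z}" for T k
  proof -
    have T: "T \<in> rot_alg0" "adj T \<in> rot_alg0"
      using that unfolding rot_alg0_def
      by (auto intro: star_algebra.gen star_algebra.star)
    have "((\<lambda>S. R o\<^sub>L S) ^^ n) id_blinfun \<in> rot_alg0" if "R \<in> rot_alg0" for R n
      by (induction n) (use id that in \<open>auto simp: rot_alg0_def intro: star_algebra.mult\<close>)
    then show ?thesis using T by (simp add: unitary_power_def)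
  qed
  then show ?thesis
    unfolding monomial_def rot_alg0_def by (intro star_algebra.mult) (auto simp: rot_alg0_def)
qed

lemma rot_alg0_span: "rot_alg0 = span scaled_monomials"
proof (intro set_eqI iffI)
  fix x assume "x \<in> rot_alg0"
  then show "x \<in> span scaled_monomials"
    unfolding rot_alg0_def
  proof induction
    case (gen a)
    then show ?case unfolding op_shift using reindex_op_span by blast
  qed (intro span_add span_scaled_monomials_cscale span_scaled_monomials_compose
      span_scaled_monomials_adj; assumption)+
next
  fix x assume "x \<in> span scaled_monomials"
  then show "x \<in> rot_alg0"
  proof (induction rule: span_induct_alt)
    case base
    have "cscale 0 o\<^sub>L op_U \<in> rot_alg0"
      unfolding rot_alg0_def by (intro star_algebra.scale star_algebra.gen) simp
    moreover have "cscale 0 o\<^sub>L op_U = 0" by (rule blinfun_eqI) (simp add: cscale.rep_eq)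
    ultimately show ?case by simp
  next
    case (step r s t)
    then obtain c m n p where "s = cscale c o\<^sub>L monomial m n p"
      unfolding scaled_monomials_def by blast
    then have "r *\<^sub>R s = cscale (complex_of_real r * c) o\<^sub>L monomial m n p"
      by (simp flip: cscale_cscale add: cscale_scaleR)
    then show ?case
      using step(2) monomial_in_rot_alg0 unfolding rot_alg0_def
      by (simp add: star_algebra.add star_algebra.scale)
  qed
qed

text \<open>The value zero outside \<open>rot_alg0\<close> is a convention that makes the extension unique as a total
  function.\<close>

definition is_linear_extension ::
  "(int \<Rightarrow> int \<Rightarrow> int \<Rightarrow> h_space \<Rightarrow>\<^sub>L h_space) \<Rightarrow> ((h_space \<Rightarrow>\<^sub>L h_space) \<Rightarrow> h_space \<Rightarrow>\<^sub>L h_space) \<Rightarrow> bool" where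
  "is_linear_extension g d \<longleftrightarrow>
     (\<forall>x\<in>rot_alg0. \<forall>y\<in>rot_alg0. d (x + y) = d x + d y) \<and>
     (\<forall>c. \<forall>x\<in>rot_alg0. d (cscale c o\<^sub>L x) = cscale c o\<^sub>L d x) \<and>
     (\<forall>m n p. d (monomial m n p) = g m n p) \<and>
     (\<forall>x. x \<notin> rot_alg0 \<longrightarrow> d x = 0)"

definition linear_extension ::
  "(int \<Rightarrow> int \<Rightarrow> int \<Rightarrow> h_space \<Rightarrow>\<^sub>L h_space) \<Rightarrow> (h_space \<Rightarrow>\<^sub>L h_space) \<Rightarrow> h_space \<Rightarrow>\<^sub>L h_space" where
  "linear_extension g = (THE d. is_linear_extension g d)"

lift_definition unit_vector :: "'i \<Rightarrow> ('i, complex) ell2" is "\<lambda>i j. if j = i then 1 else 0"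
  by (rule finite_nonzero_values_imp_summable_on) (auto intro: finite_subset[of _ "{_}"])

definition coefficient :: "(h_space \<Rightarrow>\<^sub>L h_space) \<Rightarrow> int \<times> int \<times> int \<Rightarrow> complex" where
  "coefficient x = (\<lambda>(m, n, p). ell2_nth (x (unit_vector (m, n, n * m + p))) (0, 0, 0))"

lemma coefficient_linear:
  "coefficient (x + y) k = coefficient x k + coefficient y k"
  "coefficient (cscale c o\<^sub>L x) k = c * coefficient x k"
  "coefficient (r *\<^sub>R x) k = complex_of_real r * coefficient x k"
  "coefficient 0 k = 0"
  by (auto simp: coefficient_def split_def blinfun.add_left blinfun.scaleR_left plus_ell2.rep_eq
      cscale.rep_eq scaleC_ell2.rep_eq scaleC_complex_def scaleR_ell2.rep_eq zero_ell2.rep_eq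
      scaleR_conv_of_real)

lemma coefficient_monomial:
  "coefficient (monomial m n p) k = (if k = (m, n, p) then 1 else 0)"
  by (cases k) (auto simp: coefficient_def monomial_nth unit_vector.rep_eq)

lemma finite_coefficient:
  "x \<in> rot_alg0 \<Longrightarrow> finite {k. coefficient x k \<noteq> 0}"
  unfolding rot_alg0_span
proof (induction rule: span_induct_alt)
  case base
  show ?case by (simp add: coefficient_linear)
next
  case (step r s t)
  then obtain c m n p where s: "s = cscale c o\<^sub>L monomial m n p"
    unfolding scaled_monomials_def by blast
  have "{k. coefficient (r *\<^sub>R s + t) k \<noteq> 0} \<subseteq> insert (m, n, p) {k. coefficient t k \<noteq> 0}"
    by (auto simp: s coefficient_linear coefficient_monomial)
  then show ?case using step(2) by (meson finite_insert finite_subset)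
qed

lemma ex1_linear_extension: "\<exists>!d. is_linear_extension g d"
proof (rule ex_ex1I)
  define G where "G = (\<lambda>(m, n, p). g m n p)"
  define d where "d x = (if x \<in> rot_alg0 then
    \<Sum>k | coefficient x k \<noteq> 0. cscale (coefficient x k) o\<^sub>L G k else 0)" for x
  have d: "d x = (\<Sum>k\<in>F. cscale (coefficient x k) o\<^sub>L G k)"
    if "x \<in> rot_alg0" "finite F" "{k. coefficient x k \<noteq> 0} \<subseteq> F" for x F
  proof -
    have "cscale 0 o\<^sub>L T = 0" for T :: "h_space \<Rightarrow>\<^sub>L h_space"
      by (rule blinfun_eqI) (simp add: cscale.rep_eq)
    then show ?thesis
      unfolding d_def using that by (auto intro!: sum.mono_neutral_left)
  qed
  have "is_linear_extension g d"
    unfolding is_linear_extension_def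
  proof (intro conjI allI ballI impI)
    fix x y assume xy: "x \<in> rot_alg0" "y \<in> rot_alg0"
    define F where "F = {k. coefficient x k \<noteq> 0} \<union> {k. coefficient y k \<noteq> 0}"
    have F: "finite F" using xy by (simp add: F_def finite_coefficient)
    have "x + y \<in> rot_alg0" using xy by (simp add: rot_alg0_def star_algebra.add)
    then have "d (x + y) = (\<Sum>k\<in>F. cscale (coefficient (x + y) k) o\<^sub>L G k)"
      by (rule d[OF _ F]) (auto simp: F_def coefficient_linear)
    also have "\<dots> = d x + d y"
      by (subst (1 2) d[OF _ F]) (auto simp: xy F_def coefficient_linear cscale_add sum.distrib)
    finally show "d (x + y) = d x + d y" .
  next
    fix c x assume x: "x \<in> rot_alg0"
    define F where "F = {k. coefficient x k \<noteq> 0}"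
    have F: "finite F" using x by (simp add: F_def finite_coefficient)
    have "cscale c o\<^sub>L x \<in> rot_alg0" using x by (simp add: rot_alg0_def star_algebra.scale)
    then have "d (cscale c o\<^sub>L x) = (\<Sum>k\<in>F. cscale (coefficient (cscale c o\<^sub>L x) k) o\<^sub>L G k)"
      by (rule d[OF _ F]) (auto simp: F_def coefficient_linear)
    also have "\<dots> = cscale c o\<^sub>L d x"
      by (subst d[OF x F]) (auto simp: F_def coefficient_linear cscale_cscale
          bounded_linear.linear[OF bounded_linear_compose(1), THEN linear_sum])
    finally show "d (cscale c o\<^sub>L x) = cscale c o\<^sub>L d x" .
  next
    fix m n p
    have "d (monomial m n p) = (\<Sum>k\<in>{(m, n, p)}. cscale (coefficient (monomial m n p) k) o\<^sub>L G k)"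
      by (rule d) (auto simp: monomial_in_rot_alg0 coefficient_monomial)
    then show "d (monomial m n p) = g m n p" by (simp add: coefficient_monomial cscale_one G_def)
  qed (simp add: d_def)
  then show "\<exists>d. is_linear_extension g d" by blast
next
  fix d d' assume d: "is_linear_extension g d" "is_linear_extension g d'"
  have "x \<in> rot_alg0 \<and> d x = d' x" if "x \<in> rot_alg0" for x
    using that unfolding rot_alg0_span
  proof (induction rule: span_induct_alt)
    case base
    have "d 0 + d 0 = d 0" "d' 0 + d' 0 = d' 0"
      using d span_zero unfolding is_linear_extension_def rot_alg0_span by (metis add.right_neutral)+
    then show ?case by (simp add: span_zero)
  next
    case (step r s t)
    then obtain c m n p where s: "s = cscale c o\<^sub>L monomial m n p"
      unfolding scaled_monomials_def by blast
    have rs: "r *\<^sub>R s = cscale (complex_of_real r * c) o\<^sub>L monomial m n p"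
      unfolding s by (simp flip: cscale_cscale add: cscale_scaleR)
    have "cscale (complex_of_real r * c) o\<^sub>L monomial m n p \<in> rot_alg0"
      using monomial_in_rot_alg0 by (simp add: rot_alg0_def star_algebra.scale)
    then show ?case unfolding rs
      using d step(2) monomial_in_rot_alg0[of m n p] unfolding is_linear_extension_def
      by (simp add: rot_alg0_span span_add)
  qed
  then show "d = d'" using d unfolding is_linear_extension_def by (metis ext)
qed

lemmas is_linear_extension_linear_extension =
  theI'[OF ex1_linear_extension, folded linear_extension_def]


section \<open>The generator of the flow\<close>

definition delta1 :: "(h_space \<Rightarrow>\<^sub>L h_space) \<Rightarrow> h_space \<Rightarrow>\<^sub>L h_space" where
  "delta1 = linear_extension (\<lambda>m n p. cscale (of_int m) o\<^sub>L monomial m n p)"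

definition delta2 :: "(h_space \<Rightarrow>\<^sub>L h_space) \<Rightarrow> h_space \<Rightarrow>\<^sub>L h_space" where
  "delta2 = linear_extension (\<lambda>m n p. cscale (of_int n) o\<^sub>L monomial m n p)"

definition delta :: "complex \<Rightarrow> complex \<Rightarrow> (h_space \<Rightarrow>\<^sub>L h_space) \<Rightarrow> h_space \<Rightarrow>\<^sub>L h_space" where
  "delta c1 c2 x = (cscale c1 o\<^sub>L delta1 x) + (cscale c2 o\<^sub>L delta2 x)"

definition delta_dagger :: "complex \<Rightarrow> complex \<Rightarrow> (h_space \<Rightarrow>\<^sub>L h_space) \<Rightarrow> h_space \<Rightarrow>\<^sub>L h_space" where
  "delta_dagger c1 c2 x = adj (delta c1 c2 (adj x))"

definition tau :: "complex \<Rightarrow> complex \<Rightarrow> (h_space \<Rightarrow>\<^sub>L h_space) \<Rightarrow> h_space \<Rightarrow>\<^sub>L h_space" where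
  "tau c1 c2 = linear_extension (\<lambda>m n p.
     cscale (- (1/2 * complex_of_real ((cmod c1)\<^sup>2) * (of_int m)\<^sup>2
              + 1/2 * complex_of_real ((cmod c2)\<^sup>2) * (of_int n)\<^sup>2
              + cnj c1 * c2 * of_int m * of_int n
              + (cnj c1 * c2 - c1 * cnj c2) * of_int p))
     o\<^sub>L monomial m n p)"

text \<open>The tensor product of an algebra of operators on \<open>h\<close> with the bounded operators on
  \<open>\<complex>\<^sup>2\<close> is identified with the two-by-two matrices over that algebra.\<close>

definition phi :: "complex \<Rightarrow> complex \<Rightarrow> (h_space \<Rightarrow>\<^sub>L h_space) \<Rightarrow> (h_space \<Rightarrow>\<^sub>L h_space)^2^2" where
  "phi c1 c2 x = vector [vector [tau c1 c2 x, delta_dagger c1 c2 x],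
                         vector [delta c1 c2 x, 0]]"

text \<open>The slice \<open>(1 \<otimes> \<langle>\<xi>|) M (1 \<otimes> |\<eta>\<rangle>)\<close> of an operator matrix.\<close>

definition slice :: "complex^2 \<Rightarrow> complex^2 \<Rightarrow> (h_space \<Rightarrow>\<^sub>L h_space)^2^2 \<Rightarrow> h_space \<Rightarrow>\<^sub>L h_space" where
  "slice \<xi> \<eta> M = (\<Sum>i\<in>UNIV. \<Sum>j\<in>UNIV. cscale (cnj (\<xi> $ i)) o\<^sub>L (M $ i $ j) o\<^sub>L cscale (\<eta> $ j))"

definition hat :: "(real \<Rightarrow> complex) \<Rightarrow> real \<Rightarrow> complex^2" where
  "hat f s = vector [1, f s]"

definition before :: "real \<Rightarrow> (real \<Rightarrow> complex) \<Rightarrow> real \<Rightarrow> complex" where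
  "before t f = (\<lambda>s. if 0 \<le> s \<and> s < t then f s else 0)"

definition after :: "real \<Rightarrow> (real \<Rightarrow> complex) \<Rightarrow> real \<Rightarrow> complex" where
  "after t f = (\<lambda>s. if t \<le> s then f s else 0)"

definition adapted :: "(h_space \<Rightarrow>\<^sub>L h_space) set \<Rightarrow>
    (real \<Rightarrow> (h_space \<Rightarrow>\<^sub>L h_space) \<Rightarrow> (h_fock \<Rightarrow>\<^sub>L h_fock)) \<Rightarrow> bool" where
  "adapted A j \<longleftrightarrow>
     (\<forall>u v. \<forall>f\<in>L2 half_line. \<forall>g\<in>L2 half_line. \<forall>t\<ge>0. \<forall>a\<in>A.
        cinner (u \<otimes>\<^sub>h expv f) (j t a (v \<otimes>\<^sub>h expv g))
        = cinner (u \<otimes>\<^sub>h expv (before t f)) (j t a (v \<otimes>\<^sub>h expv (before t g)))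
          * cinner (expv (after t f)) (expv (after t g)))"

end

theory Submission
  imports Defs
begin

text \<open>On the monomial with index \<open>k = (m, n, p)\<close> the flow is explicit: with \<open>z = m c\<^sub>1 + n c\<^sub>2\<close> it is a scalar
  phase times \<open>U\<^sup>m V\<^sup>n Z\<^sup>p \<otimes> W(z 1\<^bsub>[0,t)\<^esub>)\<close>, where \<open>W\<close> denotes the Weyl operators.  The phase makes
  \<open>\<pi>\<^sub>t(k)\<close>, the second factor with its phase, a unitary representation of the Heisenberg group.
  Since the algebra is represented by the regular representation of that group, Fell's absorption
  principle shows that the regular representation tensored with \<open>\<pi>\<^sub>t\<close> is unitarily equivalent to its ampliation.
  So the map is contractive on the span of the monomials and extends to the norm closure.  Adaptedness and the
  differential equation are read off from the exponentials
  \<open>\<langle>\<epsilon>(f), \<pi>\<^sub>t(k) \<epsilon>(g)\<rangle>\<close>.\<close>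

section \<open>Complex Hilbert spaces\<close>

text \<open>The phase is dictated by the quantum Ito formula. Composing two displacements over
  \<open>[0,t)\<close> produces the scalar \<open>exp (- t * cnj (charge k) * charge l)\<close>,
  which is not symmetric in \<open>k\<close> and \<open>l\<close>, so Weyl operators alone represent
  the group only projectively. On monomials the Ito formula for \<open>tau\<close> says that
  \<open>drift\<close> fails to be additive by exactly this kind of term; the part of
  \<open>tau\<close> in \<open>p\<close> lets the central generator \<open>Z\<close>, whose charge
  is zero, absorb the asymmetry.

  Contractivity has to come from a spatial argument, since \<open>rot_alg0\<close> is not complete
  and multiplicativity alone does not control the operator norm there. Fell absorption reduces it to
  ampliations, whose norm is bounded by working in finitely many orthonormal directions of the Fock
  space at a time.

  The functions \<open>f\<close> and \<open>g\<close> are only square integrable, so the exponent of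
  a matrix element is an indefinite integral that need not be differentiable everywhere. The
  equation therefore rests on an integral identity for its exponential, obtained by comparing
  increments instead of derivatives.\<close>

class chilbert = complex_inner + complete_space

instance chilbert \<subseteq> banach ..

lemma cinner_zero [simp]: "cinner x (0::'a::complex_inner) = 0" "cinner (0::'a) x = 0"
  using cinner_scaleC_right[of x 0 x] cinner_scaleC_left[of 0 x x] by simp_all

lemma cinner_scaleR_right: "cinner x (r *\<^sub>R y) = r *\<^sub>R cinner x (y::'a::complex_inner)"
  unfolding scaleR_scaleC cinner_scaleC_right by (simp add: scaleC_complex_def)

lemma cinner_scaleR_left: "cinner (r *\<^sub>R x) y = r *\<^sub>R cinner x (y::'a::complex_inner)"
  unfolding scaleR_scaleC cinner_scaleC_left by (simp add: scaleC_complex_def)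

lemma bounded_bilinear_cinner [bounded_bilinear]: "bounded_bilinear (cinner :: 'a::complex_inner \<Rightarrow> 'a \<Rightarrow> complex)"
  by (rule bounded_bilinear.intro)
    (auto simp: cinner_add_left cinner_add_right cinner_scaleR_right cinner_scaleR_left
      intro!: exI[of _ 1] norm_cinner_le)

interpretation cinner: bounded_bilinear "cinner :: 'a::complex_inner \<Rightarrow> 'a \<Rightarrow> complex"
  by (rule bounded_bilinear_cinner)

lemma bounded_bilinear_scaleC [bounded_bilinear]: "bounded_bilinear ((*\<^sub>C) :: complex \<Rightarrow> 'a::complex_inner \<Rightarrow> 'a)"
  by (rule bounded_bilinear.intro)
    (auto simp: scaleC_add_left scaleC_add_right scaleR_scaleC scaleC_scaleC norm_scaleC mult.commute
      scaleC_complex_def intro!: exI[of _ 1])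

lemma cinner_Im_inner: "Im (cinner x y) = - inner x (\<i> *\<^sub>C (y::'a::complex_inner))"
  by (simp add: inner_cinner cinner_scaleC_right)

text \<open>Polarization recovers the real inner product from the norm. The imaginary part of
  \<open>cinner\<close> is a real inner product with \<open>\<i> *\<^sub>C y\<close>, which is where
  complex linearity enters.\<close>

lemma isometry_cinner:
  fixes T :: "'a::complex_inner \<Rightarrow>\<^sub>L 'b::complex_inner"
  assumes "clinear_op T" "\<And>x. norm (T x) = norm x"
  shows "cinner (T x) (T y) = cinner x y"
proof -
  have i: "inner (T x) (T y) = inner x y" for x y
    using assms(2)[of "x + y"] assms(2)[of x] assms(2)[of y] by (simp add: dot_norm blinfun.add_right)
  have "\<i> *\<^sub>C T y = T (\<i> *\<^sub>C y)" using assms(1) by (simp add: clinear_op_def)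
  then show ?thesis
    by (intro complex_eqI) (simp_all add: cinner_Im_inner i flip: inner_cinner)
qed

text \<open>Gram-Schmidt: the residual \<open>w\<close> of a new vector is either zero or,
  normalized, a further basis vector. It allows exact finite expansions inside an
  infinite-dimensional fibre.\<close>

lemma finite_orthonormal_basis:
  fixes S :: "'a::complex_inner set"
  assumes "finite S"
  shows "\<exists>E. finite E \<and> (\<forall>e\<in>E. \<forall>e'\<in>E. cinner e e' = (if e = e' then 1 else 0)) \<and>
    (\<forall>v\<in>S. v = (\<Sum>e\<in>E. cinner e v *\<^sub>C e))"
  using assms
proof induction
  case empty
  show ?case by (intro exI[of _ "{}"]) simp
next
  case (insert v S)
  then obtain E where E: "finite E" "\<And>e e'. e \<in> E \<Longrightarrow> e' \<in> E \<Longrightarrow> cinner e e' = (if e = e' then 1 else 0)"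
    "\<And>v. v \<in> S \<Longrightarrow> v = (\<Sum>e\<in>E. cinner e v *\<^sub>C e)" by metis
  define w where "w = v - (\<Sum>e\<in>E. cinner e v *\<^sub>C e)"
  have w: "cinner e w = 0" if "e \<in> E" for e
    using that E(1) by (simp add: w_def cinner.diff_right cinner.sum_right cinner_scaleC_right E(2) if_distrib cong: if_cong)
  show ?case
  proof (cases "w = 0")
    case True
    then show ?thesis using E insert by (intro exI[of _ E]) (auto simp: w_def)
  next
    case False
    define e where "e = w /\<^sub>R norm w"
    have we: "cinner e' e = 0" "cinner e e' = 0" if "e' \<in> E" for e'
      using w[OF that] cinner_commute[of w e'] by (simp_all add: e_def cinner_scaleR_right cinner_scaleR_left)
    have ee: "cinner e e = 1"
      using False by (simp add: e_def cinner_self)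
    have e: "e \<notin> E" using we(1) ee by auto
    have ev: "cinner e v *\<^sub>C e = w"
    proof -
      have "cinner e v = cinner e w"
        using we by (simp add: w_def cinner.diff_right cinner.sum_right cinner_scaleC_right)
      also have "\<dots> = complex_of_real (norm w)"
        using False by (simp add: e_def cinner_scaleR_left cinner_self power2_eq_square scaleR_conv_of_real)
      finally show ?thesis using False by (simp add: e_def flip: scaleR_scaleC)
    qed
    have "u = (\<Sum>e'\<in>insert e E. cinner e' u *\<^sub>C e')" if u: "u \<in> insert v S" for u
    proof (cases "u = v")
      case True
      then show ?thesis using E(1) e ev by (simp add: w_def)
    next
      case False
      then have u: "u \<in> S" using u by simp
      have "cinner e u = 0"
        by (subst E(3)[OF u]) (simp add: cinner.sum_right cinner_scaleC_right we)
      then show ?thesis using E(1) e E(3)[OF u] by simp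
    qed
    then show ?thesis using E we ee e by (intro exI[of _ "insert e E"]) auto
  qed
qed

text \<open>Pythagoras for the projection \<open>p\<close> of \<open>v\<close> onto the span of
  \<open>E\<close>; the second part is the case \<open>p = v\<close>.\<close>

lemma bessel_inequality:
  fixes v :: "'a::complex_inner"
  assumes "finite E" "\<And>e e'. e \<in> E \<Longrightarrow> e' \<in> E \<Longrightarrow> cinner e e' = (if e = e' then 1 else 0)"
  shows "(\<Sum>e\<in>E. (cmod (cinner e v))\<^sup>2) \<le> (norm v)\<^sup>2"
    and "v = (\<Sum>e\<in>E. cinner e v *\<^sub>C e) \<Longrightarrow> (norm v)\<^sup>2 = (\<Sum>e\<in>E. (cmod (cinner e v))\<^sup>2)"
proof -
  define p where "p = (\<Sum>e\<in>E. cinner e v *\<^sub>C e)"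
  have ep: "cinner e p = cinner e v" if "e \<in> E" for e
  proof -
    have "cinner e p = (\<Sum>e'\<in>E. if e = e' then cinner e v else 0)"
      unfolding p_def cinner.sum_right cinner_scaleC_right
      by (intro sum.cong refl) (simp add: assms(2) that)
    then show ?thesis using that assms(1) by simp
  qed
  have pu: "cinner p u = (\<Sum>e\<in>E. cnj (cinner e v) * cinner e u)" for u
    by (simp add: p_def cinner.sum_left cinner_scaleC_left)
  have pp: "cinner p p = complex_of_real (\<Sum>e\<in>E. (cmod (cinner e v))\<^sup>2)"
    unfolding pu of_real_sum
    by (intro sum.cong refl) (simp only: ep complex_norm_square mult.commute)
  have np: "(norm p)\<^sup>2 = (\<Sum>e\<in>E. (cmod (cinner e v))\<^sup>2)"
    using pp cinner_self[of p] by (metis of_real_eq_iff)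
  have "cinner p v = cinner p p" unfolding pu by (intro sum.cong refl) (simp only: ep)
  then have pv: "inner p v = (norm p)\<^sup>2" by (simp add: inner_cinner power2_norm_eq_inner)
  have "(norm (v - p))\<^sup>2 = (norm v)\<^sup>2 - 2 * inner p v + (norm p)\<^sup>2"
    unfolding power2_norm_eq_inner inner_diff_left inner_diff_right inner_commute[of v p] by simp
  then have "(norm v)\<^sup>2 = (norm p)\<^sup>2 + (norm (v - p))\<^sup>2" using pv by simp
  then show "(\<Sum>e\<in>E. (cmod (cinner e v))\<^sup>2) \<le> (norm v)\<^sup>2" using np
    by (metis le_add_same_cancel1 zero_le_power2)
  show "(norm v)\<^sup>2 = (\<Sum>e\<in>E. (cmod (cinner e v))\<^sup>2)" if "v = (\<Sum>e\<in>E. cinner e v *\<^sub>C e)"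
  proof -
    have "norm v = norm p" unfolding p_def using that by (rule arg_cong)
    then show ?thesis using np by (simp only:)
  qed
qed

section \<open>Closures of subspaces and of graphs\<close>

lemma bounded_linear_maps_closure:
  assumes "bounded_linear f" "\<And>x. x \<in> S \<Longrightarrow> f x \<in> closure T" "x \<in> closure S"
  shows "f x \<in> closure T"
  using closure_bounded_linear_image_subset[OF assms(1), of S] assms(2,3)
    closure_minimal[of "f ` S" "closure T"] by blast

lemma subspace_closure:
  fixes S :: "'a::real_normed_vector set"
  assumes "subspace S" shows "subspace (closure S)"
proof (rule subspaceI)
  show "0 \<in> closure S" using subspace_0[OF assms] closure_subset by blast
  fix x y assume x: "x \<in> closure S" and y: "y \<in> closure S"
  obtain f g where "\<And>n. f n \<in> S" "f \<longlonglongrightarrow> x" "\<And>n. g n \<in> S" "g \<longlonglongrightarrow> y"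
    using x y unfolding closure_sequential by metis
  then show "x + y \<in> closure S"
    unfolding closure_sequential by (intro exI[of _ "\<lambda>n. f n + g n"]) (auto intro: tendsto_add subspace_add[OF assms])
next
  fix c x assume "x \<in> closure S"
  then show "c *\<^sub>R x \<in> closure S"
    by (rule bounded_linear_maps_closure[rotated 2, where f = "\<lambda>x. c *\<^sub>R x"])
      (auto intro: bounded_linear_scaleR_right subsetD[OF closure_subset] subspace_scale[OF assms])
qed

lemma bounded_linear_zero_on_closure_span:
  assumes "bounded_linear f" "\<And>x. x \<in> B \<Longrightarrow> f x = 0" "x \<in> closure (span B)"
  shows "f x = 0"
proof -
  have "f x = 0" if "x \<in> span B" for x
    using linear_eq_0_on_span[OF bounded_linear.linear[OF assms(1)] assms(2) that] .
  then show ?thesis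
    using continuous_constant_on_closure[OF linear_continuous_on[OF assms(1)], of "span B" 0 x] assms(3)
    by blast
qed

text \<open>The density principle behind most identities below. Since \<open>span\<close> is the
  real span, the generating sets to which it is applied contain all complex multiples of their
  members.\<close>

lemma bounded_linear_eq_on_closure_span:
  assumes "bounded_linear f" "bounded_linear g" "\<And>x. x \<in> B \<Longrightarrow> f x = g x" "x \<in> closure (span B)"
  shows "f x = g x"
  using bounded_linear_zero_on_closure_span[OF bounded_linear_sub[OF assms(1,2)], of B x] assms(3,4)
  by simp

lemma closure_span_image:
  assumes "bounded_linear f" "\<And>b. b \<in> B \<Longrightarrow> f b \<in> closure (span C)" "x \<in> closure (span B)"
  shows "f x \<in> closure (span C)"
proof (rule bounded_linear_maps_closure[OF assms(1) _ assms(3)])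
  have "subspace (f -` closure (span C))"
    by (intro linear_subspace_vimage bounded_linear.linear assms(1) subspace_closure subspace_span)
  moreover have "B \<subseteq> f -` closure (span C)" using assms(2) by blast
  ultimately show "f x \<in> closure (span C)" if "x \<in> span B" for x
    using that span_minimal by blast
qed

lemma graph_norm_le_closure:
  fixes S :: "('a::real_normed_vector \<times> 'b::real_normed_vector) set"
  assumes "\<And>x y. (x, y) \<in> S \<Longrightarrow> norm y \<le> M * norm x" "(x, y) \<in> closure S"
  shows "norm y \<le> M * norm x"
proof -
  have "closed {p :: 'a \<times> 'b. norm (snd p) \<le> M * norm (fst p)}"
    by (intro closed_Collect_le continuous_intros)
  moreover have "S \<subseteq> {p. norm (snd p) \<le> M * norm (fst p)}" using assms(1) by auto
  ultimately have "closure S \<subseteq> {p. norm (snd p) \<le> M * norm (fst p)}" by (intro closure_minimal)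
  then show ?thesis using assms(2) by auto
qed

text \<open>Extension by continuity, phrased for a relation: the bound makes the closed relation
  single-valued, because \<open>(0, y)\<close> forces \<open>y = 0\<close>, so well-definedness on
  the span needs no separate argument. Completeness of the target gives existence.\<close>

lemma closed_graph_total:
  fixes S :: "('a::real_normed_vector \<times> 'b::banach) set"
  assumes "subspace S" "\<And>x y. (x, y) \<in> S \<Longrightarrow> norm y \<le> M * norm x" "x \<in> closure (fst ` S)"
  shows "\<exists>!y. (x, y) \<in> closure S"
proof (rule ex_ex1I)
  obtain X where X: "\<And>n. X n \<in> fst ` S" "X \<longlonglongrightarrow> x"
    using assms(3) unfolding closure_sequential by blast
  have "\<exists>y. (X n, y) \<in> S" for n using X(1)[of n] by force
  then obtain Y where Y: "\<And>n. (X n, Y n) \<in> S" by metis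
  have le: "norm (Y m - Y n) \<le> M * norm (X m - X n)" for m n
    using assms(2) subspace_diff[OF assms(1) Y[of m] Y[of n]] by simp
  have "Cauchy X" using X(2) by (auto intro: LIMSEQ_imp_Cauchy)
  have "Cauchy Y"
  proof (rule metric_CauchyI)
    fix e :: real assume "e > 0"
    \<comment> \<open>The sign of \<open>M\<close> is unknown and it may vanish;
      \<open>\<bar>M\<bar> + 1\<close> is a positive upper bound.\<close>
    then have "e / (\<bar>M\<bar> + 1) > 0" by simp
    then obtain N where N: "\<And>m n. m \<ge> N \<Longrightarrow> n \<ge> N \<Longrightarrow> dist (X m) (X n) < e / (\<bar>M\<bar> + 1)"
      using metric_CauchyD[OF \<open>Cauchy X\<close>] by metis
    have "dist (Y m) (Y n) < e" if "m \<ge> N" "n \<ge> N" for m n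
    proof -
      have "dist (Y m) (Y n) \<le> M * norm (X m - X n)" using le by (simp add: dist_norm)
      also have "\<dots> \<le> (\<bar>M\<bar> + 1) * norm (X m - X n)" by (intro mult_right_mono) auto
      also have "\<dots> < e" using N[OF that] by (simp add: dist_norm field_simps)
      finally show ?thesis .
    qed
    then show "\<exists>N. \<forall>m\<ge>N. \<forall>n\<ge>N. dist (Y m) (Y n) < e" by blast
  qed
  then obtain y where "Y \<longlonglongrightarrow> y" using Cauchy_convergent convergent_def by blast
  then show "\<exists>y. (x, y) \<in> closure S"
    unfolding closure_sequential using X(2) Y by (intro exI[of _ y] exI[of _ "\<lambda>n. (X n, Y n)"]) (auto intro: tendsto_Pair)
next
  fix y y' assume "(x, y) \<in> closure S" "(x, y') \<in> closure S"
  then have "(0, y - y') \<in> closure S"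
    using subspace_diff[OF subspace_closure[OF assms(1)]] by fastforce
  with assms(2) have "norm (y - y') \<le> M * norm (0::'a)" by (rule graph_norm_le_closure)
  then show "y = y'" by simp
qed

section \<open>Orthogonal complements\<close>

text \<open>Hilbert's projection theorem: a minimizing sequence is Cauchy by the parallelogram law,
  and its limit satisfies the first-order condition for a minimum.\<close>

lemma closest_point_subspace:
  fixes M :: "'a::{real_inner, complete_space} set"
  assumes "subspace M" "closed M"
  shows "\<exists>p\<in>M. \<forall>m\<in>M. inner (x - p) m = 0"
proof -
  define d where "d = Inf ((\<lambda>m. (norm (x - m))\<^sup>2) ` M)"
  have M0: "M \<noteq> {}" using subspace_0[OF assms(1)] by blast
  have bdd: "bdd_below ((\<lambda>m. (norm (x - m))\<^sup>2) ` M)" by (rule bdd_belowI[of _ 0]) auto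
  have d: "d \<le> (norm (x - m))\<^sup>2" if "m \<in> M" for m
    unfolding d_def using that bdd by (intro cInf_lower) auto
  have "\<exists>m\<in>M. (norm (x - m))\<^sup>2 < d + 1 / (real n + 1)" for n
  proof -
    have "Inf ((\<lambda>m. (norm (x - m))\<^sup>2) ` M) < d + 1 / (real n + 1)" by (simp add: d_def)
    then show ?thesis using cInf_lessD[of "(\<lambda>m. (norm (x - m))\<^sup>2) ` M"] M0 by blast
  qed
  then obtain P where P: "\<And>n. P n \<in> M" "\<And>n. (norm (x - P n))\<^sup>2 < d + 1 / (real n + 1)" by metis
  have le: "(norm (P m - P n))\<^sup>2 \<le> 2 / (real m + 1) + 2 / (real n + 1)" for m n
  proof -
    \<comment> \<open>The midpoint lies in \<open>M\<close>, so its squared distance to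
      \<open>x\<close> is at least \<open>d\<close>; the parallelogram law then bounds the distance
      of the two approximants.\<close>
    have "(1/2) *\<^sub>R (P m + P n) \<in> M" by (intro subspace_scale subspace_add assms P)
    then have "4 * d \<le> 4 * (norm (x - (1/2) *\<^sub>R (P m + P n)))\<^sup>2" using d by simp
    also have "\<dots> = 2 * (norm (x - P m))\<^sup>2 + 2 * (norm (x - P n))\<^sup>2 - (norm (P m - P n))\<^sup>2"
      unfolding power2_norm_eq_inner by (simp add: inner_diff_left inner_diff_right inner_add_left inner_add_right inner_commute algebra_simps)
    finally show ?thesis using P(2)[of m] P(2)[of n] by simp
  qed
  have "Cauchy P"
  proof (rule metric_CauchyI)
    fix e :: real assume e: "e > 0"
    obtain N where N: "4 / e\<^sup>2 < real N" using reals_Archimedean2 by blast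
    have "dist (P m) (P n) < e" if "m \<ge> N" "n \<ge> N" for m n
    proof -
      have N0: "real N > 0" using N e by (smt (verit) divide_pos_pos zero_less_power)
      have "2 / (real m + 1) + 2 / (real n + 1) \<le> 2 / (real N + 1) + 2 / (real N + 1)"
        using that by (intro add_mono divide_left_mono) auto
      also have "\<dots> = 4 / (real N + 1)" by simp
      also have "\<dots> \<le> 4 / real N" using N0 by (intro divide_left_mono) auto
      also have "\<dots> < e\<^sup>2" using N N0 e by (simp add: field_simps)
      finally have "(norm (P m - P n))\<^sup>2 < e\<^sup>2" using le[of m n] by simp
      then show ?thesis using e by (simp add: dist_norm power2_less_imp_less)
    qed
    then show "\<exists>N. \<forall>m\<ge>N. \<forall>n\<ge>N. dist (P m) (P n) < e" by blast
  qed
  then obtain p where p: "P \<longlonglongrightarrow> p" using Cauchy_convergent convergent_def by blast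
  have pM: "p \<in> M" using closed_sequentially[OF assms(2) P(1) p] .
  have lim: "(\<lambda>n. d + 1 / (real n + 1)) \<longlonglongrightarrow> d + 0"
    using LIMSEQ_inverse_real_of_nat by (intro tendsto_add tendsto_const) (simp add: inverse_eq_divide add.commute)
  have "(\<lambda>n. (norm (x - P n))\<^sup>2) \<longlonglongrightarrow> (norm (x - p))\<^sup>2" by (intro tendsto_intros p)
  then have "(norm (x - p))\<^sup>2 \<le> d + 0"
    by (rule LIMSEQ_le[OF _ lim]) (intro exI allI impI less_imp_le P)
  then have min: "(norm (x - p))\<^sup>2 \<le> (norm (x - p - m))\<^sup>2" if "m \<in> M" for m
    unfolding diff_diff_eq
    using d[OF subspace_add[OF assms(1) pM that]] \<open>(norm (x - p))\<^sup>2 \<le> d + 0\<close> by linarith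
  have "inner (x - p) m = 0" if m: "m \<in> M" for m
  proof (cases "m = 0")
    case False
    \<comment> \<open>The value of \<open>r\<close> that minimizes the quadratic polynomial
      \<open>(norm (x - p - r *\<^sub>R m))\<^sup>2\<close>.\<close>
    define r where "r = inner (x - p) m / (norm m)\<^sup>2"
    have r: "inner m m * r = inner (x - p) m" using False by (simp add: r_def power2_norm_eq_inner)
    have "(norm (x - p))\<^sup>2 \<le> (norm (x - p - r *\<^sub>R m))\<^sup>2" by (intro min subspace_scale assms m)
    also have "\<dots> = (norm (x - p))\<^sup>2 - 2 * r * inner (x - p) m + r * (inner m m * r)"
    proof -
      have "(norm (u - r *\<^sub>R m))\<^sup>2 = (norm u)\<^sup>2 - 2 * r * inner u m + r * (inner m m * r)" for u
        by (simp add: power2_norm_eq_inner inner_diff_left inner_diff_right inner_commute[of m u] right_diff_distrib)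
      then show ?thesis .
    qed
    finally have "r * inner (x - p) m \<le> 0" unfolding r by linarith
    moreover have "r * inner (x - p) m = (inner (x - p) m)\<^sup>2 / (norm m)\<^sup>2"
      unfolding r_def power2_eq_square by (rule times_divide_eq_left)
    ultimately have "(inner (x - p) m)\<^sup>2 / (norm m)\<^sup>2 \<le> 0" by simp
    moreover have "(norm m)\<^sup>2 > 0" using False by simp
    ultimately have "(inner (x - p) m)\<^sup>2 \<le> 0" by (simp only: divide_le_0_iff) linarith
    then show ?thesis by simp
  qed simp
  then show ?thesis using pM by blast
qed

text \<open>The complement is assumed to lie in \<open>M\<close> instead of being zero. This suits a
  family that was completed by its own orthogonal complement, as \<open>exp_index\<close>
  is.\<close>

lemma closed_subspace_eq_UNIV:
  fixes M :: "'a::{real_inner, complete_space} set"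
  assumes "subspace M" "closed M" "\<And>y. (\<And>m. m \<in> M \<Longrightarrow> inner m y = 0) \<Longrightarrow> y \<in> M"
  shows "M = UNIV"
proof (intro equalityI subset_UNIV subsetI)
  fix x
  obtain p where p: "p \<in> M" "\<And>m. m \<in> M \<Longrightarrow> inner (x - p) m = 0"
    using closest_point_subspace[OF assms(1,2)] by blast
  then have "x - p \<in> M" by (intro assms(3)) (simp add: inner_commute)
  then show "x \<in> M" using subspace_add[OF assms(1) _ p(1)] by force
qed

section \<open>Completeness of the Fock space and of direct sums\<close>

text \<open>The reduction of the Riesz-Fischer argument: a Cauchy sequence has a subsequence with
  geometrically small increments, and its limit is the limit of the whole sequence.\<close>

lemma Cauchy_convergent_if_fast:
  fixes X :: "nat \<Rightarrow> 'a::real_normed_vector"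
  assumes "\<And>Y :: nat \<Rightarrow> 'a. (\<And>k. norm (Y (Suc k) - Y k) \<le> (1/2) ^ k) \<Longrightarrow> Cauchy Y \<Longrightarrow> convergent Y"
    and "Cauchy X"
  shows "convergent X"
proof -
  have "\<exists>N. \<forall>m\<ge>N. \<forall>n\<ge>N. dist (X m) (X n) < (1/2) ^ k" for k
    using metric_CauchyD[OF assms(2), of "(1/2) ^ k"] by simp
  then obtain N where N: "\<And>k m n. m \<ge> N k \<Longrightarrow> n \<ge> N k \<Longrightarrow> dist (X m) (X n) < (1/2) ^ k" by metis
  \<comment> \<open>The running maximum keeps \<open>r k\<close> above \<open>N k\<close>, and the
    summand \<open>k\<close> makes \<open>r\<close> strictly increasing.\<close>
  define r where "r k = k + Max (N ` {..k})" for k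
  have mx: "Max (N ` {..k}) \<le> Max (N ` {..Suc k})" for k by (rule Max_mono) auto
  have "r k < r (Suc k)" for k unfolding r_def using mx[of k] by linarith
  then have r: "strict_mono r" by (simp add: strict_mono_Suc_iff)
  have "N k \<le> Max (N ` {..k})" for k by (rule Max_ge) auto
  then have "r k \<ge> N k" for k unfolding r_def by (meson trans_le_add2)
  then have "r k \<ge> N k" "r (Suc k) \<ge> N k" for k
    using strict_mono_less_eq[OF r, of k "Suc k"] by (auto intro: order_trans)
  then have "norm ((X \<circ> r) (Suc k) - (X \<circ> r) k) \<le> (1/2) ^ k" for k
    using N[of k "r (Suc k)" "r k"] by (simp add: dist_norm less_imp_le)
  then have "convergent (X \<circ> r)" by (intro assms(1) Cauchy_subseq_Cauchy[OF assms(2) r])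
  then obtain l where l: "(X \<circ> r) \<longlonglongrightarrow> l" unfolding convergent_def by blast
  have "X \<longlonglongrightarrow> l"
  proof (rule metric_LIMSEQ_I)
    fix e :: real assume e: "e > 0"
    obtain n0 where n0: "\<And>m n. m \<ge> n0 \<Longrightarrow> n \<ge> n0 \<Longrightarrow> dist (X m) (X n) < e / 2"
      using metric_CauchyD[OF assms(2), of "e / 2"] e by auto
    obtain n1 where n1: "\<And>k. k \<ge> n1 \<Longrightarrow> dist (X (r k)) l < e / 2"
      using metric_LIMSEQ_D[OF l, of "e / 2"] e by auto
    have "dist (X n) l < e" if "n \<ge> n0" for n
      using n0[OF that, of "r (max n0 n1)"] n1[of "max n0 n1"] seq_suble[OF r, of "max n0 n1"]
        dist_triangle[of "X n" l "X (r (max n0 n1))"]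
      by simp
    then show "\<exists>n0. \<forall>n\<ge>n0. dist (X n) l < e" by blast
  qed
  then show ?thesis by (rule convergentI)
qed

text \<open>The squared norm with values in \<open>ennreal\<close>, so that it makes sense before
  membership in \<open>fock_vectors\<close> is known. Writing the sum over particle numbers as an
  integral for counting measure lets Fatou's lemma apply to it as well.\<close>

definition fock_norm2 :: "(nat \<Rightarrow> (nat \<Rightarrow> real) \<Rightarrow> complex) \<Rightarrow> ennreal" where
  "fock_norm2 \<psi> = (\<integral>\<^sup>+n. \<integral>\<^sup>+x. ennreal ((cmod (\<psi> n x))\<^sup>2) \<partial>particles n \<partial>count_space UNIV)"

lemma fock_norm2_eq:
  assumes "\<psi> \<in> fock_vectors"
  shows "fock_norm2 \<psi> = ennreal ((norm (abs_fock \<psi>))\<^sup>2)"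
proof -
  have i: "integrable (particles n) (\<lambda>x. (cmod (\<psi> n x))\<^sup>2)" for n
    using assms by (simp add: fock_vectors_def L2_def)
  have s: "(\<lambda>n. \<integral>x. (cmod (\<psi> n x))\<^sup>2 \<partial>particles n) summable_on UNIV"
    using assms by (simp add: fock_vectors_def)
  have sq: "Re (l2_inner (particles n) (\<psi> n) (\<psi> n)) = (\<integral>x. (cmod (\<psi> n x))\<^sup>2 \<partial>particles n)" for n
    by (simp add: l2_inner_def complex_norm_square[symmetric] mult.commute[of "cnj _"]
        del: of_real_power)
  have "(norm (abs_fock \<psi>))\<^sup>2 = Re (fock_inner \<psi> \<psi>)"
    using cinner_fock.abs_eq[of \<psi> \<psi>] assms
    by (simp add: power2_norm_eq_inner inner_cinner fock_rel_def)
  also have "\<dots> = (\<Sum>\<^sub>\<infinity>n. \<integral>x. (cmod (\<psi> n x))\<^sup>2 \<partial>particles n)"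
    unfolding fock_inner_def infsum_Re[OF fock_inner_summable[OF assms assms], symmetric] sq ..
  finally have n: "(norm (abs_fock \<psi>))\<^sup>2 = (\<Sum>\<^sub>\<infinity>n. \<integral>x. (cmod (\<psi> n x))\<^sup>2 \<partial>particles n)" .
  have "fock_norm2 \<psi> = (\<Sum>n. ennreal (\<integral>x. (cmod (\<psi> n x))\<^sup>2 \<partial>particles n))"
    unfolding fock_norm2_def nn_integral_count_space_nat by (simp add: nn_integral_eq_integral i)
  also have "\<dots> = ennreal (\<Sum>n. \<integral>x. (cmod (\<psi> n x))\<^sup>2 \<partial>particles n)"
    using has_sum_imp_sums[OF has_sum_infsum[OF s]] by (intro suminf_ennreal2) (auto simp: sums_iff)
  also have "(\<Sum>n. \<integral>x. (cmod (\<psi> n x))\<^sup>2 \<partial>particles n) = (norm (abs_fock \<psi>))\<^sup>2"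
    using has_sum_imp_sums[OF has_sum_infsum[OF s]] n by (simp add: sums_iff)
  finally show ?thesis .
qed

lemma fock_vectorsI:
  assumes "\<And>n. \<psi> n \<in> borel_measurable (particles n)"
    "\<And>n \<sigma>. \<sigma> permutes {..<n} \<Longrightarrow> AE x in particles n. \<psi> n (x \<circ> \<sigma>) = \<psi> n x"
    "fock_norm2 \<psi> < \<infinity>"
  shows "\<psi> \<in> fock_vectors"
proof -
  have fin: "(\<Sum>n. \<integral>\<^sup>+x. ennreal ((cmod (\<psi> n x))\<^sup>2) \<partial>particles n) < \<infinity>"
    using assms(3) by (simp add: fock_norm2_def nn_integral_count_space_nat)
  then have f1: "(\<integral>\<^sup>+x. ennreal ((cmod (\<psi> n x))\<^sup>2) \<partial>particles n) < \<infinity>" for n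
    using ennreal_suminf_lessD by blast
  have i: "integrable (particles n) (\<lambda>x. (cmod (\<psi> n x))\<^sup>2)" for n
    using f1[of n] assms(1)[of n] by (intro integrableI_bounded) auto
  have "(\<Sum>n. ennreal (\<integral>x. (cmod (\<psi> n x))\<^sup>2 \<partial>particles n)) < \<infinity>"
    using fin by (simp add: nn_integral_eq_integral i)
  then have "summable (\<lambda>n. \<integral>x. (cmod (\<psi> n x))\<^sup>2 \<partial>particles n)"
    by (intro summable_suminf_not_top) auto
  then have "(\<lambda>n. \<integral>x. (cmod (\<psi> n x))\<^sup>2 \<partial>particles n) summable_on UNIV"
    by (intro norm_summable_imp_summable_on) simp
  then show ?thesis using i assms(1,2) by (simp add: fock_vectors_def L2_def)
qed

text \<open>A termwise substitute for Cauchy-Schwarz: from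
  \<open>a * s \<le> 1 + a\<^sup>2 * s\<^sup>2\<close>, division by \<open>a = 2 ^ k\<close>
  dominates \<open>norm (d k)\<close> by a geometric term plus the given summable term.\<close>

lemma summable_if_weighted_square_summable:
  fixes d :: "nat \<Rightarrow> 'a::banach"
  assumes "summable (\<lambda>k. 2 ^ k * (norm (d k))\<^sup>2)"
  shows "summable d"
proof (rule summable_comparison_test)
  show "summable (\<lambda>k. (1/2) ^ k + 2 ^ k * (norm (d k))\<^sup>2 :: real)"
    by (intro summable_add assms summable_geometric) simp
  have "norm (d k) \<le> (1/2) ^ k + 2 ^ k * (norm (d k))\<^sup>2" for k
  proof -
    define a :: real where "a = 2 ^ k"
    have a: "a > 0" by (simp add: a_def)
    have "0 \<le> (1 - a * norm (d k))\<^sup>2 + a * norm (d k)" using a by simp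
    then have "a * norm (d k) \<le> 1 + a\<^sup>2 * (norm (d k))\<^sup>2"
      by (simp add: power2_diff power_mult_distrib)
    then have "norm (d k) \<le> 1 / a + a * (norm (d k))\<^sup>2"
      using a by (simp add: field_simps power2_eq_square)
    then show ?thesis by (simp add: a_def power_one_over)
  qed
  then show "\<exists>N. \<forall>n\<ge>N. norm (d n) \<le> (1/2) ^ n + 2 ^ n * (norm (d n))\<^sup>2" by blast
qed

lemma abs_fock_diff:
  assumes "\<psi> \<in> fock_vectors" "\<phi> \<in> fock_vectors"
  shows "abs_fock \<psi> - abs_fock \<phi> = abs_fock (\<lambda>n x. \<psi> n x - \<phi> n x)"
    and "(\<lambda>n x. \<psi> n x - \<phi> n x) \<in> fock_vectors"
proof -
  have s: "(\<lambda>n x. - 1 * \<phi> n x) \<in> fock_vectors" using assms(2) by (rule fock_vectors_scale)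
  have "(- 1) *\<^sub>C abs_fock \<phi> = abs_fock (\<lambda>n x. - 1 * \<phi> n x)"
    by (rule scaleC_fock.abs_eq) (simp add: fock_rel_def assms)
  then have "abs_fock \<psi> - abs_fock \<phi> = abs_fock (\<lambda>n x. \<psi> n x + - 1 * \<phi> n x)"
    unfolding minus_fock_def using plus_fock.abs_eq[of \<psi> "\<lambda>n x. - 1 * \<phi> n x"] assms s
    by (simp add: fock_rel_def)
  then show "abs_fock \<psi> - abs_fock \<phi> = abs_fock (\<lambda>n x. \<psi> n x - \<phi> n x)" by simp
  show "(\<lambda>n x. \<psi> n x - \<phi> n x) \<in> fock_vectors" using fock_vectors_add[OF assms(1) s] by simp
qed

text \<open>The squared increments have integrals at most \<open>(1/4) ^ k\<close>, so with weights
  \<open>2 ^ k\<close> their sum still has a finite integral and is finite almost everywhere. There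
  the increments themselves are summable.\<close>

lemma AE_convergent_if_fast:
  fixes \<psi> :: "nat \<Rightarrow> nat \<Rightarrow> (nat \<Rightarrow> real) \<Rightarrow> complex"
  assumes "\<And>k. \<psi> k \<in> fock_vectors"
    and "\<And>k. norm (abs_fock (\<psi> (Suc k)) - abs_fock (\<psi> k)) \<le> (1/2) ^ k"
  shows "AE x in particles n. convergent (\<lambda>k. \<psi> k n x)"
proof -
  define d where "d k n x = \<psi> (Suc k) n x - \<psi> k n x" for k n x
  have m[measurable]: "\<psi> k n \<in> borel_measurable (particles n)" for k n
    using assms(1)[of k] by (simp add: fock_vectors_def L2_def)
  have [measurable]: "d k n \<in> borel_measurable (particles n)" for k n
    unfolding d_def[abs_def] by measurable
  have Q: "fock_norm2 (d k) \<le> ennreal ((1/4) ^ k)" for k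
  proof -
    have "fock_norm2 (d k) = ennreal ((norm (abs_fock (\<psi> (Suc k)) - abs_fock (\<psi> k)))\<^sup>2)"
      using abs_fock_diff[OF assms(1) assms(1), of "Suc k" k] unfolding d_def[abs_def]
      by (simp add: fock_norm2_eq)
    also have "\<dots> \<le> ennreal (((1/2) ^ k)\<^sup>2)"
      using assms(2)[of k] by (intro ennreal_leI power_mono) auto
    also have "((1/2::real) ^ k)\<^sup>2 = (1/4) ^ k" by (simp flip: power_mult power_mult_distrib add: power_mult[of _ 2] mult.commute[of k] power2_eq_square)
    finally show ?thesis .
  qed
  have le: "(\<integral>\<^sup>+x. ennreal ((cmod (d k n x))\<^sup>2) \<partial>particles n) \<le> ennreal ((1/4) ^ k)" for k
    using order_trans[OF nn_integral_ge_point[of n UNIV "\<lambda>n. \<integral>\<^sup>+x. ennreal ((cmod (d k n x))\<^sup>2) \<partial>particles n"] Q[of k, unfolded fock_norm2_def]]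
    by simp
  have "(\<integral>\<^sup>+x. (\<Sum>k. ennreal (2 ^ k * (cmod (d k n x))\<^sup>2)) \<partial>particles n)
      = (\<Sum>k. \<integral>\<^sup>+x. ennreal (2 ^ k * (cmod (d k n x))\<^sup>2) \<partial>particles n)"
    by (rule nn_integral_suminf) measurable
  also have "\<dots> \<le> (\<Sum>k. ennreal ((1/2) ^ k))"
  proof (intro suminf_le)
    fix k
    have "(\<integral>\<^sup>+x. ennreal (2 ^ k * (cmod (d k n x))\<^sup>2) \<partial>particles n)
        = ennreal (2 ^ k) * (\<integral>\<^sup>+x. ennreal ((cmod (d k n x))\<^sup>2) \<partial>particles n)"
      unfolding ennreal_mult'' by (subst nn_integral_cmult[symmetric]) (auto simp: ennreal_mult)
    also have "\<dots> \<le> ennreal (2 ^ k) * ennreal ((1/4) ^ k)" by (intro mult_left_mono le) auto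
    also have "\<dots> = ennreal ((1/2) ^ k)"
      by (simp flip: ennreal_mult add: power_mult_distrib[symmetric])
    finally show "(\<integral>\<^sup>+x. ennreal (2 ^ k * (cmod (d k n x))\<^sup>2) \<partial>particles n) \<le> ennreal ((1/2) ^ k)" .
  qed auto
  also have "\<dots> = ennreal (\<Sum>k. (1/2) ^ k)" by (intro suminf_ennreal2) auto
  also have "\<dots> < \<infinity>" by simp
  finally have "AE x in particles n. (\<Sum>k. ennreal (2 ^ k * (cmod (d k n x))\<^sup>2)) \<noteq> \<infinity>"
    by (intro nn_integral_noteq_infinite) auto
  then show ?thesis
  proof eventually_elim
    case (elim x)
    then have "summable (\<lambda>k. 2 ^ k * (cmod (d k n x))\<^sup>2)"
      by (intro summable_suminf_not_top) (auto simp: less_top)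
    then have "summable (\<lambda>k. d k n x)" by (rule summable_if_weighted_square_summable)
    then have "convergent (\<lambda>k. \<psi> 0 n x + (\<Sum>i<k. d i n x))"
      by (intro convergent_add convergent_const) (simp add: summable_iff_convergent)
    then show ?case by (simp add: d_def sum_lessThan_telescope[of "\<lambda>i. \<psi> i n x"])
  qed
qed

text \<open>Fatou's lemma twice, over the configurations of \<open>n\<close> particles and then over
  \<open>n\<close>.\<close>

lemma fock_norm2_limit:
  fixes \<psi> :: "nat \<Rightarrow> nat \<Rightarrow> (nat \<Rightarrow> real) \<Rightarrow> complex"
  assumes "\<And>m n. \<psi> m n \<in> borel_measurable (particles n)"
    and "\<And>n. AE x in particles n. (\<lambda>m. \<psi> m n x) \<longlonglongrightarrow> \<phi> n x"
    and "eventually (\<lambda>m. fock_norm2 (\<psi> m) \<le> c) sequentially"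
  shows "fock_norm2 \<phi> \<le> c"
proof -
  have m[measurable]: "\<psi> m n \<in> borel_measurable (particles n)" for m n by (rule assms(1))
  have "(\<integral>\<^sup>+x. ennreal ((cmod (\<phi> n x))\<^sup>2) \<partial>particles n)
      \<le> liminf (\<lambda>m. \<integral>\<^sup>+x. ennreal ((cmod (\<psi> m n x))\<^sup>2) \<partial>particles n)" for n
  proof -
    have "AE x in particles n. ennreal ((cmod (\<phi> n x))\<^sup>2) = liminf (\<lambda>m. ennreal ((cmod (\<psi> m n x))\<^sup>2))"
      using assms(2)[of n]
    proof eventually_elim
      case (elim x)
      have "(\<lambda>m. ennreal ((cmod (\<psi> m n x))\<^sup>2)) \<longlonglongrightarrow> ennreal ((cmod (\<phi> n x))\<^sup>2)"
        by (intro tendsto_ennrealI tendsto_intros elim)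
      then show ?case using lim_imp_Liminf by (metis sequentially_bot)
    qed
    then have "(\<integral>\<^sup>+x. ennreal ((cmod (\<phi> n x))\<^sup>2) \<partial>particles n)
        = (\<integral>\<^sup>+x. liminf (\<lambda>m. ennreal ((cmod (\<psi> m n x))\<^sup>2)) \<partial>particles n)"
      by (rule nn_integral_cong_AE)
    then show ?thesis using nn_integral_liminf[of "\<lambda>m x. ennreal ((cmod (\<psi> m n x))\<^sup>2)" "particles n"] by simp
  qed
  then have "fock_norm2 \<phi> \<le> (\<integral>\<^sup>+n. liminf (\<lambda>m. \<integral>\<^sup>+x. ennreal ((cmod (\<psi> m n x))\<^sup>2) \<partial>particles n) \<partial>count_space UNIV)"
    unfolding fock_norm2_def by (intro nn_integral_mono)
  also have "\<dots> \<le> liminf (\<lambda>m. fock_norm2 (\<psi> m))"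
    unfolding fock_norm2_def by (rule nn_integral_liminf) simp
  also have "\<dots> \<le> c"
    by (rule order_trans[OF Liminf_le_Limsup Limsup_bounded[OF assms(3)]]) simp
  finally show ?thesis .
qed

instance fock :: chilbert
proof
  fix X :: "nat \<Rightarrow> fock" assume "Cauchy X"
  then show "convergent X"
  proof (rule Cauchy_convergent_if_fast[rotated])
    fix Y :: "nat \<Rightarrow> fock"
    assume fast: "\<And>k. norm (Y (Suc k) - Y k) \<le> (1/2) ^ k" and Y: "Cauchy Y"
    have "\<exists>\<psi>. \<psi> \<in> fock_vectors \<and> y = abs_fock \<psi>" for y :: fock
      by (rule fock.abs_induct[of "\<lambda>y. \<exists>\<psi>. \<psi> \<in> fock_vectors \<and> y = abs_fock \<psi>"])
        (auto simp: fock_rel_def)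
    then have "\<exists>\<psi>. \<forall>k. \<psi> k \<in> fock_vectors \<and> Y k = abs_fock (\<psi> k)" by (intro choice allI)
    then obtain \<psi> where \<psi>: "\<And>k. \<psi> k \<in> fock_vectors" "\<And>k. Y k = abs_fock (\<psi> k)" by blast
    have m[measurable]: "\<psi> k n \<in> borel_measurable (particles n)" for k n
      using \<psi>(1)[of k] by (simp add: fock_vectors_def L2_def)
    \<comment> \<open>Where the sequence diverges, \<open>lim\<close> is some unspecified value;
      this happens on a null set only, and measurability holds regardless.\<close>
    define \<phi> where "\<phi> n x = lim (\<lambda>k. \<psi> k n x)" for n x
    have [measurable]: "\<phi> n \<in> borel_measurable (particles n)" for n
      unfolding \<phi>_def[abs_def] by (rule borel_measurable_lim_metric) measurable
    have lim: "AE x in particles n. (\<lambda>k. \<psi> k n x) \<longlonglongrightarrow> \<phi> n x" for n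
      using AE_convergent_if_fast[of \<psi> n] fast \<psi> by (simp add: \<phi>_def convergent_LIMSEQ_iff)
    \<comment> \<open>Off one null set the sequences at \<open>x\<close> and at
      \<open>x \<circ> \<sigma>\<close> coincide for all \<open>k\<close>, hence so do their values
      of \<open>lim\<close>, convergent or not.\<close>
    have sym: "AE x in particles n. \<phi> n (x \<circ> \<sigma>) = \<phi> n x" if "\<sigma> permutes {..<n}" for n \<sigma>
    proof -
      have "AE x in particles n. \<forall>k. \<psi> k n (x \<circ> \<sigma>) = \<psi> k n x"
        using \<psi>(1) that unfolding AE_all_countable by (auto simp: fock_vectors_def)
      then show ?thesis by eventually_elim (simp add: \<phi>_def)
    qed
    \<comment> \<open>Stated with \<open>fock_norm2\<close> because \<open>\<phi>\<close> is not yet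
      known to be a Fock vector; membership follows from the finite bound on its difference from a
      single \<open>\<psi> N\<close>.\<close>
    have close: "fock_norm2 (\<lambda>n x. \<phi> n x - \<psi> k n x) \<le> ennreal (e\<^sup>2)"
      if N: "\<And>m. m \<ge> N \<Longrightarrow> dist (Y m) (Y k) < e" for N k e
    proof (rule fock_norm2_limit[where \<psi> = "\<lambda>m n x. \<psi> m n x - \<psi> k n x"])
      show "AE x in particles n. (\<lambda>m. \<psi> m n x - \<psi> k n x) \<longlonglongrightarrow> \<phi> n x - \<psi> k n x" for n
        using lim[of n] by eventually_elim (intro tendsto_intros)
      have "fock_norm2 (\<lambda>n x. \<psi> m n x - \<psi> k n x) \<le> ennreal (e\<^sup>2)" if "m \<ge> N" for m
        using N[OF that] abs_fock_diff[OF \<psi>(1) \<psi>(1), of m k]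
        by (auto simp: fock_norm2_eq \<psi>(2) dist_norm intro!: ennreal_leI power_mono)
      then show "eventually (\<lambda>m. fock_norm2 (\<lambda>n x. \<psi> m n x - \<psi> k n x) \<le> ennreal (e\<^sup>2)) sequentially"
        unfolding eventually_sequentially by blast
    qed measurable
    have v: "(\<lambda>n x. \<phi> n x - \<psi> k n x) \<in> fock_vectors" if "fock_norm2 (\<lambda>n x. \<phi> n x - \<psi> k n x) \<le> ennreal e" for k e
    proof (rule fock_vectorsI)
      show "fock_norm2 (\<lambda>n x. \<phi> n x - \<psi> k n x) < \<infinity>"
        using that by (simp add: order_le_less_trans)
    next
      fix n :: nat and \<sigma> :: "nat \<Rightarrow> nat" assume \<sigma>: "\<sigma> permutes {..<n}"
      then have "AE x in particles n. \<psi> k n (x \<circ> \<sigma>) = \<psi> k n x"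
        using \<psi>(1)[of k] by (auto simp: fock_vectors_def)
      then show "AE x in particles n. \<phi> n (x \<circ> \<sigma>) - \<psi> k n (x \<circ> \<sigma>) = \<phi> n x - \<psi> k n x"
        using sym[OF \<sigma>] by eventually_elim simp
    qed measurable
    have \<phi>: "\<phi> \<in> fock_vectors"
    proof -
      obtain N where "\<And>m n. m \<ge> N \<Longrightarrow> n \<ge> N \<Longrightarrow> dist (Y m) (Y n) < 1"
        using metric_CauchyD[OF Y, of 1] by auto
      then have "fock_norm2 (\<lambda>n x. \<phi> n x - \<psi> N n x) \<le> ennreal (1\<^sup>2)" by (intro close[of N]) auto
      then have "(\<lambda>n x. \<phi> n x - \<psi> N n x) \<in> fock_vectors" by (rule v)
      from fock_vectors_add[OF this \<psi>(1)[of N]] show ?thesis by simp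
    qed
    have "Y \<longlonglongrightarrow> abs_fock \<phi>"
    proof (rule metric_LIMSEQ_I)
      fix e :: real assume e: "e > 0"
      obtain N where N: "\<And>m n. m \<ge> N \<Longrightarrow> n \<ge> N \<Longrightarrow> dist (Y m) (Y n) < e / 2"
        using metric_CauchyD[OF Y, of "e / 2"] e by auto
      have "dist (Y k) (abs_fock \<phi>) < e" if k: "k \<ge> N" for k
      proof -
        have "fock_norm2 (\<lambda>n x. \<phi> n x - \<psi> k n x) \<le> ennreal ((e / 2)\<^sup>2)"
          using N k by (intro close) auto
        then have "ennreal ((norm (abs_fock \<phi> - Y k))\<^sup>2) \<le> ennreal ((e / 2)\<^sup>2)"
          using abs_fock_diff[OF \<phi> \<psi>(1), of k] by (simp add: fock_norm2_eq \<psi>(2))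
        then have "(norm (abs_fock \<phi> - Y k))\<^sup>2 \<le> (e / 2)\<^sup>2"
          by (rule ennreal_le_iff[OF zero_le_power2, THEN iffD1])
        then have "norm (abs_fock \<phi> - Y k) \<le> e / 2" by (rule power2_le_imp_le) (use e in simp)
        then show ?thesis using e by (simp add: dist_norm norm_minus_commute)
      qed
      then show "\<exists>N. \<forall>k\<ge>N. dist (Y k) (abs_fock \<phi>) < e" by blast
    qed
    then show "convergent Y" by (rule convergentI)
  qed
qed

section \<open>Completeness of Hilbert-space direct sums\<close>

lemma ell2_norm_square_has_sum: "((\<lambda>i. (norm (ell2_nth x i))\<^sup>2) has_sum (norm x)\<^sup>2) UNIV"
  unfolding ell2_norm_square using ell2_nth[of x] by (intro has_sum_infsum) simp

lemma ell2_sum_norm_le: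
  assumes "finite I" shows "(\<Sum>i\<in>I. (norm (ell2_nth x i))\<^sup>2) \<le> (norm x)\<^sup>2"
  using finite_sum_le_has_sum[OF ell2_norm_square_has_sum assms] by simp

lemma ell2_norm_leI:
  assumes "\<And>I. finite I \<Longrightarrow> (\<Sum>i\<in>I. (norm (ell2_nth x i))\<^sup>2) \<le> c\<^sup>2" "c \<ge> 0"
  shows "norm x \<le> c"
proof (rule power2_le_imp_le)
  show "(norm x)\<^sup>2 \<le> c\<^sup>2"
    unfolding ell2_norm_square using ell2_nth[of x] assms(1) by (intro infsum_le_finite_sums) auto
qed (rule assms(2))

lemma ell2_nth_norm_le: "norm (ell2_nth x i) \<le> norm x"
  by (rule power2_le_imp_le) (use ell2_sum_norm_le[of "{i}" x] in auto)

lemma Abs_ell2_nth: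
  assumes "\<And>I. finite I \<Longrightarrow> (\<Sum>i\<in>I. (norm (y i))\<^sup>2) \<le> c"
  shows "ell2_nth (Abs_ell2 y) = y"
proof (rule Abs_ell2_inverse)
  have "(\<lambda>i. (norm (y i))\<^sup>2) summable_on UNIV"
    using assms by (intro nonneg_bdd_above_summable_on bdd_aboveI[of _ c]) auto
  then show "y \<in> {x. (\<lambda>i. (norm (x i))\<^sup>2) summable_on UNIV}" by simp
qed

text \<open>Coordinates converge because the fibre is complete, and norm bounds survive the limit
  because only finite partial sums are compared.\<close>

instance ell2 :: (type, chilbert) chilbert
proof
  fix X :: "nat \<Rightarrow> ('a, 'b) ell2" assume X: "Cauchy X"
  have "Cauchy (\<lambda>n. ell2_nth (X n) i)" for i
  proof (rule metric_CauchyI)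
    fix e :: real assume "e > 0"
    then obtain N where N: "\<And>m n. m \<ge> N \<Longrightarrow> n \<ge> N \<Longrightarrow> dist (X m) (X n) < e"
      using metric_CauchyD[OF X] by blast
    have "dist (ell2_nth (X m) i) (ell2_nth (X n) i) \<le> dist (X m) (X n)" for m n
      using ell2_nth_norm_le[of "X m - X n" i] by (simp add: dist_norm minus_ell2.rep_eq)
    then show "\<exists>N. \<forall>m\<ge>N. \<forall>n\<ge>N. dist (ell2_nth (X m) i) (ell2_nth (X n) i) < e"
      using N le_less_trans by meson
  qed
  then have "\<exists>l. (\<lambda>n. ell2_nth (X n) i) \<longlonglongrightarrow> l" for i
    using Cauchy_convergent convergent_def by blast
  then obtain y where y: "\<And>i. (\<lambda>n. ell2_nth (X n) i) \<longlonglongrightarrow> y i" by metis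
  have le: "(\<Sum>i\<in>I. (norm (y i - ell2_nth (X n) i))\<^sup>2) \<le> e\<^sup>2"
    if "finite I" "\<And>m. m \<ge> N \<Longrightarrow> dist (X m) (X n) < e" for I N n e
  proof (rule tendsto_upperbound)
    show "(\<lambda>m. \<Sum>i\<in>I. (norm (ell2_nth (X m) i - ell2_nth (X n) i))\<^sup>2)
        \<longlonglongrightarrow> (\<Sum>i\<in>I. (norm (y i - ell2_nth (X n) i))\<^sup>2)"
      by (intro tendsto_intros y)
    have "(\<Sum>i\<in>I. (norm (ell2_nth (X m) i - ell2_nth (X n) i))\<^sup>2) \<le> e\<^sup>2" if "m \<ge> N" for m
    proof -
      have "(\<Sum>i\<in>I. (norm (ell2_nth (X m) i - ell2_nth (X n) i))\<^sup>2) \<le> (norm (X m - X n))\<^sup>2"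
        using ell2_sum_norm_le[OF \<open>finite I\<close>, of "X m - X n"] by (simp add: minus_ell2.rep_eq)
      also have "\<dots> \<le> e\<^sup>2"
        using \<open>\<And>m. m \<ge> N \<Longrightarrow> dist (X m) (X n) < e\<close>[OF that] by (intro power_mono) (auto simp: dist_norm)
      finally show ?thesis .
    qed
    then show "eventually (\<lambda>m. (\<Sum>i\<in>I. (norm (ell2_nth (X m) i - ell2_nth (X n) i))\<^sup>2) \<le> e\<^sup>2) sequentially"
      unfolding eventually_sequentially by blast
  qed simp
  \<comment> \<open>Square summability of \<open>y\<close> is obtained from that of
    \<open>y - X N\<close>, which the bound \<open>le\<close> controls uniformly over finite
    sets.\<close>
  have nth: "ell2_nth (Abs_ell2 y) = y"
  proof -
    obtain N where N: "\<And>m n. m \<ge> N \<Longrightarrow> n \<ge> N \<Longrightarrow> dist (X m) (X n) < 1"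
      using metric_CauchyD[OF X, of 1] by auto
    define z where "z = Abs_ell2 (\<lambda>i. y i - ell2_nth (X N) i)"
    have "ell2_nth z = (\<lambda>i. y i - ell2_nth (X N) i)"
      unfolding z_def using le[of _ N N 1] N by (intro Abs_ell2_nth[of _ 1]) auto
    then have "ell2_nth (z + X N) = y" by (auto simp: plus_ell2.rep_eq)
    then show ?thesis by (metis ell2_nth_inverse)
  qed
  have "X \<longlonglongrightarrow> Abs_ell2 y"
  proof (rule metric_LIMSEQ_I)
    fix e :: real assume e: "e > 0"
    obtain N where N: "\<And>m n. m \<ge> N \<Longrightarrow> n \<ge> N \<Longrightarrow> dist (X m) (X n) < e / 2"
      using metric_CauchyD[OF X, of "e / 2"] e by auto
    have "dist (X n) (Abs_ell2 y) < e" if "n \<ge> N" for n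
    proof -
      have "norm (Abs_ell2 y - X n) \<le> e / 2"
        using le[of _ N n "e / 2"] N that e by (intro ell2_norm_leI) (auto simp: minus_ell2.rep_eq nth)
      then show ?thesis using e by (simp add: dist_norm norm_minus_commute)
    qed
    then show "\<exists>N. \<forall>n\<ge>N. dist (X n) (Abs_ell2 y) < e" by blast
  qed
  then show "convergent X" by (rule convergentI)
qed

instance complex :: chilbert ..

section \<open>Isometries with prescribed values on a total family\<close>

text \<open>Equality of Gram matrices is a sesquilinear identity, so it extends to closed spans in
  one argument at a time.\<close>

lemma closure_span_gram:
  fixes a b :: "'s \<Rightarrow> 'h::complex_inner"
  assumes gram: "\<And>s s'. s \<in> S \<Longrightarrow> s' \<in> S \<Longrightarrow> cinner (b s) (b s') = cinner (a s) (a s')"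
    and G: "G = {(c *\<^sub>C a s, c *\<^sub>C b s) |c s. s \<in> S}"
    and p: "p \<in> closure (span G)" and q: "q \<in> closure (span G)"
  shows "cinner (snd p) (snd q) = cinner (fst p) (fst q)"
proof (rule bounded_linear_eq_on_closure_span[OF _ _ _ q])
  show "bounded_linear (\<lambda>q. cinner (snd p) (snd q))" "bounded_linear (\<lambda>q. cinner (fst p) (fst q))"
    by (intro bounded_linear_intros)+
  fix q assume q: "q \<in> G"
  show "cinner (snd p) (snd q) = cinner (fst p) (fst q)"
  proof (rule bounded_linear_eq_on_closure_span[OF _ _ _ p])
    show "bounded_linear (\<lambda>p. cinner (snd p) (snd q))" "bounded_linear (\<lambda>p. cinner (fst p) (fst q))"
      by (intro bounded_linear_intros)+
  qed (use q in \<open>auto simp: cinner_scaleC_left cinner_scaleC_right gram G\<close>)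
qed

text \<open>Linear relations among the \<open>a s\<close> are inherited by the \<open>b s\<close>,
  since the Gram matrix determines the norm of every combination. The graph of the isometry is
  therefore the closed span of the pairs.\<close>

lemma isometry_from_gram:
  fixes a b :: "'s \<Rightarrow> 'h::chilbert"
  assumes total: "closure (span {c *\<^sub>C a s |c s. s \<in> S}) = UNIV"
    and gram: "\<And>s s'. s \<in> S \<Longrightarrow> s' \<in> S \<Longrightarrow> cinner (b s) (b s') = cinner (a s) (a s')"
  shows "\<exists>T :: 'h \<Rightarrow>\<^sub>L 'h. clinear_op T \<and> (\<forall>x. norm (T x) = norm x) \<and> (\<forall>s\<in>S. T (a s) = b s)"
proof -
  define G where "G = {(c *\<^sub>C a s, c *\<^sub>C b s) |c s. s \<in> S}"
  have norm_eq: "norm y = norm x" if "(x, y) \<in> closure (span G)" for x y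
    using closure_span_gram[OF gram G_def that that]
    by (simp only: fst_conv snd_conv cinner_self of_real_eq_iff) simp
  have "fst ` G = {c *\<^sub>C a s |c s. s \<in> S}" unfolding G_def by force
  then have fG: "fst ` span G = span {c *\<^sub>C a s |c s. s \<in> S}"
    using linear_span_image[OF bounded_linear.linear[OF bounded_linear_fst], of G] by simp
  have ex1: "\<exists>!y. (x, y) \<in> closure (span G)" for x
  proof (rule closed_graph_total[where M = 1])
    show "norm y \<le> 1 * norm x" if "(x, y) \<in> span G" for x y
      using norm_eq[OF subsetD[OF closure_subset that]] by simp
  qed (use total in \<open>simp_all add: fG\<close>)
  define T where "T x = (THE y. (x, y) \<in> closure (span G))" for x
  have T: "(x, T x) \<in> closure (span G)" for x unfolding T_def by (rule theI'[OF ex1])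
  have TI: "T x = y" if "(x, y) \<in> closure (span G)" for x y using ex1 T that by blast
  have sub: "subspace (closure (span G))" by (intro subspace_closure subspace_span)
  have lin: "bounded_linear T"
  proof (rule bounded_linear_intro[where K = 1])
    show "T (x + y) = T x + T y" for x y by (rule TI) (use subspace_add[OF sub T T] in simp)
    show "T (r *\<^sub>R x) = r *\<^sub>R T x" for r x by (rule TI) (use subspace_scale[OF sub T] in simp)
    show "norm (T x) \<le> norm x * 1" for x using norm_eq[OF T] by simp
  qed
  have "T (c *\<^sub>C x) = c *\<^sub>C T x" for c x
  proof (rule TI)
    have "(\<lambda>p. (c *\<^sub>C fst p, c *\<^sub>C snd p)) (x, T x) \<in> closure (span G)"
    proof (rule closure_span_image[OF _ _ T])
      show "bounded_linear (\<lambda>p. (c *\<^sub>C fst p, c *\<^sub>C snd p) :: 'h \<times> 'h)"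
        by (intro bounded_linear_Pair bounded_linear_intros)
      show "(c *\<^sub>C fst p, c *\<^sub>C snd p) \<in> closure (span G)" if "p \<in> G" for p
      proof -
        have "(c *\<^sub>C fst p, c *\<^sub>C snd p) \<in> G"
          using that unfolding G_def by (auto simp: scaleC_scaleC) blast
        then show ?thesis using closure_subset span_base by blast
      qed
    qed
    then show "(c *\<^sub>C x, c *\<^sub>C T x) \<in> closure (span G)" by simp
  qed
  moreover have "T (a s) = b s" if "s \<in> S" for s
  proof (rule TI)
    have "(1 *\<^sub>C a s, 1 *\<^sub>C b s) \<in> span G"
      unfolding G_def by (rule span_base) (use that in blast)
    then show "(a s, b s) \<in> closure (span G)" using closure_subset by auto
  qed
  ultimately show ?thesis
    using norm_eq[OF T] by (intro exI[of _ "Blinfun T"]) (simp add: clinear_op_def bounded_linear_Blinfun_apply[OF lin])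
qed

section \<open>Operators on direct sums\<close>

text \<open>The slice map 1 tensor \<open><e|\<close>. An ampliation of \<open>x\<close> is
  characterized by intertwining all legs with \<open>x\<close>, so it need not be
  constructed.\<close>

lift_definition leg :: "'b::complex_inner \<Rightarrow> ('i, 'b) ell2 \<Rightarrow> ('i, complex) ell2"
  is "\<lambda>e \<psi> i. cinner e (\<psi> i)"
proof -
  fix e and \<psi> :: "'i \<Rightarrow> 'b" assume s: "(\<lambda>i. (norm (\<psi> i))\<^sup>2) summable_on UNIV"
  show "(\<lambda>i. (norm (cinner e (\<psi> i)))\<^sup>2) summable_on UNIV"
  proof (rule summable_on_comparison_test)
    show "(\<lambda>i. (norm e)\<^sup>2 * (norm (\<psi> i))\<^sup>2) summable_on UNIV" by (intro summable_on_cmult_right s)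
    show "(norm (cinner e (\<psi> i)))\<^sup>2 \<le> (norm e)\<^sup>2 * (norm (\<psi> i))\<^sup>2" for i
      unfolding power_mult_distrib[symmetric] by (intro power_mono norm_cinner_le) simp
  qed simp
qed

lemma bounded_linear_leg [bounded_linear]:
  "bounded_linear (leg e :: ('i, 'b::complex_inner) ell2 \<Rightarrow> _)"
proof (rule bounded_linear_intro[where K = "norm e"])
  show "leg e (x + y) = leg e x + leg e y" for x y :: "('i, 'b) ell2" by transfer (simp add: cinner_add_right)
  show "leg e (r *\<^sub>R x) = r *\<^sub>R leg e x" for r and x :: "('i, 'b) ell2" by transfer (simp add: cinner_scaleR_right)
  show "norm (leg e x) \<le> norm x * norm e" for x :: "('i, 'b) ell2"
  proof (rule ell2_norm_leI)
    fix I :: "'i set" assume I: "finite I"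
    have "(\<Sum>i\<in>I. (norm (ell2_nth (leg e x) i))\<^sup>2) \<le> (\<Sum>i\<in>I. (norm e)\<^sup>2 * (norm (ell2_nth x i))\<^sup>2)"
      unfolding leg.rep_eq power_mult_distrib[symmetric]
      by (intro sum_mono power_mono norm_cinner_le) simp
    also have "\<dots> \<le> (norm e)\<^sup>2 * (norm x)\<^sup>2"
      unfolding sum_distrib_left[symmetric] by (intro mult_left_mono ell2_sum_norm_le I) simp
    finally show "(\<Sum>i\<in>I. (norm (ell2_nth (leg e x) i))\<^sup>2) \<le> (norm x * norm e)\<^sup>2"
      by (simp add: power_mult_distrib mult.commute)
  qed simp
qed

text \<open>The hypothesis says that \<open>\<phi>\<close> is the image of \<open>\<psi>\<close> under the ampliation of \<open>x\<close>.  Expanding finitely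
  many components of \<open>\<phi>\<close> in an orthonormal basis of their span reduces the bound to the operator
  norm of \<open>x\<close> on each leg and to Bessel's inequality.\<close>

lemma norm_le_if_legs:
  fixes x :: "('i, complex) ell2 \<Rightarrow>\<^sub>L ('j, complex) ell2"
    and \<psi> :: "('i, 'b::complex_inner) ell2" and \<phi> :: "('j, 'b) ell2"
  assumes leg: "\<And>e. leg e \<phi> = x (leg e \<psi>)"
  shows "norm \<phi> \<le> norm x * norm \<psi>"
proof (rule ell2_norm_leI)
  fix I :: "'j set" assume I: "finite I"
  obtain E where E: "finite E" "\<And>e e'. e \<in> E \<Longrightarrow> e' \<in> E \<Longrightarrow> cinner e e' = (if e = e' then 1 else 0)"
    "\<And>v. v \<in> ell2_nth \<phi> ` I \<Longrightarrow> v = (\<Sum>e\<in>E. cinner e v *\<^sub>C e)"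
    using finite_orthonormal_basis[of "ell2_nth \<phi> ` I"] I by auto
  have "(\<Sum>i\<in>I. (norm (ell2_nth \<phi> i))\<^sup>2) = (\<Sum>i\<in>I. \<Sum>e\<in>E. (cmod (ell2_nth (leg e \<phi>) i))\<^sup>2)"
    unfolding leg.rep_eq using E by (intro sum.cong refl bessel_inequality(2)) auto
  also have "\<dots> = (\<Sum>e\<in>E. \<Sum>i\<in>I. (cmod (ell2_nth (leg e \<phi>) i))\<^sup>2)" by (rule sum.swap)
  also have "\<dots> \<le> (\<Sum>e\<in>E. (norm x * norm (leg e \<psi>))\<^sup>2)"
  proof (rule sum_mono)
    fix e
    have "(\<Sum>i\<in>I. (cmod (ell2_nth (leg e \<phi>) i))\<^sup>2) \<le> (norm (leg e \<phi>))\<^sup>2" by (rule ell2_sum_norm_le[OF I])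
    also have "\<dots> \<le> (norm x * norm (leg e \<psi>))\<^sup>2"
      unfolding leg by (intro power_mono norm_blinfun) simp
    finally show "(\<Sum>i\<in>I. (cmod (ell2_nth (leg e \<phi>) i))\<^sup>2) \<le> (norm x * norm (leg e \<psi>))\<^sup>2" .
  qed
  also have "\<dots> = (norm x)\<^sup>2 * (\<Sum>e\<in>E. (norm (leg e \<psi>))\<^sup>2)"
    by (simp add: power_mult_distrib sum_distrib_left)
  also have "\<dots> \<le> (norm x)\<^sup>2 * (norm \<psi>)\<^sup>2"
  proof (rule mult_left_mono)
    have "((\<lambda>i. \<Sum>e\<in>E. (cmod (ell2_nth (leg e \<psi>) i))\<^sup>2) has_sum (\<Sum>e\<in>E. (norm (leg e \<psi>))\<^sup>2)) UNIV"
      using E(1) by (induction E) (auto intro: has_sum_add ell2_norm_square_has_sum)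
    then show "(\<Sum>e\<in>E. (norm (leg e \<psi>))\<^sup>2) \<le> (norm \<psi>)\<^sup>2"
      by (rule has_sum_mono[OF _ ell2_norm_square_has_sum])
        (use bessel_inequality(1)[OF E(1,2)] in \<open>auto simp: leg.rep_eq\<close>)
  qed simp
  finally show "(\<Sum>i\<in>I. (norm (ell2_nth \<phi> i))\<^sup>2) \<le> (norm x * norm \<psi>)\<^sup>2"
    by (simp add: power_mult_distrib)
qed simp

text \<open>Families that do not consist of isometries are sent to the zero operator.\<close>

lift_definition fibre :: "('i \<Rightarrow> 'b::complex_inner \<Rightarrow>\<^sub>L 'b) \<Rightarrow> ('i, 'b) ell2 \<Rightarrow> ('i, 'b) ell2"
  is "\<lambda>T \<psi> i. if \<forall>i x. norm (T i x) = norm x then T i (\<psi> i) else 0"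
proof -
  fix T :: "'i \<Rightarrow> 'b \<Rightarrow> 'b" and \<psi> :: "'i \<Rightarrow> 'b"
  assume s: "(\<lambda>i. (norm (\<psi> i))\<^sup>2) summable_on UNIV"
  show "(\<lambda>i. (norm (if \<forall>i x. norm (T i x) = norm x then T i (\<psi> i) else 0))\<^sup>2) summable_on UNIV"
  proof (cases "\<forall>i x. norm (T i x) = norm x")
    case True
    then show ?thesis using s by simp
  next
    case False
    show ?thesis unfolding if_not_P[OF False] by simp
  qed
qed

lemma norm_fibre:
  fixes T :: "'i \<Rightarrow> 'b::complex_inner \<Rightarrow>\<^sub>L 'b"
  assumes "\<And>i x. norm (T i x) = norm x" shows "norm (fibre T \<psi>) = norm \<psi>"
proof -
  have "(norm (fibre T \<psi>))\<^sup>2 = (norm \<psi>)\<^sup>2"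
    unfolding ell2_norm_square fibre.rep_eq using assms by simp
  then show ?thesis by (simp add: power2_eq_iff_nonneg)
qed

lemma bounded_linear_fibre: "bounded_linear (fibre T)"
proof (cases "\<forall>i x. norm (T i x) = norm x")
  case True
  note nth = fibre.rep_eq[of T, unfolded if_P[OF True]]
  show ?thesis
  proof (rule bounded_linear_intro[where K = 1])
    show "fibre T (x + y) = fibre T x + fibre T y" for x y
      by (rule ell2_nth_inject[THEN iffD1]) (simp only: nth plus_ell2.rep_eq blinfun.add_right)
    show "fibre T (r *\<^sub>R x) = r *\<^sub>R fibre T x" for r x
      by (rule ell2_nth_inject[THEN iffD1]) (simp only: nth scaleR_ell2.rep_eq blinfun.scaleR_right)
    show "norm (fibre T x) \<le> norm x * 1" for x
      using norm_fibre[of T x] True by simp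
  qed
next
  case False
  have "ell2_nth (fibre T x) = ell2_nth 0" for x
    unfolding fibre.rep_eq if_not_P[OF False] zero_ell2.rep_eq ..
  then have "fibre T = (\<lambda>x. 0)" by (auto simp: ell2_nth_inject)
  then show ?thesis by simp
qed

definition fibre_op :: "('i \<Rightarrow> 'b::complex_inner \<Rightarrow>\<^sub>L 'b) \<Rightarrow> ('i, 'b) ell2 \<Rightarrow>\<^sub>L ('i, 'b) ell2" where
  "fibre_op T = Blinfun (fibre T)"

lemma fibre_op_apply: "fibre_op T \<psi> = fibre T \<psi>"
  by (simp add: fibre_op_def bounded_linear_Blinfun_apply bounded_linear_fibre)

lemma fibre_op_nth:
  fixes T :: "'i \<Rightarrow> 'b::complex_inner \<Rightarrow>\<^sub>L 'b"
  assumes "\<And>i x. norm (T i x) = norm x" shows "ell2_nth (fibre_op T \<psi>) i = T i (ell2_nth \<psi> i)"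
  using assms by (simp add: fibre_op_apply fibre.rep_eq)

section \<open>Twisting the regular representation of the Heisenberg group\<close>

text \<open>Multiplication of monomials read off on indices: \<open>V U\<close> equals
  \<open>U V\<close> times the inverse of \<open>Z\<close>, so moving \<open>n\<close> factors
  \<open>V\<close> past \<open>m'\<close> factors \<open>U\<close> contributes
  \<open>- m' * n\<close> to the exponent of \<open>Z\<close>.\<close>

fun heis_mult :: "int \<times> int \<times> int \<Rightarrow> int \<times> int \<times> int \<Rightarrow> int \<times> int \<times> int" where
  "heis_mult (m, n, p) (m', n', p') = (m + m', n + n', p + p' - m' * n)"

fun heis_inv :: "int \<times> int \<times> int \<Rightarrow> int \<times> int \<times> int" where
  "heis_inv (m, n, p) = (- m, - n, - p - m * n)"

text \<open>The group element that shifts the origin to a given point.\<close>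

fun heis_of_point :: "int \<times> int \<times> int \<Rightarrow> int \<times> int \<times> int" where
  "heis_of_point (a, b, c) = (a, b, c - a * b)"

text \<open>The index maps form a right action on points. Precomposition reverses the order once
  more, so the operators \<open>reindex_op (shift k)\<close> multiply like the group
  elements.\<close>

lemma shift_heis_mult: "shift l (shift k i) = shift (heis_mult k l) i"
  by (cases k; cases l) (simp add: shift_shift)

text \<open>With points identified with group elements, \<open>shift k\<close> is right translation
  by \<open>k\<close>, so \<open>reindex_op (shift k)\<close> is the right regular representation.
  This equivariance drives the absorption.\<close>

lemma heis_of_point_shift: "heis_of_point (shift k i) = heis_mult (heis_of_point i) k"
  by (cases k; cases i) (simp add: shift_def algebra_simps)

lemma heis_mult_inv: "heis_mult k (heis_inv k) = (0, 0, 0)" "heis_mult (heis_inv k) k = (0, 0, 0)"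
  by (cases k, simp add: algebra_simps)+

lemma reindex_op_mult:
  "reindex_op (shift k) o\<^sub>L reindex_op (shift l)
    = (reindex_op (shift (heis_mult k l)) :: (_, 'a::complex_inner) ell2 \<Rightarrow>\<^sub>L _)"
  by (rule blinfun_eqI, rule ell2_nth_inject[THEN iffD1])
    (auto simp: fun_eq_iff reindex_op_nth bij_shift shift_heis_mult)

lemma cinner_reindex_op_heis_inv:
  "cinner (reindex_op (shift (heis_inv k)) x) y = cinner x (reindex_op (shift k) y)" for x y :: h_space
  by (cases k) (simp add: cinner_reindex_op_shift)

lemma norm_le_if_adjoint:
  fixes x :: "'a::complex_inner \<Rightarrow>\<^sub>L 'b::complex_inner" and x' :: "'b \<Rightarrow>\<^sub>L 'a"
  assumes "\<And>u v. cinner (x' u) v = cinner u (x v)"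
  shows "norm x' \<le> norm x"
proof (rule norm_blinfun_bound)
  fix u
  have "(norm (x' u))\<^sup>2 = cmod (cinner (x' u) (x' u))" by (simp add: cinner_self norm_power)
  also have "\<dots> = cmod (cinner u (x (x' u)))" by (simp add: assms)
  also have "\<dots> \<le> norm u * norm (x (x' u))" by (rule norm_cinner_le)
  also have "\<dots> \<le> norm u * (norm x * norm (x' u))" by (intro mult_left_mono norm_blinfun) simp
  finally have "norm (x' u) * norm (x' u) \<le> (norm x * norm u) * norm (x' u)"
    by (simp add: power2_eq_square mult_ac)
  then show "norm (x' u) \<le> norm x * norm u"
    by (cases "norm (x' u) = 0") (auto simp: mult_le_cancel_right)
qed simp

locale heis_unitary_rep =
  fixes \<pi> :: "int \<times> int \<times> int \<Rightarrow> 'b::chilbert \<Rightarrow>\<^sub>L 'b"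
  assumes clinear: "clinear_op (\<pi> k)"
    and isometry: "norm (\<pi> k x) = norm x"
    and mult: "\<pi> k (\<pi> l x) = \<pi> (heis_mult k l) x"
    and one: "\<pi> (0, 0, 0) x = x"
begin

lemma cinner_adjoint: "cinner (\<pi> (heis_inv k) x) y = cinner x (\<pi> k y)"
proof -
  have "cinner (\<pi> (heis_inv k) x) y = cinner (\<pi> k (\<pi> (heis_inv k) x)) (\<pi> k y)"
    by (simp only: isometry_cinner[OF clinear isometry])
  then show ?thesis by (simp add: mult heis_mult_inv one)
qed

text \<open>The tensor product of the regular representation with \<open>\<pi>\<close>, realized on
  square-summable families of vectors of the representation space.\<close>

definition twist :: "int \<times> int \<times> int \<Rightarrow> (int \<times> int \<times> int, 'b) ell2 \<Rightarrow>\<^sub>L (int \<times> int \<times> int, 'b) ell2" where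
  "twist k = fibre_op (\<lambda>_. \<pi> k) o\<^sub>L reindex_op (shift k)"

lemma twist_nth: "ell2_nth (twist k \<psi>) i = \<pi> k (ell2_nth \<psi> (shift k i))"
  by (simp add: twist_def fibre_op_nth isometry reindex_op_nth bij_shift)

lemma twist_mult: "twist k o\<^sub>L twist l = twist (heis_mult k l)"
  by (rule blinfun_eqI, rule ell2_nth_inject[THEN iffD1])
    (auto simp: fun_eq_iff twist_nth mult shift_heis_mult)

lemma twist_one: "twist (0, 0, 0) = id_blinfun"
  by (rule blinfun_eqI, rule ell2_nth_inject[THEN iffD1])
    (auto simp: fun_eq_iff twist_nth one shift_zero)

lemma twist_cscale: "twist k o\<^sub>L cscale c = cscale c o\<^sub>L twist k"
  using clinear[of k]
  by (intro blinfun_eqI ell2_nth_inject[THEN iffD1])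
    (auto simp: fun_eq_iff twist_nth cscale.rep_eq scaleC_ell2.rep_eq clinear_op_def)

lemma cinner_twist: "cinner (twist (heis_inv k) \<psi>) \<phi> = cinner \<psi> (twist k \<phi>)"
proof -
  have "cinner (twist (heis_inv k) \<psi>) \<phi>
      = (\<Sum>\<^sub>\<infinity>i. cinner (ell2_nth \<psi> (shift (heis_inv k) i)) (\<pi> k (ell2_nth \<phi> i)))"
    by (simp add: cinner_ell2_def twist_nth cinner_adjoint)
  also have "\<dots> = (\<Sum>\<^sub>\<infinity>i. cinner (ell2_nth \<psi> (shift (heis_inv k) (shift k i))) (\<pi> k (ell2_nth \<phi> (shift k i))))"
    by (rule infsum_reindex_bij_betw[OF bij_shift, symmetric])
  also have "\<dots> = cinner \<psi> (twist k \<phi>)"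
    by (simp add: cinner_ell2_def twist_nth shift_heis_mult heis_mult_inv shift_zero)
  finally show ?thesis .
qed

lemma twist_tensor: "twist k (v \<otimes>\<^sub>h \<xi>) = (reindex_op (shift k) v) \<otimes>\<^sub>h (\<pi> k \<xi>)"
  using clinear[of k]
  by (intro ell2_nth_inject[THEN iffD1])
    (auto simp: fun_eq_iff twist_nth tensor.rep_eq reindex_op_nth bij_shift clinear_op_def)

section \<open>Extension to the norm closure as a closed graph\<close>

definition gens :: "((h_space \<Rightarrow>\<^sub>L h_space) \<times> ((int \<times> int \<times> int, 'b) ell2 \<Rightarrow>\<^sub>L (int \<times> int \<times> int, 'b) ell2)) set" where
  "gens = {(cscale c o\<^sub>L reindex_op (shift k), cscale c o\<^sub>L twist k) |c k. True}"

text \<open>Closing in the product of the two operator norms gives the homomorphism on the span and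
  its continuous extension at once. The real span suffices because \<open>gens\<close> is stable
  under complex multiples.\<close>

definition graph :: "((h_space \<Rightarrow>\<^sub>L h_space) \<times> ((int \<times> int \<times> int, 'b) ell2 \<Rightarrow>\<^sub>L (int \<times> int \<times> int, 'b) ell2)) set" where
  "graph = closure (span gens)"

lemma gensI: "(cscale c o\<^sub>L reindex_op (shift k), cscale c o\<^sub>L twist k) \<in> gens"
  unfolding gens_def by blast

lemma graph_generator: "p \<in> gens \<Longrightarrow> p \<in> graph"
  unfolding graph_def using closure_subset span_base by blast

lemma subspace_graph: "subspace graph"
  unfolding graph_def by (intro subspace_closure subspace_span)

text \<open>Fell absorption: the unitary that acts on the fibre over \<open>i\<close> as \<open>\<pi> (heis_of_point i)\<close> turns the
  twisted representation into the ampliation of the regular one.\<close>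

lemma graph_leg:
  assumes "(x, y) \<in> graph"
  shows "leg e (fibre_op (\<pi> \<circ> heis_of_point) (y \<psi>)) = x (leg e (fibre_op (\<pi> \<circ> heis_of_point) \<psi>))"
proof -
  let ?W = "fibre_op (\<pi> \<circ> heis_of_point)"
  have W: "ell2_nth (?W \<psi>) i = \<pi> (heis_of_point i) (ell2_nth \<psi> i)" for \<psi> i
    by (simp add: fibre_op_nth isometry)
  have "leg e (?W (snd p \<psi>)) = fst p (leg e (?W \<psi>))" if "p \<in> closure (span gens)" for p
  proof (rule bounded_linear_eq_on_closure_span[OF _ _ _ that])
    show "bounded_linear (\<lambda>p. leg e (?W (blinfun_apply (snd p) \<psi>)))"
      "bounded_linear (\<lambda>p. blinfun_apply (fst p) (leg e (?W \<psi>)))"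
      by (intro bounded_linear_intros)+
    fix p assume "p \<in> gens"
    then obtain c k where p: "p = (cscale c o\<^sub>L reindex_op (shift k), cscale c o\<^sub>L twist k)"
      unfolding gens_def by blast
    \<comment> \<open>The unitary over \<open>i\<close> followed after \<open>\<pi> k\<close> is the
      unitary over \<open>shift k i\<close>: the twist is absorbed and only the translation of the
      index remains.\<close>
    have "cinner e (\<pi> (heis_of_point i) (c *\<^sub>C \<pi> k (ell2_nth \<psi> (shift k i))))
        = c * cinner e (\<pi> (heis_of_point (shift k i)) (ell2_nth \<psi> (shift k i)))" for i
      using clinear[of "heis_of_point i"]
      by (simp add: clinear_op_def cinner_scaleC_right mult heis_of_point_shift)
    then show "leg e (?W (blinfun_apply (snd p) \<psi>)) = blinfun_apply (fst p) (leg e (?W \<psi>))"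
      by (intro ell2_nth_inject[THEN iffD1] ext)
        (simp add: p leg.rep_eq W cscale.rep_eq scaleC_ell2.rep_eq twist_nth reindex_op_nth bij_shift
          scaleC_complex_def)
  qed
  from this[of "(x, y)"] assms show ?thesis by (simp add: graph_def)
qed

text \<open>The absorbing operator preserves norms, so the bound for ampliations carries over to
  \<open>y\<close> unchanged.\<close>

lemma graph_norm_le:
  assumes "(x, y) \<in> graph" shows "norm y \<le> norm x"
proof (rule norm_blinfun_bound)
  fix \<psi>
  have W: "norm (fibre_op (\<pi> \<circ> heis_of_point) \<psi>) = norm \<psi>" for \<psi>
    by (simp add: fibre_op_apply norm_fibre isometry)
  show "norm (y \<psi>) \<le> norm x * norm \<psi>"
    using norm_le_if_legs[of "fibre_op (\<pi> \<circ> heis_of_point) (y \<psi>)" x "fibre_op (\<pi> \<circ> heis_of_point) \<psi>"]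
      graph_leg[OF assms] by (simp add: W)
qed simp

lemma fst_span_gens: "fst ` span gens = rot_alg0"
proof -
  have "fst ` gens = scaled_monomials"
    unfolding gens_def scaled_monomials_def monomial_shift by force
  then show ?thesis
    unfolding rot_alg0_span
    using linear_span_image[OF bounded_linear.linear[OF bounded_linear_fst], of gens] by simp
qed

lemma graph_ex1: "x \<in> rot_alg \<Longrightarrow> \<exists>!y. (x, y) \<in> graph"
  unfolding graph_def
proof (rule closed_graph_total[where M = 1])
  fix x y assume "(x, y) \<in> span gens"
  then have "(x, y) \<in> graph" unfolding graph_def using closure_subset by blast
  then show "norm y \<le> 1 * norm x" using graph_norm_le by simp
qed (auto simp: fst_span_gens rot_alg_def)

lemma graph_fst: "(x, y) \<in> graph \<Longrightarrow> x \<in> rot_alg"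
  using closure_bounded_linear_image_subset[OF bounded_linear_fst, of "span gens"]
  unfolding graph_def rot_alg_def fst_span_gens[symmetric] by force

definition lift_hom where "lift_hom x = (THE y. (x, y) \<in> graph)"

lemma graph_lift_hom: "x \<in> rot_alg \<Longrightarrow> (x, lift_hom x) \<in> graph"
  unfolding lift_hom_def by (rule theI'[OF graph_ex1])

lemma lift_hom_eqI: "(x, y) \<in> graph \<Longrightarrow> lift_hom x = y"
  using graph_ex1[OF graph_fst] graph_lift_hom[OF graph_fst] by blast

lemma lift_hom_monomial: "lift_hom (monomial m n p) = twist (m, n, p)"
  using graph_generator[OF gensI[of 1 "(m, n, p)"]]
  by (intro lift_hom_eqI) (simp add: monomial_shift cscale_one)

text \<open>Composition is linear and continuous in each factor, so closure under products passes
  from generators to the graph one factor at a time.\<close>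

lemma graph_mult:
  assumes "(x, y) \<in> graph" "(x', y') \<in> graph"
  shows "(x o\<^sub>L x', y o\<^sub>L y') \<in> graph"
proof -
  have gg: "(fst p o\<^sub>L fst q, snd p o\<^sub>L snd q) \<in> graph" if pq: "p \<in> gens" "q \<in> gens" for p q
  proof -
    obtain c k d l where p: "p = (cscale c o\<^sub>L reindex_op (shift k), cscale c o\<^sub>L twist k)"
      and q: "q = (cscale d o\<^sub>L reindex_op (shift l), cscale d o\<^sub>L twist l)"
      using pq unfolding gens_def by blast
    have "fst p o\<^sub>L fst q = cscale c o\<^sub>L ((reindex_op (shift k) o\<^sub>L cscale d) o\<^sub>L reindex_op (shift l))"
      by (simp add: p q compose_assoc)
    also have "\<dots> = cscale (c * d) o\<^sub>L reindex_op (shift (heis_mult k l))"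
      unfolding cscale_reindex_op compose_assoc cscale_cscale reindex_op_mult ..
    finally have 1: "fst p o\<^sub>L fst q = cscale (c * d) o\<^sub>L reindex_op (shift (heis_mult k l))" .
    have "snd p o\<^sub>L snd q = cscale c o\<^sub>L ((twist k o\<^sub>L cscale d) o\<^sub>L twist l)"
      by (simp add: p q compose_assoc)
    also have "\<dots> = cscale (c * d) o\<^sub>L twist (heis_mult k l)"
      unfolding twist_cscale compose_assoc cscale_cscale twist_mult ..
    finally show ?thesis unfolding 1 using graph_generator[OF gensI] by simp
  qed
  have gp: "(fst p o\<^sub>L fst q, snd p o\<^sub>L snd q) \<in> closure (span gens)"
    if "p \<in> closure (span gens)" "q \<in> gens" for p q
  proof (rule closure_span_image[OF _ _ that(1)])
    show "bounded_linear (\<lambda>p. (fst p o\<^sub>L fst q, snd p o\<^sub>L snd q))"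
      by (intro bounded_linear_Pair bounded_linear_intros)
    show "(fst p' o\<^sub>L fst q, snd p' o\<^sub>L snd q) \<in> closure (span gens)" if "p' \<in> gens" for p'
      using gg[OF that \<open>q \<in> gens\<close>] by (simp add: graph_def)
  qed
  have "(fst p o\<^sub>L fst q, snd p o\<^sub>L snd q) \<in> closure (span gens)"
    if p: "p \<in> closure (span gens)" and q: "q \<in> closure (span gens)" for p q
  proof (rule closure_span_image[OF _ _ q])
    show "bounded_linear (\<lambda>q. (fst p o\<^sub>L fst q, snd p o\<^sub>L snd q))"
      by (intro bounded_linear_Pair bounded_linear_intros)
  qed (rule gp[OF p])
  from this[of "(x, y)" "(x', y')"] assms show ?thesis by (simp add: graph_def)
qed

lemma graph_clinear:
  assumes "(x, y) \<in> graph" shows "clinear_op y"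
proof -
  have "blinfun_apply (snd p) (c *\<^sub>C u) = c *\<^sub>C blinfun_apply (snd p) u" if "p \<in> closure (span gens)" for p c u
  proof (rule bounded_linear_eq_on_closure_span[OF _ _ _ that])
    fix p assume "p \<in> gens"
    then obtain d k where p: "snd p = cscale d o\<^sub>L twist k" unfolding gens_def by auto
    have "twist k (c *\<^sub>C u) = c *\<^sub>C twist k u"
      using blinfun_apply_blinfun_compose[of "twist k" "cscale c" u] unfolding twist_cscale
      by (simp add: cscale.rep_eq)
    then show "blinfun_apply (snd p) (c *\<^sub>C u) = c *\<^sub>C blinfun_apply (snd p) u"
      by (simp add: p cscale.rep_eq scaleC_scaleC mult.commute)
  qed (intro bounded_linear_intros)+
  from this[of "(x, y)"] assms show ?thesis by (simp add: graph_def clinear_op_def)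
qed

text \<open>\<open>adj\<close> is a definite description whose value is known once an adjoint is
  exhibited. Each generator therefore carries its adjoint pair along in \<open>H\<close>, and both
  the existence of the adjoints and their membership in the graph survive the closure.\<close>

lemma graph_adjoint:
  assumes "(x, y) \<in> graph"
  shows "(adj x, adj y) \<in> graph"
proof -
  define H where "H = {((cscale c o\<^sub>L reindex_op (shift k) :: h_space \<Rightarrow>\<^sub>L h_space, cscale c o\<^sub>L twist k),
    (cscale (cnj c) o\<^sub>L reindex_op (shift (heis_inv k)) :: h_space \<Rightarrow>\<^sub>L h_space, cscale (cnj c) o\<^sub>L twist (heis_inv k))) |c k. True}"
  have fstH: "fst ` span H = span gens"
  proof -
    have "fst ` H = gens" unfolding H_def gens_def by force
    then show ?thesis
      using linear_span_image[OF bounded_linear.linear[OF bounded_linear_fst], of H] by simp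
  qed
  have a1: "cinner (fst (snd p) u) v = cinner u (fst (fst p) v)" if "p \<in> closure (span H)" for p u v
  proof (rule bounded_linear_eq_on_closure_span[OF _ _ _ that])
    show "bounded_linear (\<lambda>p. cinner (blinfun_apply (fst (snd p)) u) v)"
      "bounded_linear (\<lambda>p. cinner u (blinfun_apply (fst (fst p)) v))"
      by (intro bounded_linear_intros)+
    show "cinner (fst (snd p) u) v = cinner u (fst (fst p) v)" if pH: "p \<in> H" for p
    proof -
      obtain c k where "p = ((cscale c o\<^sub>L reindex_op (shift k), cscale c o\<^sub>L twist k),
          (cscale (cnj c) o\<^sub>L reindex_op (shift (heis_inv k)), cscale (cnj c) o\<^sub>L twist (heis_inv k)))"
        using pH unfolding H_def by blast
      then show ?thesis
        by (simp add: cscale.rep_eq cinner_scaleC_left cinner_scaleC_right cinner_reindex_op_heis_inv)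
    qed
  qed
  have a2: "cinner (snd (snd p) u) v = cinner u (snd (fst p) v)" if "p \<in> closure (span H)" for p u v
  proof (rule bounded_linear_eq_on_closure_span[OF _ _ _ that])
    show "bounded_linear (\<lambda>p. cinner (blinfun_apply (snd (snd p)) u) v)"
      "bounded_linear (\<lambda>p. cinner u (blinfun_apply (snd (fst p)) v))"
      by (intro bounded_linear_intros)+
    show "cinner (snd (snd p) u) v = cinner u (snd (fst p) v)" if pH: "p \<in> H" for p
    proof -
      obtain c k where "p = ((cscale c o\<^sub>L reindex_op (shift k), cscale c o\<^sub>L twist k),
          (cscale (cnj c) o\<^sub>L reindex_op (shift (heis_inv k)), cscale (cnj c) o\<^sub>L twist (heis_inv k)))"
        using pH unfolding H_def by blast
      then show ?thesis
        by (simp add: cscale.rep_eq cinner_scaleC_left cinner_scaleC_right cinner_twist)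
    qed
  qed
  \<comment> \<open>The pair of adjoints is a function of the pair of operators, contractive by
    \<open>norm_le_if_adjoint\<close>, so it extends to limits.\<close>
  have "\<exists>!q. ((x, y), q) \<in> closure (span H)"
  proof (rule closed_graph_total[where M = 1])
    fix p q assume "(p, q) \<in> span H"
    then have pq: "(p, q) \<in> closure (span H)" using closure_subset by blast
    have "norm (fst q) \<le> norm (fst p)" using a1[OF pq] by (intro norm_le_if_adjoint) simp
    moreover have "norm (snd q) \<le> norm (snd p)" using a2[OF pq] by (intro norm_le_if_adjoint) simp
    ultimately show "norm q \<le> 1 * norm p"
      unfolding norm_prod_def by (auto intro!: real_sqrt_le_mono add_mono power_mono)
  qed (use assms in \<open>auto simp: fstH graph_def\<close>)
  then obtain x' y' where q: "((x, y), (x', y')) \<in> closure (span H)" by auto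
  have "snd ((x, y), (x', y')) \<in> closure (span gens)"
  proof (rule closure_span_image[OF bounded_linear_snd _ q])
    fix p assume "p \<in> H"
    then obtain c k where "snd p = (cscale (cnj c) o\<^sub>L reindex_op (shift (heis_inv k)),
        cscale (cnj c) o\<^sub>L twist (heis_inv k))"
      unfolding H_def by auto
    then have "snd p \<in> gens" using gensI by (simp only:)
    then show "snd p \<in> closure (span gens)" by (rule graph_generator[unfolded graph_def])
  qed
  moreover have "adj x = x'" using a1[OF q] by (intro adj_eqI) simp
  moreover have "adj y = y'" using a2[OF q] by (intro adj_eqI) simp
  ultimately show ?thesis by (simp add: graph_def)
qed

lemma graph_one: "(id_blinfun, id_blinfun) \<in> graph"
  using graph_generator[OF gensI[of 1 "(0, 0, 0)"]] by (simp add: cscale_one twist_one reindex_op_shift_zero)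

lemma graph_cscale:
  assumes "(x, y) \<in> graph" shows "(cscale c o\<^sub>L x, cscale c o\<^sub>L y) \<in> graph"
proof -
  have "(cscale c o\<^sub>L id_blinfun, cscale c o\<^sub>L id_blinfun) \<in> graph"
    using graph_generator[OF gensI[of c "(0, 0, 0)"]] by (simp add: twist_one reindex_op_shift_zero)
  moreover have "(cscale c o\<^sub>L id_blinfun) o\<^sub>L T = cscale c o\<^sub>L T" for c and T :: "'c::complex_inner \<Rightarrow>\<^sub>L 'c"
    by (rule blinfun_eqI) simp
  ultimately show ?thesis using graph_mult[OF _ assms] by metis
qed

theorem unital_star_hom_lift_hom: "unital_star_hom rot_alg lift_hom"
  unfolding unital_star_hom_def
proof (intro conjI ballI allI)
  fix a b c assume a: "a \<in> rot_alg" and b: "b \<in> rot_alg"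
  note g = graph_lift_hom[OF a] graph_lift_hom[OF b]
  show "clinear_op (lift_hom a)" by (rule graph_clinear[OF g(1)])
  show "lift_hom (a + b) = lift_hom a + lift_hom b"
    using subspace_add[OF subspace_graph g] by (intro lift_hom_eqI) simp
  show "lift_hom (cscale c o\<^sub>L a) = cscale c o\<^sub>L lift_hom a"
    by (intro lift_hom_eqI graph_cscale g)
  show "lift_hom (a o\<^sub>L b) = lift_hom a o\<^sub>L lift_hom b" by (intro lift_hom_eqI graph_mult g)
  show "lift_hom (adj a) = adj (lift_hom a)" by (intro lift_hom_eqI graph_adjoint g)
qed (auto intro: lift_hom_eqI graph_one)

text \<open>Transfers identities between matrix elements, such as adaptedness at fixed vectors, from
  the generators to the whole algebra.\<close>

lemma lift_hom_eqI_linear: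
  assumes "bounded_linear f" "bounded_linear g" "\<And>c k. f (cscale c o\<^sub>L twist k) = g (cscale c o\<^sub>L twist k)"
    "x \<in> rot_alg"
  shows "f (lift_hom x) = g (lift_hom x)"
proof -
  have "f (snd (x, lift_hom x)) = g (snd (x, lift_hom x))"
  proof (rule bounded_linear_eq_on_closure_span[where B = gens])
    show "(x, lift_hom x) \<in> closure (span gens)" using graph_lift_hom[OF assms(4)] by (simp add: graph_def)
  qed (use assms in \<open>auto simp: gens_def intro: bounded_linear_intros Real_Vector_Spaces.bounded_linear_compose[OF _ bounded_linear_snd]\<close>)
  then show ?thesis by simp
qed

end

section \<open>The exponential of an indefinite integral\<close>

text \<open>With \<open>L\<close> as a new time parameter, increments of \<open>D\<close> are
  quadratic in the increment of the parameter, so the derivative vanishes. Only continuity and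
  monotonicity of \<open>L\<close> are used, and differentiability in the original time plays no
  part.\<close>

lemma constant_if_quadratically_close:
  fixes D :: "real \<Rightarrow> 'a::real_normed_vector" and L :: "real \<Rightarrow> real"
  assumes L: "continuous_on {a..b} L"
    and D: "\<And>s t. a \<le> s \<Longrightarrow> s \<le> t \<Longrightarrow> t \<le> b \<Longrightarrow> norm (D t - D s) \<le> C * (L t - L s)\<^sup>2"
    and mono: "\<And>s t. a \<le> s \<Longrightarrow> s \<le> t \<Longrightarrow> t \<le> b \<Longrightarrow> L s \<le> L t"
    and ab: "a \<le> b"
  shows "D b = D a"
proof -
  have D': "norm (D t - D s) \<le> C * (L t - L s)\<^sup>2" if "s \<in> {a..b}" "t \<in> {a..b}" for s t
  proof (cases "s \<le> t")
    case False
    then show ?thesis using D[of t s] that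
      by (simp add: norm_minus_commute[of "D t"] power2_commute[of "L t"])
  qed (use D that in auto)
  \<comment> \<open>The intermediate value theorem yields a right inverse \<open>\<sigma>\<close> of
    \<open>L\<close>; it may jump where \<open>L\<close> is flat, but \<open>D\<close> does not see
    this.\<close>
  have "\<exists>s. s \<in> {a..b} \<and> L s = y" if "y \<in> {L a..L b}" for y
    using IVT'[of L a y b] that ab L by auto
  then obtain \<sigma> where \<sigma>: "\<And>y. y \<in> {L a..L b} \<Longrightarrow> \<sigma> y \<in> {a..b}" "\<And>y. y \<in> {L a..L b} \<Longrightarrow> L (\<sigma> y) = y"
    by metis
  have LL: "L a \<in> {L a..L b}" "L b \<in> {L a..L b}" using mono[OF order_refl ab order_refl] by auto
  have "((\<lambda>y. D (\<sigma> y)) has_derivative (\<lambda>x. 0)) (at y within {L a..L b})" if y: "y \<in> {L a..L b}" for y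
    unfolding has_derivative_within_alt
  proof (intro conjI allI impI)
    fix e :: real assume e: "e > 0"
    show "\<exists>d>0. \<forall>x\<in>{L a..L b}. norm (x - y) < d \<longrightarrow> norm (D (\<sigma> x) - D (\<sigma> y) - 0) \<le> e * norm (x - y)"
    proof (intro exI[of _ "e / (\<bar>C\<bar> + 1)"] conjI ballI impI)
      show "0 < e / (\<bar>C\<bar> + 1)" using e by simp
      fix x assume x: "x \<in> {L a..L b}" and "norm (x - y) < e / (\<bar>C\<bar> + 1)"
      then have le: "(\<bar>C\<bar> + 1) * \<bar>x - y\<bar> \<le> e" by (simp add: field_simps)
      have "norm (D (\<sigma> x) - D (\<sigma> y)) \<le> C * (x - y)\<^sup>2" using D'[of "\<sigma> y" "\<sigma> x"] \<sigma> x y by simp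
      also have "\<dots> \<le> (\<bar>C\<bar> + 1) * (x - y)\<^sup>2" by (intro mult_right_mono) auto
      also have "\<dots> = ((\<bar>C\<bar> + 1) * \<bar>x - y\<bar>) * \<bar>x - y\<bar>" by (simp add: power2_eq_square)
      also have "\<dots> \<le> e * \<bar>x - y\<bar>" by (intro mult_right_mono le) simp
      finally show "norm (D (\<sigma> x) - D (\<sigma> y) - 0) \<le> e * norm (x - y)" by simp
    qed
  qed simp
  then obtain c where c: "\<And>y. y \<in> {L a..L b} \<Longrightarrow> D (\<sigma> y) = c"
    using has_derivative_zero_constant[of "{L a..L b}" "\<lambda>y. D (\<sigma> y)"] by auto
  \<comment> \<open>The points \<open>s\<close> and \<open>\<sigma> (L s)\<close> lie on one level
    set of \<open>L\<close>, where the quadratic bound is zero.\<close>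
  have "D s = c" if "s \<in> {a..b}" "L s \<in> {L a..L b}" for s
    using D'[OF \<sigma>(1)[OF that(2)] that(1)] \<sigma>(2)[OF that(2)] c[OF that(2)] by simp
  then show ?thesis using LL ab by auto
qed

text \<open>The mean value inequality on a ball. The radius \<open>r\<close> measures the increment
  and gives the order of smallness, while \<open>M\<close> is a uniform bound that stays in the
  exponential.\<close>

lemma cmod_exp_minus_one_le:
  fixes w :: complex
  assumes "cmod w \<le> r" "r \<le> M"
  shows "cmod (exp w - 1) \<le> r * exp M"
proof -
  have "cmod (exp w - exp 0) \<le> exp M * cmod (w - 0)"
  proof (rule field_differentiable_bound[of "cball 0 r" _ exp])
    show "(exp has_field_derivative exp z) (at z within cball 0 r)" for z :: complex
      by (rule DERIV_subset[OF DERIV_exp]) simp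
    show "cmod (exp z) \<le> exp M" if "z \<in> cball 0 r" for z
      using that assms norm_exp[of z] by (auto intro: order_trans)
  qed (use assms in \<open>auto intro: order_trans[OF norm_ge_zero]\<close>)
  also have "\<dots> \<le> exp M * r" using assms(1) by simp
  finally show ?thesis by (simp add: mult.commute)
qed

text \<open>The mean value inequality again, now for \<open>exp z - z\<close>, whose derivative is
  already of size \<open>r\<close> by the first-order bound.\<close>

lemma cmod_exp_minus_linear_le:
  fixes w :: complex
  assumes "cmod w \<le> r" "r \<le> M"
  shows "cmod (exp w - 1 - w) \<le> r\<^sup>2 * exp M"
proof -
  have "cmod ((exp w - w) - (exp 0 - 0)) \<le> (r * exp M) * cmod (w - 0)"
  proof (rule field_differentiable_bound[of "cball 0 r" "\<lambda>z. exp z - z" "\<lambda>z. exp z - 1"])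
    show "((\<lambda>z. exp z - z) has_field_derivative exp z - 1) (at z within cball 0 r)" for z :: complex
      by (auto intro!: derivative_eq_intros)
    show "cmod (exp z - 1) \<le> r * exp M" if "z \<in> cball 0 r" for z
      using that assms by (intro cmod_exp_minus_one_le) auto
  qed (use assms in \<open>auto intro: order_trans[OF norm_ge_zero]\<close>)
  also have "\<dots> \<le> (r * exp M) * r"
    using assms order_trans[OF norm_ge_zero assms(1)] by (intro mult_left_mono) auto
  finally show ?thesis by (simp add: power2_eq_square mult_ac algebra_simps)
qed

lemma set_integrable_mult_continuous:
  fixes k h :: "real \<Rightarrow> complex"
  assumes "set_integrable lborel {a..b} k" "continuous_on {a..b} h"
  shows "set_integrable lborel {a..b} (\<lambda>s. k s * h s)"
proof -
  obtain B where B: "\<And>s. s \<in> {a..b} \<Longrightarrow> cmod (h s) \<le> B"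
    using compact_imp_bounded[OF compact_continuous_image[OF assms(2) compact_Icc]]
    unfolding bounded_iff by blast
  have [measurable]: "(\<lambda>s. indicator {a..b} s *\<^sub>R k s) \<in> borel_measurable lborel"
    using assms(1) unfolding set_integrable_def by (rule borel_measurable_integrable)
  have [measurable]: "(\<lambda>s. indicator {a..b} s *\<^sub>R h s) \<in> borel_measurable lborel"
    using borel_measurable_continuous_on_indicator[OF _ assms(2)] by simp
  have eq: "indicator {a..b} s *\<^sub>R (k s * h s) = (indicator {a..b} s *\<^sub>R k s) * (indicator {a..b} s *\<^sub>R h s)" for s
    by (simp split: split_indicator)
  show ?thesis
    unfolding set_integrable_def
  proof (rule Bochner_Integration.integrable_bound)
    show "integrable lborel (\<lambda>s. \<bar>B\<bar> *\<^sub>R (indicator {a..b} s *\<^sub>R k s))"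
      using assms(1) unfolding set_integrable_def by (rule integrable_scaleR_right)
    show "(\<lambda>s. indicator {a..b} s *\<^sub>R (k s * h s)) \<in> borel_measurable lborel"
      unfolding eq by measurable
    have "norm (indicator {a..b} s *\<^sub>R (k s * h s)) \<le> norm (\<bar>B\<bar> *\<^sub>R (indicator {a..b} s *\<^sub>R k s))" for s
      using B[of s] mult_left_mono[of "cmod (h s)" "\<bar>B\<bar>" "cmod (k s)"]
      by (auto simp: norm_mult mult.commute split: split_indicator)
    then show "AE s in lborel. norm (indicator {a..b} s *\<^sub>R (k s * h s)) \<le> norm (\<bar>B\<bar> *\<^sub>R (indicator {a..b} s *\<^sub>R k s))"
      by simp
  qed
qed

lemma continuous_on_set_integral:
  fixes k :: "real \<Rightarrow> 'a::euclidean_space"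
  assumes "set_integrable lborel {0..T} k"
  shows "continuous_on {0..T} (\<lambda>s. LBINT r:{0..s}. k r)"
proof -
  have "continuous_on {0..T} (\<lambda>s. integral {0..s} k)"
    by (intro indefinite_integral_continuous_1 set_borel_integral_eq_integral(1) assms)
  moreover have "(LBINT r:{0..s}. k r) = integral {0..s} k" if "s \<in> {0..T}" for s
    using that by (intro set_borel_integral_eq_integral(2) set_integrable_subset[OF assms]) auto
  ultimately show ?thesis by (subst continuous_on_cong[OF refl]) auto
qed

lemma set_integral_split:
  fixes k :: "real \<Rightarrow> 'a::euclidean_space"
  assumes "set_integrable lborel {0..T} k" "0 \<le> s" "s \<le> t" "t \<le> T"
  shows "set_integrable lborel {s<..t} k"
    and "(LBINT r:{0..t}. k r) = (LBINT r:{0..s}. k r) + (LBINT r:{s<..t}. k r)"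
proof -
  show i: "set_integrable lborel {s<..t} k"
    using assms by (intro set_integrable_subset[OF assms(1)]) auto
  have "set_integrable lborel {0..s} k"
    using assms by (intro set_integrable_subset[OF assms(1)]) auto
  moreover have "{0..t} = {0..s} \<union> {s<..t}" using assms by auto
  ultimately show "(LBINT r:{0..t}. k r) = (LBINT r:{0..s}. k r) + (LBINT r:{s<..t}. k r)"
    using i set_integral_Un[of "{0..s}" "{s<..t}" lborel k] by (simp add: ivl_disj_int)
qed

lemma set_integral_singleton: "(LBINT r:{a}. k r) = (0::'a::euclidean_space)" for a :: real
  unfolding set_lebesgue_integral_def
proof (rule integral_eq_zero_AE)
  show "AE x in lborel. indicator {a} x *\<^sub>R k x = 0"
    using AE_lborel_singleton[of a] by eventually_elim simp
qed

lemma norm_set_integral_le: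
  fixes k :: "real \<Rightarrow> 'a::euclidean_space" and l :: "real \<Rightarrow> real"
  assumes "set_integrable lborel A k" "set_integrable lborel A l" "\<And>r. r \<in> A \<Longrightarrow> norm (k r) \<le> l r"
  shows "norm (LBINT r:A. k r) \<le> (LBINT r:A. l r)"
proof -
  have "norm (LBINT r:A. k r) \<le> (\<integral>r. norm (indicator A r *\<^sub>R k r) \<partial>lborel)"
    unfolding set_lebesgue_integral_def by (rule integral_norm_bound)
  also have "\<dots> \<le> (LBINT r:A. l r)"
    unfolding set_lebesgue_integral_def using assms unfolding set_integrable_def
    by (intro integral_mono integrable_norm) (auto split: split_indicator)
  finally show ?thesis .
qed

text \<open>The difference of the two sides is constant, because over an interval it changes by at most a
  multiple of the square of the integral of \<open>\<bar>k\<bar>\<close>.\<close>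

lemma set_integral_exp_integral:
  fixes k :: "real \<Rightarrow> complex"
  assumes k: "set_integrable lborel {0..T} k" and T: "T \<ge> 0"
  defines "K \<equiv> \<lambda>s. LBINT r:{0..s}. k r"
  shows "set_integrable lborel {0..T} (\<lambda>s. k s * exp (K s))"
    and "exp (K T) = 1 + (LBINT s:{0..T}. k s * exp (K s))"
proof -
  \<comment> \<open>\<open>L\<close> dominates the increments of \<open>K\<close> and serves as the
    time parameter in which the error is quadratic.\<close>
  define L where "L s = (LBINT r:{0..s}. cmod (k r))" for s
  have kn: "set_integrable lborel {0..T} (\<lambda>r. cmod (k r))" by (rule set_integrable_norm[OF k])
  have K: "continuous_on {0..T} K" unfolding K_def by (rule continuous_on_set_integral[OF k])
  have L: "continuous_on {0..T} L" unfolding L_def by (rule continuous_on_set_integral[OF kn])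
  show ke: "set_integrable lborel {0..T} (\<lambda>s. k s * exp (K s))"
    by (intro set_integrable_mult_continuous k continuous_intros K)
  have Ld: "L t - L s = (LBINT r:{s<..t}. cmod (k r))" if "0 \<le> s" "s \<le> t" "t \<le> T" for s t
    using set_integral_split(2)[OF kn that] by (simp add: L_def)
  have mono: "L s \<le> L t" if "0 \<le> s" "s \<le> t" "t \<le> T" for s t
  proof -
    have "0 \<le> (LBINT r:{s<..t}. cmod (k r))"
      unfolding set_lebesgue_integral_def by (intro integral_nonneg_AE) auto
    then show ?thesis using Ld[OF that] by simp
  qed
  have Kd: "cmod (K t - K s) \<le> L t - L s" if "0 \<le> s" "s \<le> t" "t \<le> T" for s t
    unfolding Ld[OF that] using set_integral_split[OF k that] set_integral_split(1)[OF kn that]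
    by (simp add: K_def norm_set_integral_le)
  \<comment> \<open>One constant that bounds both \<open>cmod (K s)\<close> and all increments of
    \<open>L\<close> on the interval.\<close>
  define M where "M = L T"
  have L0: "L 0 = 0" by (simp add: L_def set_integral_singleton)
  have K0: "K 0 = 0" by (simp add: K_def set_integral_singleton)
  have KM: "cmod (K s) \<le> M" if "0 \<le> s" "s \<le> T" for s
    using Kd[of 0 s] mono[of s T] that by (simp add: L0 K0 M_def)
  define D where "D t = exp (K t) - (LBINT s:{0..t}. k s * exp (K s))" for t
  \<comment> \<open>The factor 2 counts two remainders of second order: that of \<open>exp w\<close>
    beyond its linear part, and that of freezing the integrand at the left endpoint.\<close>
  have "norm (D t - D s) \<le> (2 * exp M * exp M) * (L t - L s)\<^sup>2" if st: "0 \<le> s" "s \<le> t" "t \<le> T" for s t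
  proof -
    define w where "w = K t - K s"
    define l where "l = L t - L s"
    have l: "0 \<le> l" "l \<le> M" using mono[OF st] mono[of t T] mono[of 0 s] st by (auto simp: l_def M_def L0)
    have w: "cmod w \<le> l" unfolding w_def l_def by (rule Kd[OF st])
    have i1: "set_integrable lborel {s<..t} k" and i2: "set_integrable lborel {s<..t} (\<lambda>r. k r * exp (K r))"
      and i3: "set_integrable lborel {s<..t} (\<lambda>r. cmod (k r))"
      by (intro set_integral_split(1)[OF _ st] k ke kn)+
    have wI: "w = (LBINT r:{s<..t}. k r)" using set_integral_split(2)[OF k st] by (simp add: w_def K_def)
    have i4: "set_integrable lborel {s<..t} (\<lambda>r. exp (K s) * k r)" using i1 by (rule set_integrable_mult_right)
    \<comment> \<open>The main term \<open>exp (K s) * w\<close> comes from freezing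
      \<open>exp (K r)\<close> at \<open>r = s\<close>; it cancels the linear part of the increment
      of \<open>exp (K t)\<close>.\<close>
    have eq: "(LBINT r:{s<..t}. k r * exp (K r))
        = exp (K s) * w + (LBINT r:{s<..t}. k r * exp (K r) - exp (K s) * k r)"
      using set_integral_diff(2)[OF i2 i4] by (simp add: wI)
    have "cmod (LBINT r:{s<..t}. k r * exp (K r) - exp (K s) * k r)
        \<le> (LBINT r:{s<..t}. (exp M * (l * exp M)) * cmod (k r))"
    proof (rule norm_set_integral_le)
      show "set_integrable lborel {s<..t} (\<lambda>r. k r * exp (K r) - exp (K s) * k r)"
        using i2 i4 by (rule set_integral_diff)
      show "set_integrable lborel {s<..t} (\<lambda>r. (exp M * (l * exp M)) * cmod (k r))"
        using i3 by (rule set_integrable_mult_right)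
      fix r assume r: "r \<in> {s<..t}"
      have "k r * exp (K r) - exp (K s) * k r = exp (K s) * (exp (K r - K s) - 1) * k r"
        by (simp add: algebra_simps flip: exp_add)
      also have "cmod \<dots> \<le> exp M * (l * exp M) * cmod (k r)"
      proof -
        have "cmod (exp (K s)) \<le> exp M" using norm_exp[of "K s"] KM[of s] st by (auto intro: order_trans)
        moreover have "cmod (exp (K r - K s) - 1) \<le> l * exp M"
        proof (rule cmod_exp_minus_one_le)
          show "cmod (K r - K s) \<le> l"
            using Kd[of s r] mono[of r t] r st by (auto simp: l_def)
        qed (rule l)
        ultimately show ?thesis unfolding norm_mult by (intro mult_right_mono mult_mono) auto
      qed
      finally show "cmod (k r * exp (K r) - exp (K s) * k r) \<le> exp M * (l * exp M) * cmod (k r)" .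
    qed
    also have "\<dots> = exp M * exp M * l\<^sup>2"
      using Ld[OF st] by (simp add: l_def power2_eq_square)
    finally have a: "cmod (LBINT r:{s<..t}. k r * exp (K r) - exp (K s) * k r) \<le> exp M * exp M * l\<^sup>2" .
    have "D t - D s = exp (K s) * (exp w - 1 - w) - (LBINT r:{s<..t}. k r * exp (K r) - exp (K s) * k r)"
    proof -
      have "exp (K t) = exp (K s) * exp w" by (simp add: w_def flip: exp_add)
      then show ?thesis
        using set_integral_split(2)[OF ke st] eq by (simp add: D_def algebra_simps)
    qed
    also have "cmod \<dots> \<le> cmod (exp (K s) * (exp w - 1 - w)) + exp M * exp M * l\<^sup>2"
      by (rule order_trans[OF norm_triangle_ineq4 add_left_mono[OF a]])
    also have "cmod (exp (K s) * (exp w - 1 - w)) \<le> exp M * (l\<^sup>2 * exp M)"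
      unfolding norm_mult
    proof (rule mult_mono)
      show "cmod (exp (K s)) \<le> exp M" using norm_exp[of "K s"] KM[of s] st by (auto intro: order_trans)
      show "cmod (exp w - 1 - w) \<le> l\<^sup>2 * exp M" by (rule cmod_exp_minus_linear_le[OF w l(2)])
    qed auto
    finally show ?thesis by (simp add: l_def mult_ac)
  qed
  then have "D T = D 0" using L mono T by (intro constant_if_quadratically_close[of 0 T L]) auto
  then show "exp (K T) = 1 + (LBINT s:{0..T}. k s * exp (K s))"
    by (simp add: D_def K0 set_integral_singleton algebra_simps)
qed

section \<open>Weyl operators on the exponential vectors\<close>

definition window :: "real \<Rightarrow> real \<Rightarrow> complex" where
  "window t s = indicator {0..<t} s"

lemma half_line_integral: "(\<integral>x. f x \<partial>half_line) = (LBINT x:{0..}. f x)"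
  for f :: "real \<Rightarrow> 'a::euclidean_space"
  by (simp add: half_line_def integral_restrict_space set_lebesgue_integral_def)

lemma L2_half_line_iff:
  "f \<in> L2 half_line \<longleftrightarrow> (\<lambda>x. indicator {0..} x *\<^sub>R f x) \<in> L2 lborel"
proof -
  have "(cmod (indicator {0..} x *\<^sub>R f x))\<^sup>2 = indicator {0..} x *\<^sub>R (cmod (f x))\<^sup>2" for x
    by (simp split: split_indicator)
  then show ?thesis
    by (simp add: L2_def half_line_def borel_measurable_restrict_space_iff integrable_restrict_space
        del: norm_scaleR)
qed

lemma L2_half_line_restrict:
  assumes "f \<in> L2 half_line" "A \<in> sets borel"
  shows "(\<lambda>s. if s \<in> A then f s else 0) \<in> L2 half_line"
proof -
  have [measurable]: "f \<in> borel_measurable half_line" and i: "integrable half_line (\<lambda>x. (cmod (f x))\<^sup>2)"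
    using assms(1) by (auto simp: L2_def)
  have [measurable]: "Measurable.pred half_line (\<lambda>x. x \<in> A)"
    using assms(2) unfolding half_line_def by (intro measurable_restrict_space1) simp
  have m: "(\<lambda>s. if s \<in> A then f s else 0) \<in> borel_measurable half_line" by measurable
  have "integrable half_line (\<lambda>x. (cmod (if x \<in> A then f x else 0))\<^sup>2)"
    by (rule Bochner_Integration.integrable_bound[OF i]) (use m in auto)
  then show ?thesis using m by (simp add: L2_def)
qed

lemma window_L2: "window t \<in> L2 half_line"
proof -
  have "(cmod (indicator {0..} x *\<^sub>R window t x))\<^sup>2 = indicator {0..<t} x" for x
    by (simp add: window_def split: split_indicator)
  moreover have "(\<lambda>x. indicator {0..} x *\<^sub>R window t x) \<in> borel_measurable lborel"
    unfolding window_def[abs_def] by measurable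
  moreover have "integrable lborel (indicat_real {0..<t})" by (cases "0 \<le> t") auto
  ultimately show ?thesis unfolding L2_half_line_iff by (simp add: L2_def)
qed

lemma before_eq: "before t f = (\<lambda>s. if s \<in> {0..<t} then f s else 0)"
  by (auto simp: before_def fun_eq_iff)

lemma after_eq: "after t f = (\<lambda>s. if s \<in> {t..} then f s else 0)"
  by (auto simp: after_def fun_eq_iff)

lemma before_L2: "f \<in> L2 half_line \<Longrightarrow> before t f \<in> L2 half_line"
  unfolding before_eq by (rule L2_half_line_restrict) auto

lemma after_L2: "f \<in> L2 half_line \<Longrightarrow> after t f \<in> L2 half_line"
  unfolding after_eq by (rule L2_half_line_restrict) auto

lemma l2_inner_add_right:
  assumes "f \<in> L2 M" "g \<in> L2 M" "h \<in> L2 M"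
  shows "l2_inner M f (\<lambda>x. g x + h x) = l2_inner M f g + l2_inner M f h"
  using L2_integrable_mult[OF assms(1,2)] L2_integrable_mult[OF assms(1,3)]
  by (simp add: l2_inner_def distrib_left)

lemma l2_inner_scale_right: "l2_inner M f (\<lambda>x. c * g x) = c * l2_inner M f g"
  by (simp add: l2_inner_def mult.left_commute[of _ c])

lemma l2_inner_cnj: "cnj (l2_inner M f g) = l2_inner M g f"
  by (simp add: l2_inner_def mult.commute flip: Bochner_Integration.integral_cnj)

lemma l2_inner_add_left:
  assumes "f \<in> L2 M" "g \<in> L2 M" "h \<in> L2 M"
  shows "l2_inner M (\<lambda>x. g x + h x) f = l2_inner M g f + l2_inner M h f"
  using arg_cong[OF l2_inner_add_right[OF assms], of cnj] by (simp add: l2_inner_cnj)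

lemma l2_inner_scale_left: "l2_inner M (\<lambda>x. c * g x) f = cnj c * l2_inner M g f"
  using arg_cong[OF l2_inner_scale_right[of M f c g], of cnj] by (simp add: l2_inner_cnj)

text \<open>Links the Fock-space pairing with the indefinite integral in the equation. The half-open
  window and the closed interval differ by the null set of one endpoint.\<close>

lemma l2_inner_window:
  assumes "f \<in> L2 half_line"
  shows "set_integrable lborel {0..t} f" and "l2_inner half_line (window t) f = (LBINT s:{0..t}. f s)"
proof -
  have i: "integrable half_line (\<lambda>x. cnj (window t x) * f x)"
    by (rule L2_integrable_mult[OF window_L2 assms])
  have eq: "indicator {0..} x *\<^sub>R (cnj (window t x) * f x) = indicator {0..<t} x *\<^sub>R f x" for x
    by (simp add: window_def split: split_indicator)
  have i0: "integrable lborel (\<lambda>x. indicator {0..<t} x *\<^sub>R f x)"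
    using i unfolding half_line_def by (simp add: integrable_restrict_space eq)
  have [measurable]: "(\<lambda>x. indicator {0..} x *\<^sub>R f x) \<in> borel_measurable borel"
    using assms unfolding L2_half_line_iff by (simp add: L2_def)
  have eq': "indicator {0..t} x *\<^sub>R f x = indicator {0..t} x *\<^sub>R (indicator {0..} x *\<^sub>R f x)"
    "indicator {0..<t} x *\<^sub>R f x = indicator {0..<t} x *\<^sub>R (indicator {0..} x *\<^sub>R f x)" for x
    by (simp_all split: split_indicator)
  have m: "(\<lambda>x. indicator {0..t} x *\<^sub>R f x) \<in> borel_measurable lborel"
    "(\<lambda>x. indicator {0..<t} x *\<^sub>R f x) \<in> borel_measurable lborel"
    unfolding eq' by measurable
  have ae: "AE x in lborel. indicator {0..<t} x *\<^sub>R f x = indicator {0..t} x *\<^sub>R f x"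
    using AE_lborel_singleton[of t] by eventually_elim (auto split: split_indicator)
  show "set_integrable lborel {0..t} f"
    unfolding set_integrable_def using integrable_cong_AE[OF m(2,1) ae] i0 by simp
  have "l2_inner half_line (window t) f = (LBINT x:{0..<t}. f x)"
    unfolding l2_inner_def half_line_integral set_lebesgue_integral_def eq ..
  also have "\<dots> = (LBINT s:{0..t}. f s)"
    unfolding set_lebesgue_integral_def by (rule integral_cong_AE[OF m(2,1) ae])
  finally show "l2_inner half_line (window t) f = (LBINT s:{0..t}. f s)" .
qed

lemma l2_inner_window_self: "t \<ge> 0 \<Longrightarrow> l2_inner half_line (window t) (window t) = complex_of_real t"
proof -
  assume t: "t \<ge> 0"
  have eq: "indicator {0..} x *\<^sub>R (cnj (window t x) * window t x) = complex_of_real (indicator {0..<t} x)" for x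
    by (simp add: window_def split: split_indicator)
  show ?thesis
    using t unfolding l2_inner_def half_line_integral set_lebesgue_integral_def eq
    by simp
qed

lemma l2_inner_before_after:
  assumes "f \<in> L2 half_line" "g \<in> L2 half_line" "t \<ge> 0"
  shows "l2_inner half_line f g = l2_inner half_line (before t f) (before t g)
    + l2_inner half_line (after t f) (after t g)"
proof -
  have "(\<integral>x. cnj (f x) * g x \<partial>half_line)
      = (\<integral>x. cnj (before t f x) * before t g x + cnj (after t f x) * after t g x \<partial>half_line)"
    by (rule Bochner_Integration.integral_cong)
      (auto simp: half_line_def space_restrict_space before_def after_def)
  then show ?thesis
    unfolding l2_inner_def
    using L2_integrable_mult[OF before_L2[OF assms(1)] before_L2[OF assms(2)], of t t]
      L2_integrable_mult[OF after_L2[OF assms(1)] after_L2[OF assms(2)], of t t]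
    by simp
qed

lemma l2_inner_window_before: "l2_inner half_line (window t) (before t f) = l2_inner half_line (window t) f"
  unfolding l2_inner_def by (rule Bochner_Integration.integral_cong) (auto simp: window_def before_def split: split_indicator)

section \<open>Scalars of the generator and displaced exponential vectors\<close>

context
  fixes c1 c2 :: complex
begin

text \<open>The generator of the flow acts on the monomial with index \<open>k\<close> by the scalars
  \<open>drift k\<close> (for \<open>\<tau>\<close>), \<open>charge k\<close> (for \<open>\<delta>\<close>) and \<open>- cnj (charge k)\<close> (for \<open>\<delta>\<^sup>\<dagger>\<close>).\<close>

fun charge :: "int \<times> int \<times> int \<Rightarrow> complex" where
  "charge (m, n, p) = of_int m * c1 + of_int n * c2"

fun drift :: "int \<times> int \<times> int \<Rightarrow> complex" where
  "drift (m, n, p) = - (1/2 * complex_of_real ((cmod c1)\<^sup>2) * (of_int m)\<^sup>2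
     + 1/2 * complex_of_real ((cmod c2)\<^sup>2) * (of_int n)\<^sup>2
     + cnj c1 * c2 * of_int m * of_int n + (cnj c1 * c2 - c1 * cnj c2) * of_int p)"

lemma charge_mult: "charge (heis_mult k l) = charge k + charge l"
  by (cases k; cases l) (simp add: algebra_simps)

lemma drift_eq:
  "drift (m, n, p) = - (1/2 * (c1 * cnj c1) * (of_int m * of_int m) + 1/2 * (c2 * cnj c2) * (of_int n * of_int n)
     + cnj c1 * c2 * of_int m * of_int n + (cnj c1 * c2 - c1 * cnj c2) * of_int p)"
  unfolding drift.simps complex_norm_square unfolding power2_eq_square ..

text \<open>The Ito product rule
  \<open>tau (x y) = tau x y + x tau y + delta_dagger x delta y\<close> on monomials. The quadratic
  part of \<open>drift\<close> alone would contribute \<open>cnj c1 * c2 * m' * n\<close>; the shift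
  of the third index by \<open>- m' * n\<close> turns this into the required
  \<open>c1 * cnj c2 * m' * n\<close>.\<close>

lemma drift_mult: "drift (heis_mult k l) = drift k + drift l - cnj (charge k) * charge l"
  by (cases k; cases l) (simp add: drift_eq algebra_simps del: drift.simps)

text \<open>The real part of \<open>drift k\<close> is minus half the squared modulus of the charge,
  the normalization of a Weyl operator; what remains is a phase.\<close>

lemma drift_cnj: "drift k + cnj (drift k) = - (charge k * cnj (charge k))"
  by (cases k) (simp add: drift_eq algebra_simps del: drift.simps)

text \<open>The action of a Weyl operator on exponential vectors,
  \<open>W(h) expv f = exp (- |h|^2 / 2 - <h, f>) expv (f + h)\<close> for
  \<open>h = charge k * window t\<close>. For nonnegative times, \<open>of_real t * drift k\<close>
  replaces \<open>- |h|^2 / 2\<close>, which is its real part.\<close>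

definition displaced :: "real \<Rightarrow> int \<times> int \<times> int \<Rightarrow> (real \<Rightarrow> complex) \<Rightarrow> fock" where
  "displaced t k f = exp (of_real t * drift k - cnj (charge k) * l2_inner half_line (window t) f)
     *\<^sub>C expv (\<lambda>s. f s + charge k * window t s)"

lemma displaced_L2: "f \<in> L2 half_line \<Longrightarrow> (\<lambda>s. f s + z * window t s) \<in> L2 half_line"
  by (intro L2_add L2_scale window_L2)

lemma l2_inner_displaced:
  assumes "f \<in> L2 half_line" "g \<in> L2 half_line"
  shows "l2_inner half_line f (\<lambda>s. g s + z * window t s)
      = l2_inner half_line f g + z * cnj (l2_inner half_line (window t) f)"
    and "l2_inner half_line (\<lambda>s. g s + z * window t s) f
      = l2_inner half_line g f + cnj z * l2_inner half_line (window t) f"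
  unfolding l2_inner_add_right[OF assms L2_scale[OF window_L2]] l2_inner_scale_right
    l2_inner_add_left[OF assms L2_scale[OF window_L2]] l2_inner_scale_left l2_inner_cnj
  by (rule refl)+

lemma cinner_expv_displaced:
  assumes "f \<in> L2 half_line" "g \<in> L2 half_line"
  shows "cinner (expv f) (displaced t k g)
    = exp (l2_inner half_line f g + (of_real t * drift k - cnj (charge k) * l2_inner half_line (window t) g
        + charge k * cnj (l2_inner half_line (window t) f)))"
  unfolding displaced_def cinner_scaleC_right cinner_expv[OF assms(1) displaced_L2[OF assms(2)]]
    l2_inner_displaced[OF assms] exp_add[symmetric]
  by (simp add: algebra_simps)

text \<open>The mixed terms of the displaced pairing cancel against the two scalar prefactors, and
  the remaining \<open>t\<close> times the squared modulus of the charge cancels by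
  \<open>drift_cnj\<close>.\<close>

lemma cinner_displaced:
  assumes "f \<in> L2 half_line" "g \<in> L2 half_line" "t \<ge> 0"
  shows "cinner (displaced t k f) (displaced t k g) = cinner (expv f) (expv g)"
proof -
  let ?z = "charge k" and ?w = "window t" and ?i = "l2_inner half_line"
  have i: "?i (\<lambda>s. f s + ?z * ?w s) (\<lambda>s. g s + ?z * ?w s)
      = ?i f g + ?z * cnj (?i ?w f) + cnj ?z * ?i ?w g + ?z * cnj ?z * of_real t"
    unfolding l2_inner_displaced(1)[OF displaced_L2[OF assms(1)] assms(2)]
      l2_inner_displaced(2)[OF assms(2,1)] l2_inner_displaced(1)[OF window_L2 assms(1)]
      l2_inner_window_self[OF assms(3)]
    by (simp add: algebra_simps)
  have "cnj (of_real t * drift k - cnj ?z * ?i ?w f) + (of_real t * drift k - cnj ?z * ?i ?w g)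
      + (?i f g + ?z * cnj (?i ?w f) + cnj ?z * ?i ?w g + ?z * cnj ?z * of_real t)
      = of_real t * (drift k + cnj (drift k)) + ?z * cnj ?z * of_real t + ?i f g"
    by (simp add: algebra_simps)
  also have "\<dots> = ?i f g" unfolding drift_cnj by (simp add: algebra_simps)
  finally have e: "cnj (of_real t * drift k - cnj ?z * ?i ?w f) + (of_real t * drift k - cnj ?z * ?i ?w g)
      + (?i f g + ?z * cnj (?i ?w f) + cnj ?z * ?i ?w g + ?z * cnj ?z * of_real t) = ?i f g" .
  define A where "A = of_real t * drift k - cnj ?z * ?i ?w f"
  define B where "B = of_real t * drift k - cnj ?z * ?i ?w g"
  define I where "I = ?i f g + ?z * cnj (?i ?w f) + cnj ?z * ?i ?w g + ?z * cnj ?z * of_real t"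
  have "cnj A + B + I = ?i f g" using e unfolding A_def B_def I_def .
  then have "cnj (exp A) * exp B * exp I = exp (?i f g)" by (simp only: exp_cnj exp_add[symmetric])
  then show ?thesis
    unfolding displaced_def cinner_scaleC_left cinner_scaleC_right
      cinner_expv[OF displaced_L2[OF assms(1)] displaced_L2[OF assms(2)]] cinner_expv[OF assms(1,2)]
      i A_def[symmetric] B_def[symmetric] I_def[symmetric]
    by (simp only: mult_ac)
qed

section \<open>Weyl operators on the whole Fock space\<close>

definition expv_perp :: "fock set" where
  "expv_perp = {y. \<forall>f\<in>L2 half_line. cinner (expv f) y = 0}"

text \<open>A tagged union, so that one Gram-matrix argument covers both families while the tag
  decides whether a vector is displaced or fixed.\<close>

definition exp_index :: "((real \<Rightarrow> complex) + fock) set" where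
  "exp_index = Inl ` L2 half_line \<union> Inr ` expv_perp"

text \<open>A vector orthogonal to the whole family is in particular orthogonal to the exponential
  vectors and hence is itself a member of the family.\<close>

lemma exp_index_total: "closure (span {c *\<^sub>C case_sum expv id i |c i. i \<in> exp_index}) = UNIV"
proof (rule closed_subspace_eq_UNIV)
  let ?B = "{c *\<^sub>C case_sum expv id i |c i. i \<in> exp_index}"
  have B: "c *\<^sub>C case_sum expv id i \<in> closure (span ?B)" if "i \<in> exp_index" for c i
    by (rule subsetD[OF closure_subset], rule span_base) (use that in blast)
  fix y assume y: "\<And>m. m \<in> closure (span ?B) \<Longrightarrow> inner m y = 0"
  have "cinner (expv f) y = 0" if f: "f \<in> L2 half_line" for f
  proof -
    have "c *\<^sub>C expv f \<in> closure (span ?B)" for c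
      using B[of "Inl f" c] f by (simp add: exp_index_def)
    then have "inner (c *\<^sub>C expv f) y = 0" for c by (intro y)
    then have 0: "Re (cnj c * cinner (expv f) y) = 0" for c
      by (simp only: inner_cinner cinner_scaleC_left)
    \<comment> \<open>The multiples by \<open>1\<close> and \<open>\<i>\<close> recover the real and
      the imaginary part from the real inner product.\<close>
    show ?thesis using 0[of 1] 0[of \<i>] by (simp add: complex_eq_iff)
  qed
  then have "Inr y \<in> exp_index" by (simp add: exp_index_def expv_perp_def)
  from B[OF this, of 1] show "y \<in> closure (span ?B)" by simp
qed (auto intro: subspace_closure)

text \<open>The Weyl operators obey only a twisted multiplication rule.  The phase contained in \<open>drift\<close>
  turns them into a unitary representation of the Heisenberg group on the closed span of the
  exponential vectors; on the orthogonal complement the representation is trivial.\<close>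

definition weyl_prop where
  "weyl_prop t k T \<longleftrightarrow> clinear_op T \<and> (\<forall>x. norm (blinfun_apply T x) = norm x)
     \<and> (\<forall>i\<in>exp_index. blinfun_apply T (case_sum expv id i) = case_sum (displaced t k) id i)"

definition weyl :: "real \<Rightarrow> int \<times> int \<times> int \<Rightarrow> fock \<Rightarrow>\<^sub>L fock" where
  "weyl t k = (SOME T. weyl_prop t k T)"

lemma weyl_prop:
  assumes "t \<ge> 0" shows "weyl_prop t k (weyl t k)"
  unfolding weyl_def
proof (rule someI_ex)
  \<comment> \<open>Displaced vectors are multiples of exponential vectors, so the mixed entries of
    both Gram matrices vanish.\<close>
  have 1: "cinner (displaced t k f) y = 0" "cinner y (displaced t k f) = 0" "cinner y (expv f) = 0"
    if "y \<in> expv_perp" "f \<in> L2 half_line" for f y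
    using that displaced_L2[OF that(2)] cinner_commute[of y]
    by (simp_all add: expv_perp_def displaced_def cinner_scaleC_left cinner_scaleC_right)
  have "cinner (case_sum (displaced t k) id i) (case_sum (displaced t k) id i')
      = cinner (case_sum expv id i) (case_sum expv id i')"
    if "i \<in> exp_index" "i' \<in> exp_index" for i i'
    using that assms unfolding exp_index_def
    by (auto simp: cinner_displaced 1) (simp add: expv_perp_def)+
  from isometry_from_gram[OF exp_index_total this]
  show "\<exists>T. weyl_prop t k T" unfolding weyl_prop_def by blast
qed

lemma weyl_expv: "t \<ge> 0 \<Longrightarrow> f \<in> L2 half_line \<Longrightarrow> weyl t k (expv f) = displaced t k f"
  using weyl_prop[of t k] unfolding weyl_prop_def exp_index_def by force

lemma weyl_perp: "t \<ge> 0 \<Longrightarrow> y \<in> expv_perp \<Longrightarrow> weyl t k y = y"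
  using weyl_prop[of t k] unfolding weyl_prop_def exp_index_def by force

lemma weyl_clinear: "t \<ge> 0 \<Longrightarrow> weyl t k (c *\<^sub>C x) = c *\<^sub>C weyl t k x"
  using weyl_prop[of t k] by (simp add: weyl_prop_def clinear_op_def)

text \<open>The second displacement sees the first through its window, which adds
  \<open>- t * cnj (charge k) * charge l\<close> to the exponent. By \<open>drift_mult\<close> this
  completes the two drifts to that of the product.\<close>

lemma displaced_mult:
  assumes "t \<ge> 0" "f \<in> L2 half_line"
  shows "weyl t k (displaced t l f) = displaced t (heis_mult k l) f"
proof -
  let ?i = "l2_inner half_line (window t)"
  have i: "?i (\<lambda>s. f s + charge l * window t s) = ?i f + charge l * of_real t"
    unfolding l2_inner_displaced(1)[OF window_L2 assms(2)] l2_inner_window_self[OF assms(1)] by simp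
  have e: "of_real t * drift l - cnj (charge l) * ?i f
      + (of_real t * drift k - cnj (charge k) * (?i f + charge l * of_real t))
      = of_real t * drift (heis_mult k l) - cnj (charge (heis_mult k l)) * ?i f"
    by (simp add: drift_mult charge_mult algebra_simps)
  have "weyl t k (displaced t l f)
      = exp (of_real t * drift l - cnj (charge l) * ?i f) *\<^sub>C displaced t k (\<lambda>s. f s + charge l * window t s)"
    unfolding displaced_def[of t l] weyl_clinear[OF assms(1)]
    by (simp add: weyl_expv assms displaced_L2)
  also have "\<dots> = displaced t (heis_mult k l) f"
    unfolding displaced_def i scaleC_scaleC exp_add[symmetric] e
    by (simp add: charge_mult algebra_simps)
  finally show ?thesis .
qed

lemma heis_unitary_rep_weyl:
  assumes t: "t \<ge> 0" shows "heis_unitary_rep (weyl t)"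
proof
  have total: "x \<in> closure (span {c *\<^sub>C case_sum expv id i |c i. i \<in> exp_index})" for x
    by (simp add: exp_index_total)
  show "clinear_op (weyl t k)" for k using weyl_prop[OF t, of k] by (simp add: weyl_prop_def)
  show "norm (weyl t k x) = norm x" for k x using weyl_prop[OF t, of k] by (simp add: weyl_prop_def)
  show "weyl t k (weyl t l x) = weyl t (heis_mult k l) x" for k l x
  proof (rule bounded_linear_eq_on_closure_span[OF _ _ _ total[of x]])
    fix x assume "x \<in> {c *\<^sub>C case_sum expv id i |c i. i \<in> exp_index}"
    then obtain c i where x: "x = c *\<^sub>C case_sum expv id i" "i \<in> exp_index" by blast
    then show "weyl t k (weyl t l x) = weyl t (heis_mult k l) x"
      using t by (auto simp: exp_index_def weyl_clinear weyl_expv weyl_perp displaced_mult)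
  qed (intro bounded_linear_intros)+
  show "weyl t (0, 0, 0) x = x" for x
  proof (rule bounded_linear_eq_on_closure_span[OF _ _ _ total[of x]])
    fix x assume "x \<in> {c *\<^sub>C case_sum expv id i |c i. i \<in> exp_index}"
    then obtain c i where x: "x = c *\<^sub>C case_sum expv id i" "i \<in> exp_index" by blast
    then show "weyl t (0, 0, 0) x = x"
      using t by (auto simp: exp_index_def weyl_clinear weyl_expv weyl_perp displaced_def)
  qed (intro bounded_linear_intros bounded_linear_ident)+
qed

end

section \<open>The flow\<close>

definition flow :: "complex \<Rightarrow> complex \<Rightarrow> real \<Rightarrow> (h_space \<Rightarrow>\<^sub>L h_space) \<Rightarrow> h_fock \<Rightarrow>\<^sub>L h_fock" where
  "flow c1 c2 t = heis_unitary_rep.lift_hom (weyl c1 c2 t)"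

lemma unital_star_hom_flow: "t \<ge> 0 \<Longrightarrow> unital_star_hom rot_alg (flow c1 c2 t)"
  unfolding flow_def by (rule heis_unitary_rep.unital_star_hom_lift_hom[OF heis_unitary_rep_weyl])

lemma rot_alg0_subset: "x \<in> rot_alg0 \<Longrightarrow> x \<in> rot_alg"
  unfolding rot_alg_def using closure_subset by blast

lemma cinner_twist_exp:
  assumes "t \<ge> 0" "f \<in> L2 half_line" "g \<in> L2 half_line"
  shows "cinner (u \<otimes>\<^sub>h expv f) ((cscale c o\<^sub>L heis_unitary_rep.twist (weyl c1 c2 t) k) (v \<otimes>\<^sub>h expv g))
    = c * cinner u (reindex_op (shift k) v)
      * exp (l2_inner half_line f g + (of_real t * drift c1 c2 k
        - cnj (charge c1 c2 k) * l2_inner half_line (window t) g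
        + charge c1 c2 k * cnj (l2_inner half_line (window t) f)))"
  by (simp add: cscale.rep_eq cinner_scaleC_right heis_unitary_rep.twist_tensor[OF heis_unitary_rep_weyl] assms
      cinner_tensor weyl_expv cinner_expv_displaced)

text \<open>The exponent involves \<open>f\<close> and \<open>g\<close> only through their pairing,
  which splits at time \<open>t\<close>, and through pairings with \<open>window t\<close>, which
  see nothing from time \<open>t\<close> on.\<close>

lemma adapted_flow: "adapted rot_alg (flow c1 c2)"
  unfolding adapted_def flow_def
proof (intro allI ballI impI)
  fix u v :: h_space and f g :: "real \<Rightarrow> complex" and t :: real and a
  assume f: "f \<in> L2 half_line" and g: "g \<in> L2 half_line" and t: "0 \<le> t" and a: "a \<in> rot_alg"
  show "cinner (u \<otimes>\<^sub>h expv f) (heis_unitary_rep.lift_hom (weyl c1 c2 t) a (v \<otimes>\<^sub>h expv g))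
    = cinner (u \<otimes>\<^sub>h expv (before t f)) (heis_unitary_rep.lift_hom (weyl c1 c2 t) a (v \<otimes>\<^sub>h expv (before t g)))
      * cinner (expv (after t f)) (expv (after t g))"
  proof (rule heis_unitary_rep.lift_hom_eqI_linear[OF heis_unitary_rep_weyl[OF t] _ _ _ a])
    show "bounded_linear (\<lambda>T. cinner (u \<otimes>\<^sub>h expv f) (blinfun_apply T (v \<otimes>\<^sub>h expv g)))"
      by (intro bounded_linear_intros bounded_linear_ident)
    show "bounded_linear (\<lambda>T. cinner (u \<otimes>\<^sub>h expv (before t f)) (blinfun_apply T (v \<otimes>\<^sub>h expv (before t g)))
      * cinner (expv (after t f)) (expv (after t g)))"
      by (intro bounded_linear_intros bounded_linear_ident)
  next
    fix c k
    show "cinner (u \<otimes>\<^sub>h expv f) ((cscale c o\<^sub>L heis_unitary_rep.twist (weyl c1 c2 t) k) (v \<otimes>\<^sub>h expv g))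
      = cinner (u \<otimes>\<^sub>h expv (before t f))
          ((cscale c o\<^sub>L heis_unitary_rep.twist (weyl c1 c2 t) k) (v \<otimes>\<^sub>h expv (before t g)))
        * cinner (expv (after t f)) (expv (after t g))"
      unfolding cinner_twist_exp[OF t f g] cinner_twist_exp[OF t before_L2[OF f] before_L2[OF g]]
        cinner_expv[OF after_L2[OF f] after_L2[OF g]] l2_inner_window_before
        l2_inner_before_after[OF f g t] exp_add
      by (simp only: mult_ac)
  qed
qed

section \<open>The generator on monomials\<close>

lemma linear_extension_diagonal:
  fixes e :: "int \<Rightarrow> int \<Rightarrow> int \<Rightarrow> complex"
  defines "d \<equiv> linear_extension (\<lambda>m n p. cscale (e m n p) o\<^sub>L monomial m n p)"
  shows "x \<in> rot_alg0 \<Longrightarrow> y \<in> rot_alg0 \<Longrightarrow> d (x + y) = d x + d y"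
    and "d (cscale c o\<^sub>L monomial m n p) = cscale (c * e m n p) o\<^sub>L monomial m n p"
    and "x \<in> rot_alg0 \<Longrightarrow> d x \<in> rot_alg0"
proof -
  have "is_linear_extension (\<lambda>m n p. cscale (e m n p) o\<^sub>L monomial m n p) d"
    unfolding d_def by (rule is_linear_extension_linear_extension)
  then have add: "\<And>x y. x \<in> rot_alg0 \<Longrightarrow> y \<in> rot_alg0 \<Longrightarrow> d (x + y) = d x + d y"
    and scale: "\<And>c x. x \<in> rot_alg0 \<Longrightarrow> d (cscale c o\<^sub>L x) = cscale c o\<^sub>L d x"
    and mon: "\<And>m n p. d (monomial m n p) = cscale (e m n p) o\<^sub>L monomial m n p"
    unfolding is_linear_extension_def by blast+
  show "x \<in> rot_alg0 \<Longrightarrow> y \<in> rot_alg0 \<Longrightarrow> d (x + y) = d x + d y" by (rule add)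
  show sm: "d (cscale c o\<^sub>L monomial m n p) = cscale (c * e m n p) o\<^sub>L monomial m n p" for c m n p
    by (simp add: scale monomial_in_rot_alg0 mon cscale_cscale)
  \<comment> \<open>Membership of \<open>x\<close> is carried through the induction because
    additivity of \<open>d\<close> is available on \<open>rot_alg0\<close> only.\<close>
  have "x \<in> rot_alg0 \<and> d x \<in> rot_alg0" if "x \<in> rot_alg0" for x
    using that unfolding rot_alg0_span
  proof (induction rule: span_induct_alt)
    case base
    have "d 0 = 0" using add[of 0 0] span_zero unfolding rot_alg0_span by fastforce
    then show ?case by (simp add: span_zero)
  next
    case (step r s x)
    obtain c m n p where s: "s = cscale c o\<^sub>L monomial m n p"
      using step(1) unfolding scaled_monomials_def by blast
    have rs: "r *\<^sub>R s = cscale (complex_of_real r * c) o\<^sub>L monomial m n p"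
      unfolding s by (simp flip: cscale_cscale add: cscale_scaleR)
    have in0: "cscale c o\<^sub>L monomial m n p \<in> span scaled_monomials" for c
      by (rule span_base) (auto simp: scaled_monomials_def)
    have "d (r *\<^sub>R s + x) = d (r *\<^sub>R s) + d x"
      using step(2) in0 unfolding rs by (intro add) (auto simp: rot_alg0_span)
    then show ?case
      using step(2) in0 unfolding rs sm by (simp add: span_add)
  qed
  then show "x \<in> rot_alg0 \<Longrightarrow> d x \<in> rot_alg0" by blast
qed

lemma rot_alg0_closed:
  "x \<in> rot_alg0 \<Longrightarrow> y \<in> rot_alg0 \<Longrightarrow> x + y \<in> rot_alg0"
  "x \<in> rot_alg0 \<Longrightarrow> cscale c o\<^sub>L x \<in> rot_alg0"
  "x \<in> rot_alg0 \<Longrightarrow> x o\<^sub>L cscale c \<in> rot_alg0"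
  "x \<in> rot_alg0 \<Longrightarrow> adj x \<in> rot_alg0"
proof -
  show s: "x \<in> rot_alg0 \<Longrightarrow> cscale c o\<^sub>L x \<in> rot_alg0" for x
    unfolding rot_alg0_def by (rule star_algebra.scale)
  show "x \<in> rot_alg0 \<Longrightarrow> y \<in> rot_alg0 \<Longrightarrow> x + y \<in> rot_alg0"
    unfolding rot_alg0_def by (rule star_algebra.add)
  show "x \<in> rot_alg0 \<Longrightarrow> adj x \<in> rot_alg0"
    unfolding rot_alg0_def by (rule star_algebra.star)
  have "cscale c o\<^sub>L monomial 0 0 0 \<in> rot_alg0" by (intro s monomial_in_rot_alg0)
  moreover have "cscale c o\<^sub>L monomial 0 0 0 = cscale c"
    unfolding monomial_shift reindex_op_shift_zero by (rule blinfun_eqI) simp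
  ultimately show "x \<in> rot_alg0 \<Longrightarrow> x o\<^sub>L cscale c \<in> rot_alg0"
    unfolding rot_alg0_def by (simp add: star_algebra.mult)
qed

lemma adj_add_rot_alg0:
  assumes "x \<in> rot_alg0" "y \<in> rot_alg0" shows "adj (x + y) = adj x + adj y"
  using span_scaled_monomials_adj(2)[of x] span_scaled_monomials_adj(2)[of y] assms
  by (intro adj_eqI) (simp add: rot_alg0_span blinfun.add_left cinner_add_left cinner_add_right)

lemma adj_scaled_monomial:
  "adj (cscale c o\<^sub>L monomial m n p) = cscale (cnj c) o\<^sub>L monomial (- m) (- n) (- p - m * n)"
  unfolding monomial_shift
  by (rule adj_eqI)
    (simp add: cscale.rep_eq cinner_scaleC_left cinner_scaleC_right cinner_reindex_op_shift)

lemma generator_additive: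
  assumes "x \<in> rot_alg0" "y \<in> rot_alg0"
  shows "tau c1 c2 (x + y) = tau c1 c2 x + tau c1 c2 y"
    and "delta c1 c2 (x + y) = delta c1 c2 x + delta c1 c2 y"
    and "delta_dagger c1 c2 (x + y) = delta_dagger c1 c2 x + delta_dagger c1 c2 y"
    and "tau c1 c2 x \<in> rot_alg0" "delta c1 c2 x \<in> rot_alg0" "delta_dagger c1 c2 x \<in> rot_alg0"
proof -
  have comp: "cscale c o\<^sub>L (a + b) = (cscale c o\<^sub>L a) + (cscale c o\<^sub>L b)" for c and a b :: "h_space \<Rightarrow>\<^sub>L h_space"
    by (rule blinfun_eqI) (simp add: blinfun.add_left blinfun.add_right)
  show "tau c1 c2 (x + y) = tau c1 c2 x + tau c1 c2 y" "tau c1 c2 x \<in> rot_alg0"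
    unfolding tau_def by (intro linear_extension_diagonal assms)+
  have d: "delta c1 c2 (x + y) = delta c1 c2 x + delta c1 c2 y" "delta c1 c2 x \<in> rot_alg0"
    if "x \<in> rot_alg0" "y \<in> rot_alg0" for x y
    using that unfolding delta_def delta1_def delta2_def
    by (simp_all add: linear_extension_diagonal comp rot_alg0_closed)
  show "delta c1 c2 (x + y) = delta c1 c2 x + delta c1 c2 y" "delta c1 c2 x \<in> rot_alg0"
    by (rule d[OF assms])+
  show "delta_dagger c1 c2 (x + y) = delta_dagger c1 c2 x + delta_dagger c1 c2 y"
    "delta_dagger c1 c2 x \<in> rot_alg0"
    unfolding delta_dagger_def using assms
    by (simp_all add: adj_add_rot_alg0 d rot_alg0_closed)
qed

text \<open>For \<open>delta_dagger\<close>, the inner adjoint negates the index and hence the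
  charge; the two conjugations restore \<open>c\<close> and leave the charge conjugated.\<close>

lemma generator_scaled_monomial:
  "tau c1 c2 (cscale c o\<^sub>L monomial m n p) = cscale (c * drift c1 c2 (m, n, p)) o\<^sub>L monomial m n p"
  "delta c1 c2 (cscale c o\<^sub>L monomial m n p) = cscale (c * charge c1 c2 (m, n, p)) o\<^sub>L monomial m n p"
  "delta_dagger c1 c2 (cscale c o\<^sub>L monomial m n p)
    = cscale (c * - cnj (charge c1 c2 (m, n, p))) o\<^sub>L monomial m n p"
proof -
  show "tau c1 c2 (cscale c o\<^sub>L monomial m n p) = cscale (c * drift c1 c2 (m, n, p)) o\<^sub>L monomial m n p"
    unfolding tau_def linear_extension_diagonal by simp
  show d: "delta c1 c2 (cscale c o\<^sub>L monomial m n p) = cscale (c * charge c1 c2 (m, n, p)) o\<^sub>L monomial m n p" for c m n p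
    unfolding delta_def delta1_def delta2_def linear_extension_diagonal cscale_cscale cscale_add[symmetric]
    by (simp add: algebra_simps)
  show "delta_dagger c1 c2 (cscale c o\<^sub>L monomial m n p)
    = cscale (c * - cnj (charge c1 c2 (m, n, p))) o\<^sub>L monomial m n p"
    unfolding delta_dagger_def adj_scaled_monomial d by (simp add: algebra_simps)
qed

section \<open>Slices of the generator and the integral equation\<close>

lemma slice_phi:
  "slice (hat f s) (hat g s) (phi c1 c2 x) = tau c1 c2 x + (delta_dagger c1 c2 x o\<^sub>L cscale (g s))
     + (cscale (cnj (f s)) o\<^sub>L delta c1 c2 x)"
  by (rule blinfun_eqI)
    (simp add: slice_def hat_def phi_def sum_2 blinfun.add_left cscale.rep_eq)

lemma slice_phi_add:
  assumes "x \<in> rot_alg0" "y \<in> rot_alg0"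
  shows "slice (hat f s) (hat g s) (phi c1 c2 (x + y))
      = slice (hat f s) (hat g s) (phi c1 c2 x) + slice (hat f s) (hat g s) (phi c1 c2 y)"
    and "slice (hat f s) (hat g s) (phi c1 c2 x) \<in> rot_alg0"
  unfolding slice_phi generator_additive[OF assms]
  by (rule blinfun_eqI, simp add: blinfun.add_left blinfun.add_right)
    (intro rot_alg0_closed generator_additive[OF assms])

lemma slice_phi_scaled_monomial:
  "slice (hat f s) (hat g s) (phi c1 c2 (cscale c o\<^sub>L monomial m n p))
    = cscale (c * (drift c1 c2 (m, n, p) - cnj (charge c1 c2 (m, n, p)) * g s
        + charge c1 c2 (m, n, p) * cnj (f s))) o\<^sub>L monomial m n p"
proof -
  have "(cscale a o\<^sub>L monomial m n p) o\<^sub>L cscale b = cscale (a * b) o\<^sub>L monomial m n p" for a b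
    unfolding compose_assoc monomial_shift cscale_reindex_op cscale_cscale ..
  then show ?thesis
    unfolding slice_phi generator_scaled_monomial cscale_cscale
    by (simp add: algebra_simps flip: cscale_add)
qed

text \<open>Integrability accompanies the equation because the integral of a non-integrable function
  is zero by convention; it also makes the property additive in \<open>x\<close>.\<close>

definition solves_qsde where
  "solves_qsde c1 c2 x u v f g t \<longleftrightarrow>
     set_integrable lborel {0..t} (\<lambda>s. cinner (u \<otimes>\<^sub>h expv f)
       (flow c1 c2 s (slice (hat f s) (hat g s) (phi c1 c2 x)) (v \<otimes>\<^sub>h expv g))) \<and>
     cinner (u \<otimes>\<^sub>h expv f) (flow c1 c2 t x (v \<otimes>\<^sub>h expv g))
     = cinner (u \<otimes>\<^sub>h expv f) (x v \<otimes>\<^sub>h expv g)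
       + (LBINT s:{0..t}. cinner (u \<otimes>\<^sub>h expv f)
            (flow c1 c2 s (slice (hat f s) (hat g s) (phi c1 c2 x)) (v \<otimes>\<^sub>h expv g)))"

lemma cinner_flow_scaled_monomial:
  assumes "t \<ge> 0" "f \<in> L2 half_line" "g \<in> L2 half_line"
  shows "cinner (u \<otimes>\<^sub>h expv f) (flow c1 c2 t (cscale c o\<^sub>L monomial m n p) (v \<otimes>\<^sub>h expv g))
    = c * cinner u (monomial m n p v)
      * exp (l2_inner half_line f g + (of_real t * drift c1 c2 (m, n, p)
        - cnj (charge c1 c2 (m, n, p)) * l2_inner half_line (window t) g
        + charge c1 c2 (m, n, p) * cnj (l2_inner half_line (window t) f)))"
proof -
  have "flow c1 c2 t (cscale c o\<^sub>L monomial m n p)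
      = cscale c o\<^sub>L heis_unitary_rep.twist (weyl c1 c2 t) (m, n, p)"
    unfolding flow_def
    using unital_star_hom_flow[OF assms(1), of c1 c2] rot_alg0_subset[OF monomial_in_rot_alg0]
      heis_unitary_rep.lift_hom_monomial[OF heis_unitary_rep_weyl[OF assms(1), of c1 c2]]
    by (simp add: unital_star_hom_def flow_def)
  then show ?thesis by (simp only: cinner_twist_exp[OF assms] monomial_shift)
qed

text \<open>A monomial is an eigenvector of the sliced generator, and its eigenvalue
  \<open>k s\<close> is exactly the density of the exponent \<open>K\<close> of the matrix element.
  The equation thus reduces to the integral identity for \<open>exp (K t)\<close>.\<close>

lemma solves_qsde_scaled_monomial:
  assumes "t \<ge> 0" and f: "f \<in> L2 half_line" and g: "g \<in> L2 half_line"
  shows "solves_qsde c1 c2 (cscale c o\<^sub>L monomial m n p) u v f g t"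
proof -
  define d where "d = drift c1 c2 (m, n, p)"
  define z where "z = charge c1 c2 (m, n, p)"
  define A where "A = c * cinner u (monomial m n p v) * exp (l2_inner half_line f g)"
  define k where "k s = d - cnj z * g s + z * cnj (f s)" for s
  have if': "set_integrable lborel {0..s} f" and ig: "set_integrable lborel {0..s} g" for s
    using l2_inner_window(1) f g by auto
  have icf: "set_integrable lborel {0..s} (\<lambda>r. cnj (f r))" for s
    using integrable_cnj[OF if'[of s, unfolded set_integrable_def]] unfolding set_integrable_def by simp
  have id: "set_integrable lborel {0..s} (\<lambda>r. d)" for s :: real
    by (rule borel_integrable_compact[unfolded set_integrable_def[symmetric]]) auto
  have k: "set_integrable lborel {0..s} k" for s
    unfolding k_def[abs_def] by (intro set_integral_add set_integral_diff set_integrable_mult_right id ig icf)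
  have K: "(LBINT r:{0..s}. k r) = of_real s * d - cnj z * l2_inner half_line (window s) g
      + z * cnj (l2_inner half_line (window s) f)" if "s \<ge> 0" for s
  proof -
    have "(LBINT r:{0..s}. cnj (f r)) = cnj (LBINT r:{0..s}. f r)"
      unfolding set_lebesgue_integral_def by (subst Bochner_Integration.integral_cnj[symmetric]) simp
    moreover have "(LBINT r:{0..s}. d) = of_real s * d"
      using that by (simp add: set_integral_const scaleR_conv_of_real)
    ultimately show ?thesis
      unfolding k_def l2_inner_window(2)[OF f] l2_inner_window(2)[OF g]
      using set_integral_add(2)[OF set_integral_diff(1)[OF id set_integrable_mult_right[OF ig]] set_integrable_mult_right[OF icf]]
        set_integral_diff(2)[OF id set_integrable_mult_right[OF ig]]
      by (simp add: set_integral_mult_right)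
  qed
  define K where "K s = (LBINT r:{0..s}. k r)" for s
  \<comment> \<open>The free factor \<open>a\<close> serves both sides of the equation:
    \<open>a = k s\<close> gives the integrand and \<open>a = 1\<close> the matrix element
    itself.\<close>
  have E: "cinner (u \<otimes>\<^sub>h expv f) (flow c1 c2 s (cscale (c * a) o\<^sub>L monomial m n p) (v \<otimes>\<^sub>h expv g))
      = A * (a * exp (K s))" if "s \<ge> 0" for s a
    unfolding cinner_flow_scaled_monomial[OF that f g] A_def K_def K[OF that] exp_add d_def z_def
    by (simp only: mult_ac)
  have I: "cinner (u \<otimes>\<^sub>h expv f) (flow c1 c2 s
        (slice (hat f s) (hat g s) (phi c1 c2 (cscale c o\<^sub>L monomial m n p))) (v \<otimes>\<^sub>h expv g))
      = A * (k s * exp (K s))" if "s \<in> {0..t}" for s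
    unfolding slice_phi_scaled_monomial using E that by (simp add: k_def d_def z_def)
  have ki: "set_integrable lborel {0..t} (\<lambda>s. k s * exp (K s))"
    and ke: "exp (K t) = 1 + (LBINT s:{0..t}. k s * exp (K s))"
    using set_integral_exp_integral[OF k assms(1)] by (simp_all add: K_def[abs_def])
  have "set_integrable lborel {0..t} (\<lambda>s. A * (k s * exp (K s)))"
    using ki by (rule set_integrable_mult_right)
  then have i: "set_integrable lborel {0..t} (\<lambda>s. cinner (u \<otimes>\<^sub>h expv f) (flow c1 c2 s
        (slice (hat f s) (hat g s) (phi c1 c2 (cscale c o\<^sub>L monomial m n p))) (v \<otimes>\<^sub>h expv g)))"
    by (rule set_integrable_cong[THEN iffD2, rotated 3]) (rule refl, rule refl, erule I)
  have "(LBINT s:{0..t}. cinner (u \<otimes>\<^sub>h expv f) (flow c1 c2 s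
        (slice (hat f s) (hat g s) (phi c1 c2 (cscale c o\<^sub>L monomial m n p))) (v \<otimes>\<^sub>h expv g)))
      = (LBINT s:{0..t}. A * (k s * exp (K s)))"
    using I by (intro set_lebesgue_integral_cong) auto
  also have "\<dots> = A * (LBINT s:{0..t}. k s * exp (K s))" by (rule set_integral_mult_right)
  also have "\<dots> = A * exp (K t) - A" unfolding ke by (simp add: algebra_simps)
  also have "A * exp (K t) = cinner (u \<otimes>\<^sub>h expv f) (flow c1 c2 t (cscale c o\<^sub>L monomial m n p) (v \<otimes>\<^sub>h expv g))"
    using E[OF assms(1), of 1] by simp
  also have "A = cinner (u \<otimes>\<^sub>h expv f) ((cscale c o\<^sub>L monomial m n p) v \<otimes>\<^sub>h expv g)"
    by (simp add: A_def cinner_tensor cscale.rep_eq cinner_scaleC_right cinner_expv f g)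
  finally show ?thesis using i unfolding solves_qsde_def by simp
qed

lemma tensor_add_left: "(u + v) \<otimes>\<^sub>h \<xi> = u \<otimes>\<^sub>h \<xi> + v \<otimes>\<^sub>h \<xi>"
  by transfer (simp add: scaleC_add_left)

lemma solves_qsde_add:
  assumes "x \<in> rot_alg0" "y \<in> rot_alg0" "t \<ge> 0"
    and "solves_qsde c1 c2 x u v f g t" "solves_qsde c1 c2 y u v f g t"
  shows "solves_qsde c1 c2 (x + y) u v f g t"
proof -
  define I where "I x s = cinner (u \<otimes>\<^sub>h expv f)
    (flow c1 c2 s (slice (hat f s) (hat g s) (phi c1 c2 x)) (v \<otimes>\<^sub>h expv g))" for x s
  have flow: "flow c1 c2 s (a + b) = flow c1 c2 s a + flow c1 c2 s b"
    if "s \<ge> 0" "a \<in> rot_alg0" "b \<in> rot_alg0" for s a b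
    using unital_star_hom_flow[OF that(1)] that(2,3)[THEN rot_alg0_subset] by (simp add: unital_star_hom_def)
  have I: "I (x + y) s = I x s + I y s" if "s \<in> {0..t}" for s
    using that slice_phi_add[OF assms(1,2)] slice_phi_add(2)[OF assms(2,1)]
    by (simp add: I_def flow blinfun.add_left cinner_add_right)
  have i: "set_integrable lborel {0..t} (I x)" "set_integrable lborel {0..t} (I y)"
    using assms(4,5) by (simp_all add: solves_qsde_def I_def[abs_def])
  have "set_integrable lborel {0..t} (\<lambda>s. I x s + I y s)" using i by (rule set_integral_add)
  then have 1: "set_integrable lborel {0..t} (I (x + y))"
    by (rule set_integrable_cong[THEN iffD2, rotated 3]) (rule refl, rule refl, erule I)
  have "(LBINT s:{0..t}. I (x + y) s) = (LBINT s:{0..t}. I x s + I y s)"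
    using I by (intro set_lebesgue_integral_cong) auto
  then have 2: "(LBINT s:{0..t}. I (x + y) s) = (LBINT s:{0..t}. I x s) + (LBINT s:{0..t}. I y s)"
    using set_integral_add(2)[OF i] by simp
  show ?thesis
    using assms(4,5) 1 2 unfolding solves_qsde_def I_def[symmetric]
    by (simp add: flow assms blinfun.add_left cinner_add_right tensor_add_left)
qed

lemma solves_qsde:
  assumes "f \<in> L2 half_line" "g \<in> L2 half_line" "x \<in> rot_alg0" "t \<ge> 0"
  shows "solves_qsde c1 c2 x u v f g t"
proof -
  have "x \<in> rot_alg0 \<and> solves_qsde c1 c2 x u v f g t"
    using assms(3) unfolding rot_alg0_span
  proof (induction rule: span_induct_alt)
    case base
    \<comment> \<open>The zero operator is treated as a scaled monomial with coefficient
      zero.\<close>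
    have "cscale 0 o\<^sub>L monomial 0 0 0 = 0" by (rule blinfun_eqI) (simp add: cscale.rep_eq)
    then show ?case using solves_qsde_scaled_monomial[OF assms(4,1,2), of c1 c2 0 0 0 0]
      by (simp add: span_zero)
  next
    case (step r s x)
    obtain c m n p where s: "s = cscale c o\<^sub>L monomial m n p"
      using step(1) unfolding scaled_monomials_def by blast
    have rs: "r *\<^sub>R s = cscale (complex_of_real r * c) o\<^sub>L monomial m n p"
      unfolding s by (simp flip: cscale_cscale add: cscale_scaleR)
    have in0: "r *\<^sub>R s \<in> span scaled_monomials" by (intro span_scale span_base step)
    have "solves_qsde c1 c2 (r *\<^sub>R s) u v f g t"
      unfolding rs by (rule solves_qsde_scaled_monomial[OF assms(4,1,2)])
    then show ?case
      using step(2) in0 assms(4) by (auto intro: span_add solves_qsde_add simp: rot_alg0_span)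
  qed
  then show ?thesis ..
qed

theorem theorem6p18:
  fixes c1 c2 :: complex
  shows "\<exists>j :: real \<Rightarrow> (h_space \<Rightarrow>\<^sub>L h_space) \<Rightarrow> (h_fock \<Rightarrow>\<^sub>L h_fock).
    (\<forall>t\<ge>0. unital_star_hom rot_alg (j t)) \<and>
    adapted rot_alg j \<and>
    (\<forall>u v. \<forall>f\<in>L2 half_line. \<forall>g\<in>L2 half_line. \<forall>x\<in>rot_alg0. \<forall>t\<ge>0.
       set_integrable lborel {0..t} (\<lambda>s. cinner (u \<otimes>\<^sub>h expv f)
         (j s (slice (hat f s) (hat g s) (phi c1 c2 x)) (v \<otimes>\<^sub>h expv g))) \<and>
       cinner (u \<otimes>\<^sub>h expv f) (j t x (v \<otimes>\<^sub>h expv g))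
       = cinner (u \<otimes>\<^sub>h expv f) (x v \<otimes>\<^sub>h expv g)
         + (LBINT s:{0..t}. cinner (u \<otimes>\<^sub>h expv f)
              (j s (slice (hat f s) (hat g s) (phi c1 c2 x)) (v \<otimes>\<^sub>h expv g))))"
proof (intro exI[of _ "flow c1 c2"] conjI)
  show "\<forall>t\<ge>0. unital_star_hom rot_alg (flow c1 c2 t)" by (simp add: unital_star_hom_flow)
  show "adapted rot_alg (flow c1 c2)" by (rule adapted_flow)
qed (use solves_qsde[unfolded solves_qsde_def] in blast)

end
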